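(* There is an algorithm which, given a finite set $\Sigma$, a candidate data structure $C$ for an antimatroid $A$ on $\Sigma$, and a comparison oracle for a total order $\pi\in\mathcal{P}(A)$, sorts $\Sigma$ with respect to $\prec_\pi$ (that is, outputs $\pi$) in time $\mathcal{O}(t^{\mathrm{total}}(C)+\log|\mathcal{P}(A)|)$ and with $\mathcal{O}(\log|\mathcal{P}(A)|)$ comparisons.
   Context: Model: word RAM; a comparison oracle for $\pi$ answers queries "$x\prec_\pi y$?" in constant time, and each query is one comparison. Logarithms are base 2 and constants in $\mathcal{O}(\cdot)$ are absolute. A simple word on $\Sigma$ is a finite sequence of pairwise distinct letters of $\Sigma$; $\tilde\alpha$ is the set of letters of $\alpha$; $\Sigma^*_{\mathrm{s}}$ is the set of simple words. An antimatroid on $\Sigma$ is a set $A\subseteq\Sigma^*_{\mathrm{s}}$ such that (i) if $\alpha x\in A$ with $\alpha\in\Sigma^*_{\mathrm{s}}$, $x\in\Sigma\setminus\tilde\alpha$, then $\alpha\in A$; and (ii) for all $\alpha,\beta\in A$ with $\tilde\alpha\not\subseteq\tilde\beta$ there is $x\in\tilde\alpha\setminus\tilde\beta$ with $\beta x\in A$. $\mathcal{P}(A)$ is the set of permutations of $\Sigma$ (simple words containing all letters) belonging to $A$. A permutation $\pi$ is identified with the total order $\prec_\pi$, where $x\prec_\pi y$ iff $x$ precedes $y$ in $\pi$. A monotone precedence system (MPS) on $\Sigma$ is a collection $S=\{p_x\}_{x\in\Sigma}$ of functions $p_x\colon2^{\Sigma\setminus\{x\}}\to\{0,1\}$ with $p_x(X)\le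 p_x(Y)$ whenever $X\subseteq Y$; its language is $\mathcal{L}(S)=\{x_1\dots x_k\in\Sigma^*_{\mathrm{s}}\mid\forall i\in[k]:p_{x_i}(\{x_1,\dots,x_{i-1}\})=1\}$. The nonempty antimatroids on $\Sigma$ are exactly the languages of MPSs. A candidate data structure $C$ for an antimatroid $A=\mathcal{L}(S)$, $S=\{p_x\}_{x\in\Sigma}$, maintains a set $X\subseteq\Sigma$ and supports: $C.\mathtt{init}()$, which sets $X\gets\emptyset$ and reports all $x\in\Sigma$ with $p_x(\emptyset)=1$; and $C.\mathtt{step}(x)$, which, given $x\in\Sigma\setminus X$ with $p_x(X)=1$, reports all $y\in\Sigma$ that were not available before and become available, i.e. with $p_y(X)=0$ and $p_y(X\cup\{x\})=1$, and then adds $x$ to $X$. The total time $t^{\mathrm{total}}(C)$ is the worst-case overall time for one call to $\mathtt{init}$ followed by any valid sequence of $\mathtt{step}$ calls. *)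

theory Defs
  imports Complex_Main "HOL-Combinatorics.Multiset_Permutations"
begin

section \<open>Antimatroids and monotone precedence systems\<close>

definition simple_words :: "'a set \<Rightarrow> 'a list set" where
  "simple_words \<Sigma> = {\<alpha>. set \<alpha> \<subseteq> \<Sigma> \<and> distinct \<alpha>}"

definition antimatroid :: "'a set \<Rightarrow> 'a list set \<Rightarrow> bool" where
  "antimatroid \<Sigma> A \<longleftrightarrow>
     A \<subseteq> simple_words \<Sigma> \<and>
     (\<forall>\<alpha>\<in>simple_words \<Sigma>. \<forall>x\<in>\<Sigma> - set \<alpha>. \<alpha> @ [x] \<in> A \<longrightarrow> \<alpha> \<in> A) \<and>
     (\<forall>\<alpha>\<in>A. \<forall>\<beta>\<in>A. \<not> set \<alpha> \<subseteq> set \<beta> \<longrightarrow> (\<exists>x\<in>set \<alpha> - set \<beta>. \<beta> @ [x] \<in> A))"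

definition antimatroid_perms :: "'a set \<Rightarrow> 'a list set \<Rightarrow> 'a list set" where
  "antimatroid_perms \<Sigma> A = A \<inter> permutations_of_set \<Sigma>"

definition precedes :: "'a list \<Rightarrow> 'a \<Rightarrow> 'a \<Rightarrow> bool" where
  "precedes \<pi> x y \<longleftrightarrow> (\<exists>i j. i < j \<and> j < length \<pi> \<and> \<pi> ! i = x \<and> \<pi> ! j = y)"

text \<open>
  The value \<open>p x X\<close> is meaningful only for \<open>x \<in> \<Sigma>\<close> and \<open>X \<subseteq> \<Sigma> - {x}\<close>; no definition below
  depends on it for other arguments.
\<close>

definition mps :: "'a set \<Rightarrow> ('a \<Rightarrow> 'a set \<Rightarrow> bool) \<Rightarrow> bool" where
  "mps \<Sigma> p \<longleftrightarrow>
     (\<forall>x\<in>\<Sigma>. \<forall>X Y. X \<subseteq> Y \<and> Y \<subseteq> \<Sigma> - {x} \<longrightarrow> p x X \<longrightarrow> p x Y)"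

definition mps_language :: "'a set \<Rightarrow> ('a \<Rightarrow> 'a set \<Rightarrow> bool) \<Rightarrow> 'a list set" where
  "mps_language \<Sigma> p =
     {\<alpha> \<in> simple_words \<Sigma>. \<forall>i<length \<alpha>. p (\<alpha> ! i) (set (take i \<alpha>))}"


section \<open>Candidate data structures\<close>

text \<open>
  A candidate data structure is a black box, described by its observable behaviour as a function of
  the sequence \<open>\<alpha>\<close> of letters passed to \<open>step\<close> since the last call to \<open>init\<close>. The last call
  of this history (\<open>init\<close> if \<open>\<alpha> = []\<close>, and \<open>step (last \<alpha>)\<close> otherwise) reports the letters
  \<open>reports C \<alpha>\<close>, in this order, and takes time \<open>cost C \<alpha>\<close>. The set maintained after this
  call is \<open>set \<alpha>\<close>.
\<close>

record 'a candidate_ds =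
  reports :: "'a list \<Rightarrow> 'a list"
  cost :: "'a list \<Rightarrow> nat"

text \<open>
  The last conjunct reflects that on a RAM each call, and the reporting of each letter, takes at
  least one unit of time.
\<close>

definition is_candidate_ds ::
    "'a set \<Rightarrow> ('a \<Rightarrow> 'a set \<Rightarrow> bool) \<Rightarrow> 'a candidate_ds \<Rightarrow> bool" where
  "is_candidate_ds \<Sigma> p C \<longleftrightarrow>
     set (reports C []) = {y \<in> \<Sigma>. p y {}} \<and>
     (\<forall>\<alpha>\<in>mps_language \<Sigma> p. \<forall>x\<in>\<Sigma> - set \<alpha>. p x (set \<alpha>) \<longrightarrow>
        set (reports C (\<alpha> @ [x])) =
          {y \<in> \<Sigma> - insert x (set \<alpha>). \<not> p y (set \<alpha>) \<and> p y (insert x (set \<alpha>))}) \<and>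
     (\<forall>\<alpha>\<in>mps_language \<Sigma> p.
        distinct (reports C \<alpha>) \<and> 1 + length (reports C \<alpha>) \<le> cost C \<alpha>)"

text \<open>
  The valid histories are exactly the words of the antimatroid, so the worst case is taken over a
  finite set.
\<close>

definition total_time :: "'a list set \<Rightarrow> 'a candidate_ds \<Rightarrow> nat" where
  "total_time A C = Max ((\<lambda>\<alpha>. \<Sum>i\<le>length \<alpha>. cost C (take i \<alpha>)) ` A)"

lemma finite_mps_language:
  assumes "finite \<Sigma>"
  shows "finite (mps_language \<Sigma> p)"
  by (rule finite_subset[OF _ finite_subset_distinct[OF assms]])
     (auto simp: mps_language_def simple_words_def)

lemma Nil_in_mps_language: "[] \<in> mps_language \<Sigma> p"
  by (simp add: mps_language_def simple_words_def)

lemma snoc_in_mps_language_iff: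
  "\<alpha> @ [x] \<in> mps_language \<Sigma> p \<longleftrightarrow>
     \<alpha> \<in> mps_language \<Sigma> p \<and> x \<in> \<Sigma> - set \<alpha> \<and> p x (set \<alpha>)"
  by (auto simp: mps_language_def simple_words_def nth_append less_Suc_eq)


section \<open>A word RAM with a comparison instruction and calls to a candidate data structure\<close>

text \<open>
  Programs are goto-free. A program mentions finitely many registers by name; registers and memory
  cells hold \<open>w\<close>-bit words, represented as natural numbers less than \<open>2 ^ w\<close>, and memory is
  addressed by words. A program does not depend on \<open>w\<close>.
\<close>

type_synonym reg = nat

datatype binop = Add | Sub | Mul | Div | Mod | And | Or | Xor | Shl | Shr | Less | Equal

fun binop_val :: "nat \<Rightarrow> binop \<Rightarrow> nat \<Rightarrow> nat \<Rightarrow> nat" where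
  "binop_val w Add a b = (a + b) mod 2 ^ w"
| "binop_val w Sub a b = (a + (2 ^ w - b)) mod 2 ^ w"
| "binop_val w Mul a b = (a * b) mod 2 ^ w"
| "binop_val w Div a b = a div b"
| "binop_val w Mod a b = a mod b"
| "binop_val w And a b = Bit_Operations.and a b"
| "binop_val w Or a b = Bit_Operations.or a b"
| "binop_val w Xor a b = Bit_Operations.xor a b"
| "binop_val w Shl a b = push_bit b a mod 2 ^ w"
| "binop_val w Shr a b = drop_bit b a"
| "binop_val w Less a b = of_bool (a < b)"
| "binop_val w Equal a b = of_bool (a = b)"

text \<open>
  \<open>Compare r a b\<close> asks whether the letter in register \<open>a\<close> precedes the letter in register
  \<open>b\<close>. \<open>CallInit a r\<close> and \<open>CallStep x a r\<close> (with the letter in register \<open>x\<close>) write the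
  reported letters to consecutive memory cells starting at the address in register \<open>a\<close>, and
  then their number to register \<open>r\<close>.
\<close>

datatype com =
    Skip
  | Const reg nat
  | Move reg reg
  | Bin binop reg reg reg
  | Load reg reg
  | Store reg reg
  | Compare reg reg reg
  | CallInit reg reg
  | CallStep reg reg reg
  | Seq com com
  | IfNZ reg com com
  | WhileNZ reg com

text \<open>
  The component \<open>hist\<close> is the history of the candidate data structure, which is \<open>None\<close> before
  the first call to \<open>init\<close>. It can be accessed only through the calls.
\<close>

record state =
  regs :: "reg \<Rightarrow> nat"
  mem :: "nat \<Rightarrow> nat"
  hist :: "nat list option"

definition write_block :: "nat \<Rightarrow> nat list \<Rightarrow> (nat \<Rightarrow> nat) \<Rightarrow> nat \<Rightarrow> nat" where
  "write_block b ys m =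
     (\<lambda>i. if b \<le> i \<and> i < b + length ys then ys ! (i - b) else m i)"

text \<open>
  \<open>exec w A C \<pi> c s s' t q\<close>: on words of \<open>w\<close> bits, the program \<open>c\<close> started in \<open>s\<close>
  terminates in \<open>s'\<close> after time \<open>t\<close> and \<open>q\<close> comparisons. There is no execution that
  compares non-letters, calls \<open>step\<close> on a letter that is not available (\<open>h @ [x] \<notin> A\<close>)
  or before \<open>init\<close>, or lets reported letters run past the end of memory. Repeated calls to
  \<open>init\<close> are allowed; each is charged.
\<close>

inductive exec ::
    "nat \<Rightarrow> nat list set \<Rightarrow> nat candidate_ds \<Rightarrow> nat list \<Rightarrow>
     com \<Rightarrow> state \<Rightarrow> state \<Rightarrow> nat \<Rightarrow> nat \<Rightarrow> bool"
  for w A C \<pi> where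
  Skip: "exec w A C \<pi> Skip s s 1 0"
| Const: "exec w A C \<pi> (Const r k) s (s\<lparr>regs := (regs s)(r := k mod 2 ^ w)\<rparr>) 1 0"
| Move: "exec w A C \<pi> (Move r a) s (s\<lparr>regs := (regs s)(r := regs s a)\<rparr>) 1 0"
| Bin: "exec w A C \<pi> (Bin f r a b) s
          (s\<lparr>regs := (regs s)(r := binop_val w f (regs s a) (regs s b))\<rparr>) 1 0"
| Load: "exec w A C \<pi> (Load r a) s (s\<lparr>regs := (regs s)(r := mem s (regs s a))\<rparr>) 1 0"
| Store: "exec w A C \<pi> (Store a r) s (s\<lparr>mem := (mem s)(regs s a := regs s r)\<rparr>) 1 0"
| Compare: "regs s a \<in> set \<pi> \<Longrightarrow> regs s b \<in> set \<pi> \<Longrightarrow>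
     exec w A C \<pi> (Compare r a b) s
       (s\<lparr>regs := (regs s)(r := of_bool (precedes \<pi> (regs s a) (regs s b)))\<rparr>) 1 1"
| CallInit: "ys = reports C [] \<Longrightarrow> regs s a + length ys \<le> 2 ^ w \<Longrightarrow>
     exec w A C \<pi> (CallInit a r) s
       (s\<lparr>regs := (regs s)(r := length ys mod 2 ^ w),
          mem := write_block (regs s a) ys (mem s), hist := Some []\<rparr>) (cost C []) 0"
| CallStep: "hist s = Some h \<Longrightarrow> h' = h @ [regs s x] \<Longrightarrow> h' \<in> A \<Longrightarrow>
     ys = reports C h' \<Longrightarrow> regs s a + length ys \<le> 2 ^ w \<Longrightarrow>
     exec w A C \<pi> (CallStep x a r) s
       (s\<lparr>regs := (regs s)(r := length ys mod 2 ^ w),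
          mem := write_block (regs s a) ys (mem s), hist := Some h'\<rparr>) (cost C h') 0"
| Seq: "exec w A C \<pi> c s s' t q \<Longrightarrow> exec w A C \<pi> d s' s'' t' q' \<Longrightarrow>
     exec w A C \<pi> (Seq c d) s s'' (t + t') (q + q')"
| IfTrue: "regs s r \<noteq> 0 \<Longrightarrow> exec w A C \<pi> c s s' t q \<Longrightarrow>
     exec w A C \<pi> (IfNZ r c d) s s' (1 + t) q"
| IfFalse: "regs s r = 0 \<Longrightarrow> exec w A C \<pi> d s s' t q \<Longrightarrow>
     exec w A C \<pi> (IfNZ r c d) s s' (1 + t) q"
| WhileFalse: "regs s r = 0 \<Longrightarrow> exec w A C \<pi> (WhileNZ r c) s s 1 0"
| WhileTrue: "regs s r \<noteq> 0 \<Longrightarrow> exec w A C \<pi> c s s' t q \<Longrightarrow>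
     exec w A C \<pi> (WhileNZ r c) s' s'' t' q' \<Longrightarrow>
     exec w A C \<pi> (WhileNZ r c) s s'' (1 + t + t') (q + q')"

inductive_cases exec_SkipE: "exec w A C \<pi> Skip s s' t q"
inductive_cases exec_ConstE: "exec w A C \<pi> (Const r k) s s' t q"
inductive_cases exec_MoveE: "exec w A C \<pi> (Move r a) s s' t q"
inductive_cases exec_BinE: "exec w A C \<pi> (Bin f r a b) s s' t q"
inductive_cases exec_LoadE: "exec w A C \<pi> (Load r a) s s' t q"
inductive_cases exec_StoreE: "exec w A C \<pi> (Store a r) s s' t q"
inductive_cases exec_CompareE: "exec w A C \<pi> (Compare r a b) s s' t q"
inductive_cases exec_CallInitE: "exec w A C \<pi> (CallInit a r) s s' t q"
inductive_cases exec_CallStepE: "exec w A C \<pi> (CallStep x a r) s s' t q"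
inductive_cases exec_SeqE: "exec w A C \<pi> (Seq c d) s s' t q"
inductive_cases exec_IfE: "exec w A C \<pi> (IfNZ r c d) s s' t q"
inductive_cases exec_WhileE: "exec w A C \<pi> (WhileNZ r c) s s' t q"

lemma exec_deterministic:
  assumes "exec w A C \<pi> c s s1 t1 q1" and "exec w A C \<pi> c s s2 t2 q2"
  shows "s1 = s2 \<and> t1 = t2 \<and> q1 = q2"
  using assms
proof (induction arbitrary: s2 t2 q2)
  case (Seq c s s' t q d s'' t' q')
  from Seq.prems show ?case
  proof (rule exec_SeqE)
    fix u v1 v2 r1 r2
    assume eq: "t2 = v1 + v2" "q2 = r1 + r2"
      and c: "exec w A C \<pi> c s u v1 r1" and d: "exec w A C \<pi> d u s2 v2 r2"
    have 1: "s' = u \<and> t = v1 \<and> q = r1" by (rule Seq.IH(1)[OF c])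
    have "exec w A C \<pi> d s' s2 v2 r2" using d 1 by metis
    from Seq.IH(2)[OF this] 1 eq show ?thesis by metis
  qed
next
  case (IfTrue s r c s' t q d)
  from IfTrue.prems show ?case
  proof (rule exec_IfE)
    fix v assume eq: "t2 = Suc v" and c: "exec w A C \<pi> c s s2 v q2"
    from IfTrue.IH[OF c] eq show ?thesis by (metis plus_1_eq_Suc)
  next
    assume "regs s r = 0"
    then show ?thesis using IfTrue.hyps(1) by metis
  qed
next
  case (IfFalse s r d s' t q c)
  from IfFalse.prems show ?case
  proof (rule exec_IfE)
    assume "0 < regs s r"
    then show ?thesis using IfFalse.hyps(1) by simp
  next
    fix v assume eq: "t2 = Suc v" and c: "exec w A C \<pi> d s s2 v q2"
    from IfFalse.IH[OF c] eq show ?thesis by (metis plus_1_eq_Suc)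
  qed
next
  case (WhileFalse s r c)
  from WhileFalse.prems show ?case
    by (rule exec_WhileE) (use WhileFalse.hyps in simp)+
next
  case (WhileTrue s r c s' t q s'' t' q')
  from WhileTrue.prems show ?case
  proof (rule exec_WhileE)
    assume "regs s r = 0"
    then show ?thesis using WhileTrue.hyps(1) by metis
  next
    fix u v1 r1 v2 r2
    assume eq: "t2 = Suc (v1 + v2)" "q2 = r1 + r2"
      and c: "exec w A C \<pi> c s u v1 r1" and d: "exec w A C \<pi> (WhileNZ r c) u s2 v2 r2"
    have 1: "s' = u \<and> t = v1 \<and> q = r1" by (rule WhileTrue.IH(1)[OF c])
    have "exec w A C \<pi> (WhileNZ r c) s' s2 v2 r2" using d 1 by metis
    from WhileTrue.IH(2)[OF this] 1 eq show ?thesis by (metis plus_1_eq_Suc add.assoc)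
  qed
next
  case (CallStep s h h' x ys a r)
  from CallStep.prems show ?case
    by (rule exec_CallStepE) (use CallStep.hyps in simp)
next
  case Skip
  from Skip.prems show ?case by (rule exec_SkipE) simp
next
  case Const
  from Const.prems show ?case by (rule exec_ConstE) simp
next
  case Move
  from Move.prems show ?case by (rule exec_MoveE) simp
next
  case Bin
  from Bin.prems show ?case by (rule exec_BinE) simp
next
  case Load
  from Load.prems show ?case by (rule exec_LoadE) simp
next
  case Store
  from Store.prems show ?case by (rule exec_StoreE) simp
next
  case Compare
  from Compare.prems show ?case by (rule exec_CompareE) simp
next
  case CallInit
  from CallInit.prems show ?case by (rule exec_CallInitE) (use CallInit.hyps in simp)
qed

text \<open>
  The input is an array at address 0 listing the letters in some order, with its length in
  register 0. All other registers and memory cells hold arbitrary words. The output array is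
  again at address 0.
\<close>

definition input_state :: "nat \<Rightarrow> nat list \<Rightarrow> state \<Rightarrow> bool" where
  "input_state w xs s \<longleftrightarrow>
     (\<forall>r. regs s r < 2 ^ w) \<and> (\<forall>i. mem s i < 2 ^ w) \<and> hist s = None \<and>
     regs s 0 = length xs \<and> (\<forall>i<length xs. mem s i = xs ! i)"

definition output_word :: "nat \<Rightarrow> state \<Rightarrow> nat list" where
  "output_word n s = map (mem s) [0..<n]"

end

theory Submission
  imports Defs "HOL-Library.Discrete_Functions" "HOL-Library.FuncSet"
begin

text \<open>
  Let the layers of \<open>\<Sigma>\<close> be formed by repeatedly performing all available steps at once. Permuting
  the layers internally shows that all letters outside singleton layers number
  \<open>\<O>(log |P(A)|)\<close>, while the letters of the singleton layers, the bottlenecks, occur in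
  layer order in every word of the antimatroid, so they are sorted without any comparison.

  The letters are then output in the order \<open>\<pi>\<close>, again following the reports of the data structure. The
  available letters that are not bottlenecks are kept in a heap. When such a letter first becomes the
  minimum, its place among the remaining bottlenecks is found by exponential search. The next letter
  is the minimum if its place is reached, and the next bottleneck otherwise.

  The search for \<open>b\<close> costs the logarithm of the number of bottlenecks output while \<open>b\<close> is
  available, and removing \<open>b\<close> from the heap costs the logarithm of the number of letters inserted
  while \<open>b\<close> is in the heap. Moving letters of \<open>\<pi>\<close> forward, independently of each other, within these
  intervals gives enough elements of \<open>P(A)\<close> to pay for both.
\<close>

section \<open>Reordering a permutation of the antimatroid\<close>

text \<open>The bound on comparisons has no additive term: each comparison must be charged to the
  freedom of some non-bottleneck letter, and if \<open>P(A)\<close> is a singleton none may be made.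
  The size of an ordinary heap says nothing about the freedom of the letter removed. The heap used
  here therefore keeps sorted lists on levels and lets a node climb only as it ages: a node on level
  \<open>i > 0\<close> has seen at least \<open>2 ^ (i - 1)\<close> insertions after its own. Merges
  are paid for in arrears, when the node they lifted is removed.

  The two counts behind the overview's last sentence differ. Searches are measured against the
  bottlenecks, which stay in place, so the position of a moved letter can be read off the new
  permutation. Removals are measured in insertions of letters that are moved themselves; different
  choices may then give the same permutation. This loses a factor \<open>4 ^ m\<close> for
  \<open>m\<close> non-bottlenecks, which is harmless because \<open>2 ^ m\<close> is at most the
  square of \<open>|P(A)|\<close>.

  Linear terms in the time are absorbed by the cost of the data structure, where each call and each
  report takes at least one unit.\<close>

definition idx :: "'a list \<Rightarrow> 'a \<Rightarrow> nat" where
  "idx xs x = length (takeWhile (\<lambda>y. y \<noteq> x) xs)"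

lemma idx_less_length: "x \<in> set xs \<Longrightarrow> idx xs x < length xs"
  by (induction xs) (auto simp: idx_def)

lemma nth_idx: "x \<in> set xs \<Longrightarrow> xs ! idx xs x = x"
  by (induction xs) (auto simp: idx_def)

lemma idx_nth: "distinct xs \<Longrightarrow> i < length xs \<Longrightarrow> idx xs (xs ! i) = i"
  using nth_eq_iff_index_eq[of xs "idx xs (xs ! i)" i]
  by (simp add: idx_less_length nth_idx)

lemma idx_inj: "x \<in> set xs \<Longrightarrow> y \<in> set xs \<Longrightarrow> idx xs x = idx xs y \<longleftrightarrow> x = y"
  by (metis nth_idx)

lemma in_set_take_iff_idx:
  "distinct xs \<Longrightarrow> x \<in> set (take j xs) \<longleftrightarrow> x \<in> set xs \<and> idx xs x < j"
  by (auto simp: in_set_conv_nth idx_nth)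

lemma precedes_iff_idx:
  "distinct xs \<Longrightarrow> x \<in> set xs \<Longrightarrow> y \<in> set xs \<Longrightarrow> precedes xs x y \<longleftrightarrow> idx xs x < idx xs y"
  unfolding precedes_def
  by (metis idx_less_length idx_nth nth_idx order.strict_trans)

lemma idx_sort_key_less_iff:
  fixes g :: "'a \<Rightarrow> nat"
  assumes "distinct xs" "inj_on g (set xs)" "x \<in> set xs" "y \<in> set xs"
  shows "idx (sort_key g xs) x < idx (sort_key g xs) y \<longleftrightarrow> g x < g y"
proof -
  let ?t = "sort_key g xs"
  have t: "set ?t = set xs" "distinct ?t" "sorted (map g ?t)"
    using assms(1) by auto
  have le: "idx ?t u \<le> idx ?t v \<Longrightarrow> g u \<le> g v" if "u \<in> set xs" "v \<in> set xs" for u v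
    using sorted_nth_mono[OF t(3), of "idx ?t u" "idx ?t v"] that
      idx_less_length[of u ?t] idx_less_length[of v ?t] nth_idx[of u ?t] nth_idx[of v ?t] by simp
  show ?thesis
    using le[OF assms(3,4)] le[OF assms(4,3)] assms(2-4) idx_inj[of x ?t y] t(1)
    by (metis antisym_conv2 inj_onD leD nat_le_linear nat_less_le)
qed

text \<open>Availability is monotone: as long as some prefix of \<open>\<pi>\<close> that makes
  \<open>x\<close> available is still placed before \<open>x\<close>, whatever else precedes
  \<open>x\<close> in the new order does no harm.\<close>

lemma sort_key_in_antimatroid_perms:
  fixes g :: "'a \<Rightarrow> nat"
  assumes mps: "mps \<Sigma> p" and \<pi>: "\<pi> \<in> antimatroid_perms \<Sigma> (mps_language \<Sigma> p)"
    and inj: "inj_on g \<Sigma>"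
    and avail: "\<And>x. x \<in> \<Sigma> \<Longrightarrow>
      \<exists>j\<le>idx \<pi> x. p x (set (take j \<pi>)) \<and> (\<forall>y\<in>set (take j \<pi>). g y < g x)"
  shows "sort_key g \<pi> \<in> antimatroid_perms \<Sigma> (mps_language \<Sigma> p)"
proof -
  let ?t = "sort_key g \<pi>"
  have p: "distinct \<pi>" "set \<pi> = \<Sigma>"
    using \<pi> by (auto simp: antimatroid_perms_def permutations_of_set_def)
  then have t: "set ?t = \<Sigma>" "distinct ?t" by auto
  have "p (?t ! i) (set (take i ?t))" if i: "i < length ?t" for i
  proof -
    let ?x = "?t ! i"
    have x: "?x \<in> \<Sigma>" using i t nth_mem by blast
    obtain j where j: "j \<le> idx \<pi> ?x" "p ?x (set (take j \<pi>))" "\<And>y. y \<in> set (take j \<pi>) \<Longrightarrow> g y < g ?x"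
      using avail[OF x] by blast
    have "set (take j \<pi>) \<subseteq> set (take i ?t)"
    proof
      fix y assume y: "y \<in> set (take j \<pi>)"
      have "idx ?t y < idx ?t ?x"
        using idx_sort_key_less_iff[OF p(1), of g y ?x] inj x j(3)[OF y] p(2) in_set_takeD[OF y] by auto
      also have "idx ?t ?x = i" using idx_nth[OF t(2) i] .
      finally show "y \<in> set (take i ?t)"
        using in_set_take_iff_idx[OF t(2)] t(1) p(2) in_set_takeD[OF y] by simp
    qed
    moreover have "set (take i ?t) \<subseteq> \<Sigma> - {?x}"
    proof
      fix y assume y: "y \<in> set (take i ?t)"
      then have "y \<in> \<Sigma>" using t(1) by (meson in_set_takeD)
      moreover have "y \<noteq> ?x" using y in_set_take_iff_idx[OF t(2), of y i] idx_nth[OF t(2) i] by auto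
      ultimately show "y \<in> \<Sigma> - {?x}" by blast
    qed
    ultimately show ?thesis using mps j(2) x unfolding mps_def by meson
  qed
  then show ?thesis using t
    by (auto simp: antimatroid_perms_def permutations_of_set_def mps_language_def simple_words_def)
qed

lemma finite_antimatroid_perms: "finite \<Sigma> \<Longrightarrow> finite (antimatroid_perms \<Sigma> A)"
  by (simp add: antimatroid_perms_def)

lemma antimatroid_permsD:
  assumes "\<pi> \<in> antimatroid_perms \<Sigma> (mps_language \<Sigma> p)"
  shows "distinct \<pi>" "set \<pi> = \<Sigma>" "\<pi> \<in> mps_language \<Sigma> p"
    and "x \<in> \<Sigma> \<Longrightarrow> p x (set (take (idx \<pi> x) \<pi>))"
proof -
  show 1: "distinct \<pi>" "set \<pi> = \<Sigma>" "\<pi> \<in> mps_language \<Sigma> p"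
    using assms by (auto simp: antimatroid_perms_def permutations_of_set_def)
  assume "x \<in> \<Sigma>"
  then show "p x (set (take (idx \<pi> x) \<pi>))"
    using 1 by (auto simp: mps_language_def) (metis idx_less_length nth_idx)
qed

text \<open>The lexicographic order by \<open>h\<close> and then by position in
  \<open>\<pi>\<close>, coded as one number. This works because positions of letters of
  \<open>\<pi>\<close> are below \<open>length \<pi>\<close>.\<close>

definition lex_key :: "'a list \<Rightarrow> ('a \<Rightarrow> nat) \<Rightarrow> 'a \<Rightarrow> nat" where
  "lex_key \<pi> h x = h x * length \<pi> + idx \<pi> x"

lemma lex_key_less_iff:
  assumes "x \<in> set \<pi>" "y \<in> set \<pi>"
  shows "lex_key \<pi> h x < lex_key \<pi> h y \<longleftrightarrow> h x < h y \<or> h x = h y \<and> idx \<pi> x < idx \<pi> y"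
proof -
  have less: "lex_key \<pi> h u < lex_key \<pi> h v" if "h u < h v" "u \<in> set \<pi>" for u v
  proof -
    have "lex_key \<pi> h u < Suc (h u) * length \<pi>"
      using idx_less_length[OF that(2)] by (simp add: lex_key_def)
    also have "\<dots> \<le> h v * length \<pi>" using that(1) by (intro mult_right_mono) auto
    finally show ?thesis by (simp add: lex_key_def)
  qed
  show ?thesis using less[of x y] less[of y x] assms
    by (cases "h x" "h y" rule: linorder_cases) (auto simp: lex_key_def)
qed

lemma inj_on_lex_key: "inj_on (lex_key \<pi> h) (set \<pi>)"
  using lex_key_less_iff[of _ \<pi> _ h] by (intro inj_onI) (metis idx_inj nat_neq_iff)

text \<open>Ties in \<open>h\<close> are broken by the order of \<open>\<pi>\<close>, where the
  letters of \<open>take j \<pi>\<close> stand before \<open>x\<close>; hence a weak inequality is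
  enough.\<close>

lemma sort_lex_key_in_antimatroid_perms:
  assumes mps: "mps \<Sigma> p" and \<pi>: "\<pi> \<in> antimatroid_perms \<Sigma> (mps_language \<Sigma> p)"
    and avail: "\<And>x. x \<in> \<Sigma> \<Longrightarrow>
      \<exists>j\<le>idx \<pi> x. p x (set (take j \<pi>)) \<and> (\<forall>y\<in>set (take j \<pi>). h y \<le> h x)"
  shows "sort_key (lex_key \<pi> h) \<pi> \<in> antimatroid_perms \<Sigma> (mps_language \<Sigma> p)"
proof (rule sort_key_in_antimatroid_perms[OF mps \<pi>])
  note p = antimatroid_permsD[OF \<pi>]
  show "inj_on (lex_key \<pi> h) \<Sigma>" using inj_on_lex_key p(2) by metis
  fix x assume x: "x \<in> \<Sigma>"
  obtain j where j: "j \<le> idx \<pi> x" "p x (set (take j \<pi>))" "\<forall>y\<in>set (take j \<pi>). h y \<le> h x"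
    using avail[OF x] by blast
  moreover have "lex_key \<pi> h y < lex_key \<pi> h x" if "y \<in> set (take j \<pi>)" for y
    using that j x p(2) in_set_take_iff_idx[OF p(1), of y j]
    by (subst lex_key_less_iff) (auto simp: order.order_iff_strict)
  ultimately show "\<exists>j\<le>idx \<pi> x. p x (set (take j \<pi>)) \<and> (\<forall>y\<in>set (take j \<pi>). lex_key \<pi> h y < lex_key \<pi> h x)"
    by blast
qed

text \<open>The ranks of the elements of \<open>D\<close> along \<open>\<pi>\<close> are exactly the
  numbers below \<open>card D\<close>. This recovers the chosen place of a moved letter from the
  number of letters of \<open>D\<close> before it.\<close>

lemma card_take_idx_inj:
  assumes "distinct \<pi>" "D \<subseteq> set \<pi>" "v \<le> card D"
  shows "card {d \<in> D. card (D \<inter> set (take (idx \<pi> d) \<pi>)) < v} = v"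
proof -
  define r where "r d = card (D \<inter> set (take (idx \<pi> d) \<pi>))" for d
  have fin: "finite D" using assms(2) by (rule finite_subset) simp
  have mono: "r d < r e" if "d \<in> D" "e \<in> D" "idx \<pi> d < idx \<pi> e" for d e
    unfolding r_def
  proof (rule psubset_card_mono)
    have "d \<in> set (take (idx \<pi> e) \<pi>)" "d \<notin> set (take (idx \<pi> d) \<pi>)"
      using that assms(1,2) by (auto simp: in_set_take_iff_idx)
    then show "D \<inter> set (take (idx \<pi> d) \<pi>) \<subset> D \<inter> set (take (idx \<pi> e) \<pi>)"
      using that set_take_subset_set_take[of "idx \<pi> d" "idx \<pi> e" \<pi>] by auto
  qed simp
  have inj: "inj_on r D"
    by (rule inj_onI) (metis assms(2) idx_inj linorder_neq_iff mono order_less_irrefl subsetD)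
  have "r ` D \<subseteq> {..<card D}"
  proof
    fix i assume "i \<in> r ` D"
    then obtain d where d: "d \<in> D" "i = r d" by blast
    have "r d < card D" unfolding r_def
      by (rule psubset_card_mono[OF fin]) (use d assms(1) in \<open>auto simp: in_set_take_iff_idx\<close>)
    then show "i \<in> {..<card D}" using d by simp
  qed
  then have r: "r ` D = {..<card D}"
    using inj by (intro card_subset_eq) (auto simp: card_image)
  have "r ` {d \<in> D. r d < v} = {..<v}" using r assms(3) by auto
  moreover have "inj_on r {d \<in> D. r d < v}" using inj by (rule inj_on_subset) auto
  ultimately have "card {d \<in> D. r d < v} = v" using card_image[of r "{d \<in> D. r d < v}"] by simp
  then show ?thesis by (simp add: r_def)
qed

lemma card_take_mono: "i \<le> j \<Longrightarrow> card (D \<inter> set (take i \<pi>)) \<le> card (D \<inter> set (take j \<pi>))"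
  by (intro card_mono) (auto dest: set_take_subset_set_take)

text \<open>
  Each letter outside \<open>D\<close> may be moved, independently of the others, to any place in \<open>\<pi>\<close>
  (measured by the letters of \<open>D\<close>) between the point where it becomes available and its own place.
  Doubling the ranks makes room for strict comparisons with the letters of \<open>D\<close>.
\<close>

lemma prod_moves_le_card_perms:
  assumes fin: "finite \<Sigma>" and mps: "mps \<Sigma> p" and \<pi>: "\<pi> \<in> antimatroid_perms \<Sigma> (mps_language \<Sigma> p)"
    and D: "D \<subseteq> \<Sigma>"
    and lo: "\<And>b. b \<in> \<Sigma> - D \<Longrightarrow> lo b \<le> idx \<pi> b \<and> p b (set (take (lo b) \<pi>))"
  shows "(\<Prod>b\<in>\<Sigma> - D. card (D \<inter> set (take (idx \<pi> b) \<pi>)) - card (D \<inter> set (take (lo b) \<pi>)) + 1)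
    \<le> card (antimatroid_perms \<Sigma> (mps_language \<Sigma> p))"
proof -
  note p = antimatroid_permsD[OF \<pi>]
  define r where "r j = card (D \<inter> set (take j \<pi>))" for j
  have finD: "finite D" using D fin by (rule finite_subset)
  have r_mono: "r i \<le> r j" if "i \<le> j" for i j using that by (simp add: r_def card_take_mono)
  have r_strict: "r (idx \<pi> d) < r j" if "d \<in> D" "idx \<pi> d < j" for d j unfolding r_def
  proof (rule psubset_card_mono)
    have "d \<in> set (take j \<pi>)" "d \<notin> set (take (idx \<pi> d) \<pi>)"
      using that D p by (auto simp: in_set_take_iff_idx)
    then show "D \<inter> set (take (idx \<pi> d) \<pi>) \<subset> D \<inter> set (take j \<pi>)"
      using that set_take_subset_set_take[of "idx \<pi> d" j \<pi>] by auto
  qed simp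
  have r_card: "r j \<le> card D" for j unfolding r_def by (rule card_mono[OF finD]) auto
  define F where "F = PiE (\<Sigma> - D) (\<lambda>b. {r (lo b)..r (idx \<pi> b)})"
  define h where "h f x = (if x \<in> D then 2 * r (idx \<pi> x) + 1 else 2 * f x)" for f :: "'a \<Rightarrow> nat" and x
  define T where "T f = sort_key (lex_key \<pi> (h f)) \<pi>" for f
  have h_le: "h f y \<le> h f x" if "f \<in> F" "x \<in> D" "y \<in> \<Sigma>" "idx \<pi> y < idx \<pi> x" for f x y
  proof (cases "y \<in> D")
    case True
    then show ?thesis using that r_mono[of "idx \<pi> y" "idx \<pi> x"] by (simp add: h_def)
  next
    case False
    then have "f y \<le> r (idx \<pi> y)" using that by (auto simp: F_def PiE_iff)
    also have "\<dots> \<le> r (idx \<pi> x)" using that by (simp add: r_mono)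
    finally show ?thesis using that False by (simp add: h_def)
  qed
  have T_perm: "T f \<in> antimatroid_perms \<Sigma> (mps_language \<Sigma> p)" if f: "f \<in> F" for f
    unfolding T_def
  proof (rule sort_lex_key_in_antimatroid_perms[OF mps \<pi>])
    fix x assume x: "x \<in> \<Sigma>"
    show "\<exists>j\<le>idx \<pi> x. p x (set (take j \<pi>)) \<and> (\<forall>y\<in>set (take j \<pi>). h f y \<le> h f x)"
    proof (cases "x \<in> D")
      case True
      then show ?thesis using p(4)[OF x] h_le[OF f True] x p
        by (intro exI[of _ "idx \<pi> x"]) (auto simp: in_set_take_iff_idx)
    next
      case False
      have fx: "r (lo x) \<le> f x" using f False x by (auto simp: F_def PiE_iff)
      have "h f y \<le> h f x" if "y \<in> set (take (lo x) \<pi>)" for y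
      proof -
        have y: "y \<in> \<Sigma>" "idx \<pi> y < lo x" using that p by (auto simp: in_set_take_iff_idx)
        show ?thesis
        proof (cases "y \<in> D")
          case True
          then show ?thesis using r_strict[OF True y(2)] fx False by (simp add: h_def)
        next
          case yD: False
          have "f y \<le> r (idx \<pi> y)" using f yD y by (auto simp: F_def PiE_iff)
          also have "\<dots> \<le> r (lo x)" using y by (simp add: r_mono)
          finally show ?thesis using fx yD False by (simp add: h_def)
        qed
      qed
      then show ?thesis using lo[of x] x False by (intro exI[of _ "lo x"]) auto
    qed
  qed
  have "inj_on T F"
  proof (rule inj_onI)
    fix f f' assume f: "f \<in> F" and f': "f' \<in> F" and eq: "T f = T f'"
    \<comment> \<open>The choice \<open>u\<close> is read off the permutation: letters of
      \<open>D\<close> have odd keys and moved letters even ones, so \<open>b\<close> is preceded by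
      exactly those letters of \<open>D\<close> whose rank is below \<open>u b\<close>.\<close>
    have val: "u b = card {d \<in> D. idx (T u) d < idx (T u) b}" if u: "u \<in> F" and b: "b \<in> \<Sigma> - D" for u b
    proof -
      have "idx (T u) d < idx (T u) b \<longleftrightarrow> r (idx \<pi> d) < u b" if "d \<in> D" for d
      proof -
        have m: "d \<in> set \<pi>" "b \<in> set \<pi>" using that b D p by auto
        have "idx (T u) d < idx (T u) b \<longleftrightarrow> lex_key \<pi> (h u) d < lex_key \<pi> (h u) b"
          unfolding T_def by (rule idx_sort_key_less_iff[OF p(1) inj_on_lex_key m])
        also have "\<dots> \<longleftrightarrow> r (idx \<pi> d) < u b"
          unfolding lex_key_less_iff[OF m] using that b by (auto simp: h_def)
        finally show ?thesis .
      qed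
      then have "{d \<in> D. idx (T u) d < idx (T u) b} = {d \<in> D. r (idx \<pi> d) < u b}" by auto
      moreover have "u b \<le> card D"
        using u b r_card[of "idx \<pi> b"] by (auto simp: F_def PiE_iff intro: order_trans)
      ultimately show ?thesis using card_take_idx_inj[OF p(1), of D "u b"] D p by (simp add: r_def)
    qed
    show "f = f'"
      by (rule PiE_ext[OF f[unfolded F_def] f'[unfolded F_def]]) (simp only: val[OF f] val[OF f'] eq)
  qed
  then have "card F \<le> card (antimatroid_perms \<Sigma> (mps_language \<Sigma> p))"
    using T_perm by (intro card_inj_on_le[OF _ _ finite_antimatroid_perms[OF fin]]) auto
  moreover have "card F = (\<Prod>b\<in>\<Sigma> - D. r (idx \<pi> b) - r (lo b) + 1)"
    unfolding F_def using fin lo r_mono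
    by (subst card_PiE) (auto intro!: prod.cong simp: Suc_diff_le)
  ultimately show ?thesis by (simp add: r_def)
qed

text \<open>A function that increases strictly along the order given by \<open>k\<close> is
  determined by its set of values: \<open>f b\<close> is the value with as many values below it as
  \<open>b\<close> has predecessors.\<close>

lemma strict_enum_unique:
  fixes f f' :: "'a \<Rightarrow> nat" and k :: "'a \<Rightarrow> nat"
  assumes fin: "finite B" and inj: "inj_on k B"
    and f: "\<And>x y. x \<in> B \<Longrightarrow> y \<in> B \<Longrightarrow> k x < k y \<Longrightarrow> f x < f y"
    and f': "\<And>x y. x \<in> B \<Longrightarrow> y \<in> B \<Longrightarrow> k x < k y \<Longrightarrow> f' x < f' y"
    and img: "f ` B = f' ` B" and b: "b \<in> B"
  shows "f b = f' b"
proof -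
  have *: "card {i \<in> u ` B. i < u c} = card {x \<in> B. k x < k c}"
    if u: "\<And>x y. x \<in> B \<Longrightarrow> y \<in> B \<Longrightarrow> k x < k y \<Longrightarrow> u x < u y" and c: "c \<in> B" for u :: "'a \<Rightarrow> nat" and c
  proof -
    have iff: "u x < u y \<longleftrightarrow> k x < k y" if "x \<in> B" "y \<in> B" for x y
      using u that inj by (metis inj_onD linorder_neqE_nat order_less_asym order_less_irrefl)
    have "{i \<in> u ` B. i < u c} = u ` {x \<in> B. k x < k c}" using iff c by auto
    moreover have "inj_on u {x \<in> B. k x < k c}"
      using iff inj by (intro inj_onI) (metis (no_types, lifting) inj_onD linorder_neqE_nat mem_Collect_eq order_less_irrefl)
    ultimately show ?thesis by (simp add: card_image)
  qed
  obtain c where c: "c \<in> B" "f b = f' c" using img b by (metis imageE imageI)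
  have "card {x \<in> B. k x < k b} = card {x \<in> B. k x < k c}"
    using *[of f, OF f b] *[of f', OF f' c(1)] img c(2) by simp
  moreover have ne: False if xy: "x \<in> B" "y \<in> B" "k x < k y" "card {z \<in> B. k z < k x} = card {z \<in> B. k z < k y}" for x y
  proof -
    have "{z \<in> B. k z < k x} \<subset> {z \<in> B. k z < k y}" using xy by auto
    then have "card {z \<in> B. k z < k x} < card {z \<in> B. k z < k y}"
      using fin by (intro psubset_card_mono) auto
    then show False using xy by simp
  qed
  ultimately have "k b = k c"
    using ne[OF b c(1)] ne[OF c(1) b] by (cases "k b" "k c" rule: linorder_cases) simp_all
  then have "b = c" using inj b c(1) by (auto dest: inj_onD)
  then show ?thesis using c by simp
qed

text \<open>
  The keys of \<open>B\<close> are weakly increasing along the new permutation; adding the rank in \<open>B\<close>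
  makes them strictly increasing, so that they are determined by a subset of \<open>{..<2 * card B}\<close>.
\<close>

lemma prod_key_intervals_le_card_perms:
  assumes fin: "finite \<Sigma>" and mps: "mps \<Sigma> p" and \<pi>: "\<pi> \<in> antimatroid_perms \<Sigma> (mps_language \<Sigma> p)"
    and B: "B \<subseteq> \<Sigma>"
    and hi_mono: "\<And>x y. x \<in> \<Sigma> \<Longrightarrow> y \<in> \<Sigma> \<Longrightarrow> idx \<pi> x < idx \<pi> y \<Longrightarrow> hi x \<le> hi y"
    and lo: "\<And>b. b \<in> B \<Longrightarrow>
      \<exists>j\<le>idx \<pi> b. p b (set (take j \<pi>)) \<and> (\<forall>y\<in>set (take j \<pi>). hi y \<le> lo b)"
    and lo_hi: "\<And>b. b \<in> B \<Longrightarrow> lo b \<le> hi b \<and> hi b \<le> card B"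
  shows "(\<Prod>b\<in>B. hi b - lo b + 1) \<le> 4 ^ card B * card (antimatroid_perms \<Sigma> (mps_language \<Sigma> p))"
proof -
  note p = antimatroid_permsD[OF \<pi>]
  let ?P = "antimatroid_perms \<Sigma> (mps_language \<Sigma> p)"
  have finB: "finite B" using B fin by (rule finite_subset)
  define F where "F = PiE B (\<lambda>b. {lo b..hi b})"
  define h where "h f x = (if x \<in> B then f x else hi x)" for f :: "'a \<Rightarrow> nat" and x
  define T where "T f = sort_key (lex_key \<pi> (h f)) \<pi>" for f
  define rk where "rk \<tau> b = card {c \<in> B. idx \<tau> c < idx \<tau> b}" for \<tau> b
  \<comment> \<open>\<open>T f\<close> alone does not determine \<open>f\<close>, since keys can
    change without changing the order. The set of strict keys is recorded as well; together with the
    order it determines every key.\<close>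
  define G where "G f = (T f, (\<lambda>b. f b + rk (T f) b) ` B)" for f
  have h_hi: "h f x \<le> hi x" if "f \<in> F" for f x using that by (auto simp: F_def h_def PiE_iff)
  have T_perm: "T f \<in> ?P" if f: "f \<in> F" for f
    unfolding T_def
  proof (rule sort_lex_key_in_antimatroid_perms[OF mps \<pi>])
    fix x assume x: "x \<in> \<Sigma>"
    show "\<exists>j\<le>idx \<pi> x. p x (set (take j \<pi>)) \<and> (\<forall>y\<in>set (take j \<pi>). h f y \<le> h f x)"
    proof (cases "x \<in> B")
      case True
      then obtain j where j: "j \<le> idx \<pi> x" "p x (set (take j \<pi>))" "\<forall>y\<in>set (take j \<pi>). hi y \<le> lo x"
        using lo by blast
      have "lo x \<le> h f x" using f True by (auto simp: F_def h_def PiE_iff)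
      then show ?thesis using j h_hi[OF f] by (meson order_trans)
    next
      case False
      have "h f y \<le> h f x" if "y \<in> set (take (idx \<pi> x) \<pi>)" for y
      proof -
        have "h f y \<le> hi y" by (rule h_hi[OF f])
        also have "\<dots> \<le> hi x" using that p x by (intro hi_mono) (auto simp: in_set_take_iff_idx)
        finally show ?thesis using False by (simp add: h_def)
      qed
      then show ?thesis using p(4)[OF x] by blast
    qed
  qed
  have strict: "f x + rk (T f) x < f y + rk (T f) y"
    if f: "f \<in> F" and xy: "x \<in> B" "y \<in> B" "idx (T f) x < idx (T f) y" for f x y
  proof -
    have m: "x \<in> set \<pi>" "y \<in> set \<pi>" using xy B p by auto
    have "lex_key \<pi> (h f) x < lex_key \<pi> (h f) y"
      using xy(3) unfolding T_def idx_sort_key_less_iff[OF p(1) inj_on_lex_key m] .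
    then have "f x \<le> f y" unfolding lex_key_less_iff[OF m] using xy by (auto simp: h_def)
    moreover have "rk (T f) x < rk (T f) y" unfolding rk_def
      by (rule psubset_card_mono) (use finB xy in auto)
    ultimately show ?thesis by simp
  qed
  have "inj_on G F"
  proof (rule inj_onI)
    fix f f' assume f: "f \<in> F" and f': "f' \<in> F" and eq: "G f = G f'"
    have T: "T f = T f'" using eq by (simp add: G_def)
    have inj: "inj_on (idx (T f)) B"
      by (rule inj_onI) (use B p in \<open>metis T_def idx_inj set_sort subsetD\<close>)
    have "f b = f' b" if "b \<in> B" for b
      using strict_enum_unique[OF finB inj, of "\<lambda>b. f b + rk (T f) b" "\<lambda>b. f' b + rk (T f) b" b]
        strict[OF f] strict[OF f', folded T] eq that T unfolding G_def by simp
    then show "f = f'" by (intro PiE_ext[OF f[unfolded F_def] f'[unfolded F_def]]) auto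
  qed
  \<comment> \<open>A key is at most \<open>card B\<close> and a rank is below it, so there are at
    most \<open>2 ^ (2 * card B)\<close> sets of strict keys. This is the factor
    \<open>4 ^ card B\<close>.\<close>
  moreover have "G ` F \<subseteq> ?P \<times> Pow {..<2 * card B}"
  proof
    fix u assume "u \<in> G ` F"
    then obtain f where f: "f \<in> F" "u = G f" by blast
    have "f b + rk (T f) b < 2 * card B" if "b \<in> B" for b
    proof -
      have "f b \<le> card B" using f(1) that lo_hi[OF that] by (auto simp: F_def PiE_iff intro: order_trans)
      moreover have "rk (T f) b < card B" unfolding rk_def
        by (rule psubset_card_mono) (use finB that in auto)
      ultimately show ?thesis by simp
    qed
    then show "u \<in> ?P \<times> Pow {..<2 * card B}" using f T_perm by (auto simp: G_def)
  qed
  ultimately have "card F \<le> card (?P \<times> Pow {..<2 * card B})"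
    using finite_antimatroid_perms[OF fin] by (intro card_inj_on_le) auto
  also have "\<dots> = 4 ^ card B * card ?P"
    by (simp add: card_cartesian_product card_Pow power_mult)
  also have "card F = (\<Prod>b\<in>B. hi b - lo b + 1)"
    unfolding F_def using finB lo_hi by (subst card_PiE) (auto intro!: prod.cong simp: Suc_diff_le)
  finally show ?thesis .
qed

section \<open>Reports of a candidate data structure\<close>

lemma take_in_mps_language: "\<alpha> \<in> mps_language \<Sigma> p \<Longrightarrow> take j \<alpha> \<in> mps_language \<Sigma> p"
  by (auto simp: mps_language_def simple_words_def min_def dest: in_set_takeD)

lemma mps_languageD:
  assumes "\<alpha> \<in> mps_language \<Sigma> p"
  shows "distinct \<alpha>" "set \<alpha> \<subseteq> \<Sigma>"
  using assms by (auto simp: mps_language_def simple_words_def)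

text \<open>The first letter of \<open>\<alpha>\<close> outside \<open>S\<close> is available after
  a prefix contained in \<open>S\<close>, hence at \<open>S\<close> by monotonicity.\<close>

lemma ex_available_in_word:
  assumes mps: "mps \<Sigma> p" and \<alpha>: "\<alpha> \<in> mps_language \<Sigma> p" and S: "S \<subseteq> \<Sigma>" "\<not> set \<alpha> \<subseteq> S"
  shows "\<exists>x\<in>set \<alpha> - S. p x S"
proof -
  define j where "j = (LEAST j. j < length \<alpha> \<and> \<alpha> ! j \<notin> S)"
  have "\<exists>j. j < length \<alpha> \<and> \<alpha> ! j \<notin> S" using S(2) by (auto simp: in_set_conv_nth)
  then have j: "j < length \<alpha>" "\<alpha> ! j \<notin> S" unfolding j_def by (metis (mono_tags, lifting) LeastI)+
  have least: "\<alpha> ! i \<in> S" if "i < j" for i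
    using not_less_Least[OF that[unfolded j_def]] that j(1) by simp
  then have "set (take j \<alpha>) \<subseteq> S" by (auto simp: in_set_conv_nth)
  moreover have "p (\<alpha> ! j) (set (take j \<alpha>))" "\<alpha> ! j \<in> \<Sigma>"
    using \<alpha> j(1) by (auto simp: mps_language_def simple_words_def)
  moreover have "S \<subseteq> \<Sigma> - {\<alpha> ! j}" using S(1) j(2) by blast
  ultimately have "p (\<alpha> ! j) S" using mps unfolding mps_def by meson
  then show ?thesis using j by auto
qed

text \<open>All letters reported during the history \<open>\<alpha>\<close>, in order of report and
  including those of \<open>init\<close>. Memory holds this log in both runs of the data structure:
  as the queue in the first, as the store of heap nodes in the second.\<close>

definition rlog :: "'a candidate_ds \<Rightarrow> 'a list \<Rightarrow> 'a list" where
  "rlog C \<alpha> = concat (map (\<lambda>j. reports C (take j \<alpha>)) [0..<Suc (length \<alpha>)])"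

definition dscost :: "'a candidate_ds \<Rightarrow> 'a list \<Rightarrow> nat" where
  "dscost C \<alpha> = (\<Sum>i\<le>length \<alpha>. cost C (take i \<alpha>))"

lemma rlog_Nil [simp]: "rlog C [] = reports C []"
  by (simp add: rlog_def)

lemma rlog_snoc: "rlog C (\<alpha> @ [x]) = rlog C \<alpha> @ reports C (\<alpha> @ [x])"
  by (simp add: rlog_def) (auto intro!: arg_cong[where f = concat])

lemma rlog_take: "\<exists>ys. rlog C \<alpha> = rlog C (take k \<alpha>) @ ys"
proof (induction \<alpha> rule: rev_induct)
  case (snoc x \<alpha>)
  then show ?case by (cases "k \<le> length \<alpha>") (auto simp: rlog_snoc)
qed simp

lemma dscost_Nil [simp]: "dscost C [] = cost C []"
  by (simp add: dscost_def)

lemma dscost_snoc: "dscost C (\<alpha> @ [x]) = dscost C \<alpha> + cost C (\<alpha> @ [x])"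
  by (simp add: dscost_def)

lemma dscost_le_total_time: "finite A \<Longrightarrow> \<alpha> \<in> A \<Longrightarrow> dscost C \<alpha> \<le> total_time A C"
  by (auto simp: total_time_def dscost_def intro!: Max_ge)

text \<open>By monotonicity an available letter stays available until it is used, so it is reported
  only once. Each call costs at least one more than its number of reports, and \<open>init\<close>
  is a call too; hence the strict inequality, which later absorbs the linear terms.\<close>

lemma rlog_props:
  assumes mps: "mps \<Sigma> p" and C: "is_candidate_ds \<Sigma> p C" and \<alpha>: "\<alpha> \<in> mps_language \<Sigma> p"
  shows "distinct (rlog C \<alpha>) \<and> set (rlog C \<alpha>) = set \<alpha> \<union> {y \<in> \<Sigma> - set \<alpha>. p y (set \<alpha>)} \<and>
    length (rlog C \<alpha>) + length \<alpha> < dscost C \<alpha>"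
  using \<alpha>
proof (induction \<alpha> rule: rev_induct)
  case Nil
  then have "distinct (reports C []) \<and> 1 + length (reports C []) \<le> cost C []"
    using C unfolding is_candidate_ds_def by blast
  then show ?case using C by (simp add: is_candidate_ds_def)
next
  case (snoc x \<alpha>)
  from snoc.prems have \<alpha>: "\<alpha> \<in> mps_language \<Sigma> p" "x \<in> \<Sigma> - set \<alpha>" "p x (set \<alpha>)"
    by (simp_all add: snoc_in_mps_language_iff)
  note IH = snoc.IH[OF \<alpha>(1)]
  have rep: "set (reports C (\<alpha> @ [x])) = {y \<in> \<Sigma> - insert x (set \<alpha>). \<not> p y (set \<alpha>) \<and> p y (insert x (set \<alpha>))}"
    using C \<alpha> unfolding is_candidate_ds_def by blast
  have rep': "distinct (reports C (\<alpha> @ [x]))" "1 + length (reports C (\<alpha> @ [x])) \<le> cost C (\<alpha> @ [x])"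
    using C snoc.prems unfolding is_candidate_ds_def by blast+
  have mono: "p y (insert x (set \<alpha>))" if "p y (set \<alpha>)" "y \<in> \<Sigma> - insert x (set \<alpha>)" for y
  proof -
    have "insert x (set \<alpha>) \<subseteq> \<Sigma> - {y}" using that \<alpha> mps_languageD(2)[OF \<alpha>(1)] by auto
    then show ?thesis using mps that unfolding mps_def by (meson DiffD1 subset_insertI)
  qed
  have "set (rlog C (\<alpha> @ [x])) = set (\<alpha> @ [x]) \<union> {y \<in> \<Sigma> - set (\<alpha> @ [x]). p y (set (\<alpha> @ [x]))}"
    using IH rep mono \<alpha> by (auto simp: rlog_snoc)
  moreover have "set (rlog C \<alpha>) \<inter> set (reports C (\<alpha> @ [x])) = {}"
    using IH rep by auto
  moreover have "length (rlog C (\<alpha> @ [x])) + length (\<alpha> @ [x]) < dscost C (\<alpha> @ [x])"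
    using IH rep'(2) by (simp add: rlog_snoc dscost_snoc)
  ultimately show ?case using IH rep'(1) by (simp add: rlog_snoc)
qed

section \<open>Bottlenecks\<close>

text \<open>\<open>T\<close> is the part of \<open>\<Sigma>\<close> that is covered by the layers processed so far.\<close>

definition bottlenecks :: "'a set \<Rightarrow> ('a \<Rightarrow> 'a set \<Rightarrow> bool) \<Rightarrow> 'a set \<Rightarrow> 'a list \<Rightarrow> bool" where
  "bottlenecks \<Sigma> p T cs \<longleftrightarrow> T \<subseteq> \<Sigma> \<and> set cs \<subseteq> T \<and> distinct cs \<and>
    (\<forall>i<length cs. \<exists>S\<subseteq>T - set (drop i cs). {y \<in> \<Sigma> - S. p y S} = {cs ! i})"

text \<open>The witness \<open>S\<close> of \<open>cs ! i\<close> avoids all bottlenecks from index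
  \<open>i\<close> on, so a word containing \<open>cs ! j\<close> must leave \<open>S\<close>. The
  first letter that leaves can only be \<open>cs ! i\<close>, the sole letter available at
  \<open>S\<close>.\<close>

lemma bottlenecks_order:
  assumes mps: "mps \<Sigma> p" and cs: "bottlenecks \<Sigma> p T cs" and \<alpha>: "\<alpha> \<in> mps_language \<Sigma> p"
    and ij: "i \<le> j" "j < length cs" "cs ! j \<in> set \<alpha>"
  shows "cs ! i \<in> set \<alpha>"
proof (rule ccontr)
  assume i: "cs ! i \<notin> set \<alpha>"
  from cs ij obtain S where S: "S \<subseteq> T - set (drop i cs)" "{y \<in> \<Sigma> - S. p y S} = {cs ! i}"
    unfolding bottlenecks_def by (meson order_le_less_trans)
  have "cs ! j = drop i cs ! (j - i)" using ij by simp
  then have "cs ! j \<in> set (drop i cs)" using ij by (metis diff_less_mono length_drop nth_mem)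
  then have "\<not> set \<alpha> \<subseteq> S" using S(1) ij(3) by blast
  moreover have "S \<subseteq> \<Sigma>" using S(1) cs unfolding bottlenecks_def by blast
  ultimately obtain x where "x \<in> set \<alpha> - S" "p x S"
    using ex_available_in_word[OF mps \<alpha>] by blast
  then have "x = cs ! i" using S(2) mps_languageD(2)[OF \<alpha>] by blast
  then show False using i \<open>x \<in> set \<alpha> - S\<close> by simp
qed

lemma bottlenecks_prefix:
  assumes mps: "mps \<Sigma> p" and cs: "bottlenecks \<Sigma> p T cs" and \<alpha>: "\<alpha> \<in> mps_language \<Sigma> p"
  shows "set cs \<inter> set \<alpha> = set (take (card (set cs \<inter> set \<alpha>)) cs)"
proof -
  \<comment> \<open>The index of the first bottleneck missing from \<open>\<alpha>\<close>, or
    \<open>length cs\<close> if none is missing.\<close>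
  define i where "i = (LEAST i. i = length cs \<or> i < length cs \<and> cs ! i \<notin> set \<alpha>)"
  have i: "i = length cs \<or> i < length cs \<and> cs ! i \<notin> set \<alpha>"
    unfolding i_def by (rule LeastI[of _ "length cs"]) simp
  have less: "cs ! j \<in> set \<alpha>" if "j < i" for j
    using not_less_Least[OF that[unfolded i_def]] that i by auto
  have ge: "cs ! j \<notin> set \<alpha>" if "i \<le> j" "j < length cs" for j
    using bottlenecks_order[OF mps cs \<alpha> that] i that by auto
  have eq: "set cs \<inter> set \<alpha> = set (take i cs)"
  proof
    show "set cs \<inter> set \<alpha> \<subseteq> set (take i cs)"
    proof
      fix x assume "x \<in> set cs \<inter> set \<alpha>"
      then obtain j where j: "j < length cs" "x = cs ! j" "x \<in> set \<alpha>" by (auto simp: in_set_conv_nth)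
      then have "j < i" using ge[of j] by (meson not_le)
      then show "x \<in> set (take i cs)" using j by (auto simp: in_set_conv_nth)
    qed
    show "set (take i cs) \<subseteq> set cs \<inter> set \<alpha>"
    proof
      fix x assume x: "x \<in> set (take i cs)"
      then obtain j where "j < i" "x = cs ! j" by (auto simp: in_set_conv_nth)
      then show "x \<in> set cs \<inter> set \<alpha>" using less in_set_takeD[OF x] by simp
    qed
  qed
  have "distinct cs" using cs by (simp add: bottlenecks_def)
  then have "card (set cs \<inter> set \<alpha>) = i"
    unfolding eq using i by (subst distinct_card) auto
  then show ?thesis using eq by simp
qed

text \<open>A bottleneck that can be appended is always the next one of \<open>cs\<close>. The
  program can therefore recognise a reported bottleneck by an equality test with one array cell,
  without asking the oracle.\<close>

lemma next_bottleneck: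
  assumes mps: "mps \<Sigma> p" and cs: "bottlenecks \<Sigma> p T cs" and \<alpha>: "\<alpha> @ [x] \<in> mps_language \<Sigma> p"
    and x: "x \<in> set cs"
  shows "card (set cs \<inter> set \<alpha>) < length cs \<and> x = cs ! card (set cs \<inter> set \<alpha>)"
proof -
  let ?k = "card (set cs \<inter> set \<alpha>)"
  have d: "distinct cs" using cs by (simp add: bottlenecks_def)
  have \<alpha>': "\<alpha> \<in> mps_language \<Sigma> p" "x \<notin> set \<alpha>" using \<alpha> by (simp_all add: snoc_in_mps_language_iff)
  have "set cs \<inter> set (\<alpha> @ [x]) = insert x (set cs \<inter> set \<alpha>)" using x by auto
  then have "card (set cs \<inter> set (\<alpha> @ [x])) = Suc ?k" using \<alpha>'(2) by simp
  then have eq: "insert x (set (take ?k cs)) = set (take (Suc ?k) cs)"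
    using bottlenecks_prefix[OF mps cs \<alpha>] bottlenecks_prefix[OF mps cs \<alpha>'(1)] x by auto
  have nx: "x \<notin> set (take ?k cs)" using bottlenecks_prefix[OF mps cs \<alpha>'(1)] \<alpha>'(2) by blast
  have l: "?k < length cs"
  proof (rule ccontr)
    assume "\<not> ?k < length cs"
    then show False using nx x by simp
  qed
  then have "set (take (Suc ?k) cs) = insert (cs ! ?k) (set (take ?k cs))"
    by (simp add: take_Suc_conv_app_nth)
  moreover have "cs ! ?k \<notin> set (take ?k cs)"
    using d l by (simp add: in_set_take_iff_idx idx_nth)
  ultimately show ?thesis using l eq nx by blast
qed

section \<open>Layers\<close>

text \<open>\<open>D\<close> consists of the first letter of each layer.\<close>

definition layered :: "'a set \<Rightarrow> ('a \<Rightarrow> 'a set \<Rightarrow> bool) \<Rightarrow> 'a list \<Rightarrow> 'a list \<Rightarrow> 'a set \<Rightarrow> bool" where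
  "layered \<Sigma> p \<alpha> cs D \<longleftrightarrow> D \<subseteq> set \<alpha> \<and> bottlenecks \<Sigma> p (set \<alpha>) cs \<and>
    card (set \<alpha> - set cs) \<le> 2 * card (set \<alpha> - D) \<and>
    (\<forall>x\<in>set \<alpha> - D. \<exists>j\<le>idx \<alpha> x. p x (set (take j \<alpha>)) \<and>
       card (D \<inter> set (take j \<alpha>)) < card (D \<inter> set (take (idx \<alpha> x) \<alpha>)))"

lemma idx_append1: "x \<in> set xs \<Longrightarrow> idx (xs @ ys) x = idx xs x"
  by (simp add: idx_def)

lemma idx_append2: "x \<notin> set xs \<Longrightarrow> idx (xs @ ys) x = length xs + idx ys x"
  by (induction xs) (auto simp: idx_def)

lemma layered_Nil: "layered \<Sigma> p [] [] {}"
  by (simp add: layered_def bottlenecks_def)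

text \<open>A layer of length \<open>l \<ge> 2\<close> adds \<open>l\<close> non-bottlenecks and
  \<open>l - 1\<close> letters outside \<open>D\<close>, and \<open>l \<le> 2 * (l - 1)\<close>; a
  singleton layer adds neither. All letters of the layer are available at
  \<open>set \<alpha>\<close>: for a singleton this set witnesses the bottleneck, and otherwise
  \<open>hd ys\<close> separates the start of the layer from the places of its other
  letters.\<close>

lemma layered_step:
  assumes l: "layered \<Sigma> p \<alpha> cs D" and \<beta>: "distinct (\<alpha> @ ys)" and ys: "ys \<noteq> []"
    and avail: "set ys = {y \<in> \<Sigma> - set \<alpha>. p y (set \<alpha>)}"
  shows "layered \<Sigma> p (\<alpha> @ ys) (if length ys = 1 then cs @ ys else cs) (insert (hd ys) D)"
proof -
  let ?d = "hd ys" let ?\<beta> = "\<alpha> @ ys" let ?cs = "if length ys = 1 then cs @ ys else cs"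
  have D: "D \<subseteq> set \<alpha>" "?d \<notin> set \<alpha>" "?d \<in> set ys" using l \<beta> ys by (auto simp: layered_def)
  have cs: "bottlenecks \<Sigma> p (set \<alpha>) cs" using l by (simp add: layered_def)
  have c\<alpha>: "set cs \<subseteq> set \<alpha>" "set \<alpha> \<subseteq> \<Sigma>" using cs by (auto simp: bottlenecks_def)
  have "bottlenecks \<Sigma> p (set ?\<beta>) ?cs"
  proof (cases "length ys = 1")
    case False
    have "\<exists>S\<subseteq>set ?\<beta> - set (drop i cs). {y \<in> \<Sigma> - S. p y S} = {cs ! i}" if i: "i < length cs" for i
    proof -
      obtain S where "S\<subseteq>set \<alpha> - set (drop i cs)" "{y \<in> \<Sigma> - S. p y S} = {cs ! i}"
        using cs i unfolding bottlenecks_def by blast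
      then show ?thesis by (intro exI[of _ S]) auto
    qed
    then show ?thesis using False cs avail by (auto simp: bottlenecks_def)
  next
    case True
    then obtain c where c: "ys = [c]" by (auto simp: length_Suc_conv)
    have S: "\<exists>S\<subseteq>set ?\<beta> - set (drop i (cs @ ys)). {y \<in> \<Sigma> - S. p y S} = {(cs @ ys) ! i}"
      if i: "i < length (cs @ ys)" for i
    proof (cases "i < length cs")
      case True
      then obtain S where "S\<subseteq>set \<alpha> - set (drop i cs)" "{y \<in> \<Sigma> - S. p y S} = {cs ! i}"
        using cs unfolding bottlenecks_def by blast
      then show ?thesis using True \<beta> by (intro exI[of _ S]) (auto simp: nth_append)
    next
      case False
      then have "i = length cs" using i c by simp
      then show ?thesis using c avail \<beta> by (intro exI[of _ "set \<alpha>"]) auto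
    qed
    have "bottlenecks \<Sigma> p (set ?\<beta>) (cs @ ys)"
      unfolding bottlenecks_def
    proof (intro conjI allI impI S)
      show "set ?\<beta> \<subseteq> \<Sigma>" using avail c\<alpha> by auto
      show "distinct (cs @ ys)" using cs \<beta> c c\<alpha> by (auto simp: bottlenecks_def)
    qed (use c\<alpha> in auto)
    then show ?thesis using True by simp
  qed
  moreover have "card (set ?\<beta> - set ?cs) \<le> 2 * card (set ?\<beta> - insert ?d D)"
  proof (cases "length ys = 1")
    case True
    then obtain c where c: "ys = [c]" by (auto simp: length_Suc_conv)
    have "set ?\<beta> - set ?cs = set \<alpha> - set cs" "set ?\<beta> - insert ?d D = set \<alpha> - D"
      using c D c\<alpha> \<beta> by auto
    then show ?thesis using l by (simp add: layered_def)
  next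
    case False
    have "set ?\<beta> - set ?cs = (set \<alpha> - set cs) \<union> set ys" using False c\<alpha> \<beta> by auto
    moreover have "set ?\<beta> - insert ?d D = (set \<alpha> - D) \<union> (set ys - {?d})" using D \<beta> by auto
    moreover have "card ((set \<alpha> - set cs) \<union> set ys) = card (set \<alpha> - set cs) + card (set ys)"
      using \<beta> by (intro card_Un_disjoint) auto
    moreover have "card ((set \<alpha> - D) \<union> (set ys - {?d})) = card (set \<alpha> - D) + card (set ys - {?d})"
      using \<beta> by (intro card_Un_disjoint) auto
    moreover have "card (set ys) = length ys" using \<beta> by (simp add: distinct_card)
    moreover have "card (set ys - {?d}) = length ys - 1" using \<beta> D by (simp add: distinct_card)
    moreover have "length ys \<ge> 2" using False ys by (cases ys rule: remdups_adj.cases) auto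
    moreover have "card (set \<alpha> - set cs) \<le> 2 * card (set \<alpha> - D)" using l by (simp add: layered_def)
    ultimately show ?thesis using False by simp
  qed
  moreover have "\<exists>j\<le>idx ?\<beta> x. p x (set (take j ?\<beta>)) \<and>
       card (insert ?d D \<inter> set (take j ?\<beta>)) < card (insert ?d D \<inter> set (take (idx ?\<beta> x) ?\<beta>))"
    if x: "x \<in> set ?\<beta> - insert ?d D" for x
  proof (cases "x \<in> set \<alpha>")
    case True
    then obtain j where j: "j \<le> idx \<alpha> x" "p x (set (take j \<alpha>))"
       "card (D \<inter> set (take j \<alpha>)) < card (D \<inter> set (take (idx \<alpha> x) \<alpha>))"
      using l x unfolding layered_def by blast
    have "idx \<alpha> x < length \<alpha>" using True by (rule idx_less_length)
    moreover have "insert ?d D \<inter> set (take i \<alpha>) = D \<inter> set (take i \<alpha>)" for i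
      using D by (auto dest: in_set_takeD)
    ultimately show ?thesis using j True by (intro exI[of _ j]) (simp add: idx_append1)
  next
    case False
    then have xy: "x \<in> set ys" "x \<noteq> ?d" using x by auto
    then have i: "idx ?\<beta> x = length \<alpha> + idx ys x" "idx ys x > 0" using False ys
      by (auto simp: idx_append2) (cases ys; auto simp: idx_def)
    have "?d \<in> set (take (idx ys x) ys)" using i ys by (cases ys; cases "idx ys x") auto
    then have "insert ?d D \<inter> set (take (idx ?\<beta> x) ?\<beta>) = insert ?d D" using i D by auto
    moreover have "insert ?d D \<inter> set (take (length \<alpha>) ?\<beta>) = D" using D by auto
    moreover have "finite D" using D(1) by (rule finite_subset) simp
    moreover have "p x (set (take (length \<alpha>) ?\<beta>))" using avail xy by simp
    ultimately show ?thesis using i D by (intro exI[of _ "length \<alpha>"]) (auto simp: card_insert_if)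
  qed
  ultimately show ?thesis using D by (auto simp: layered_def)
qed

text \<open>Each letter outside \<open>D\<close> becomes available before some letter of
  \<open>D\<close> that precedes it in \<open>\<sigma>\<close>, so its interval has at least two
  places. The square comes from the factor 2 between the non-bottlenecks and the letters outside
  \<open>D\<close>.\<close>

lemma layered_card:
  assumes fin: "finite \<Sigma>" and mps: "mps \<Sigma> p" and \<sigma>: "\<sigma> \<in> antimatroid_perms \<Sigma> (mps_language \<Sigma> p)"
    and l: "layered \<Sigma> p \<sigma> cs D"
  shows "2 ^ card (\<Sigma> - set cs) \<le> (card (antimatroid_perms \<Sigma> (mps_language \<Sigma> p)))\<^sup>2"
proof -
  note p = antimatroid_permsD[OF \<sigma>]
  have D: "D \<subseteq> \<Sigma>" using l p by (simp add: layered_def)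
  define ok where "ok x j \<longleftrightarrow> j \<le> idx \<sigma> x \<and> p x (set (take j \<sigma>)) \<and>
       card (D \<inter> set (take j \<sigma>)) < card (D \<inter> set (take (idx \<sigma> x) \<sigma>))" for x j
  define lo where "lo x = (SOME j. ok x j)" for x
  have "\<exists>j. ok x j" if "x \<in> \<Sigma> - D" for x
    using l p(2) that unfolding layered_def ok_def by blast
  then have lo: "ok x (lo x)" if "x \<in> \<Sigma> - D" for x
    unfolding lo_def using that by (metis someI_ex)
  have "(2::nat) ^ card (\<Sigma> - D) = (\<Prod>b\<in>\<Sigma> - D. 2)" by simp
  also have "\<dots> \<le> (\<Prod>b\<in>\<Sigma> - D. card (D \<inter> set (take (idx \<sigma> b) \<sigma>)) - card (D \<inter> set (take (lo b) \<sigma>)) + 1)"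
    using lo by (intro prod_mono) (fastforce simp: ok_def)
  also have "\<dots> \<le> card (antimatroid_perms \<Sigma> (mps_language \<Sigma> p))"
    using lo by (intro prod_moves_le_card_perms[OF fin mps \<sigma> D]) (auto simp: ok_def)
  finally have 1: "(2::nat) ^ card (\<Sigma> - D) \<le> card (antimatroid_perms \<Sigma> (mps_language \<Sigma> p))" .
  have "(2::nat) ^ card (\<Sigma> - set cs) \<le> 2 ^ (2 * card (\<Sigma> - D))"
    using l p(2) by (intro power_increasing) (auto simp: layered_def)
  also have "\<dots> = (2 ^ card (\<Sigma> - D))\<^sup>2" by (simp only: power_mult[symmetric] mult.commute)
  also have "\<dots> \<le> (card (antimatroid_perms \<Sigma> (mps_language \<Sigma> p)))\<^sup>2"
    using 1 by (rule power_mono) simp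
  finally show ?thesis .
qed

section \<open>Weakest preconditions\<close>

text \<open>Executions are deterministic, so the existence of a run is total correctness. Time and
  number of comparisons are arguments of the postcondition, so that symbolic execution yields the
  costs along with the final state.\<close>

definition wp where
  "wp w A C \<pi> c Q s \<longleftrightarrow> (\<exists>s' t q. exec w A C \<pi> c s s' t q \<and> Q s' t q)"

primrec block :: "com list \<Rightarrow> com" where
  "block [] = Skip"
| "block (c # cs) = Seq c (block cs)"

locale ram =
  fixes w :: nat and A :: "nat list set" and C :: "nat candidate_ds" and \<pi> :: "nat list"
begin

abbreviation "WP \<equiv> wp w A C \<pi>"

lemma wp_det: "exec w A C \<pi> c s s' t q \<Longrightarrow> WP c Q s \<longleftrightarrow> Q s' t q"
  unfolding wp_def using exec_deterministic by blast

lemmas wp_Skip = wp_det[OF exec.Skip]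
lemmas wp_Const = wp_det[OF exec.Const]
lemmas wp_Move = wp_det[OF exec.Move]
lemmas wp_Bin = wp_det[OF exec.Bin]
lemmas wp_Load = wp_det[OF exec.Load]
lemmas wp_Store = wp_det[OF exec.Store]
lemmas wp_Compare = wp_det[OF exec.Compare]
lemmas wp_CallInit = wp_det[OF exec.CallInit[OF refl]]
lemmas wp_CallStep = wp_det[OF exec.CallStep[OF _ refl _ refl]]

lemma wp_Seq: "WP (Seq c d) Q s \<longleftrightarrow> WP c (\<lambda>s' t q. WP d (\<lambda>s'' t' q'. Q s'' (t + t') (q + q')) s') s"
  unfolding wp_def by (auto elim!: exec_SeqE) (blast intro: exec.intros)+

lemma exec_IfNZ_iff: "exec w A C \<pi> (IfNZ r c d) s s' t q \<longleftrightarrow>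
    (\<exists>u. t = 1 + u \<and> exec w A C \<pi> (if regs s r \<noteq> 0 then c else d) s s' u q)" (is "?L \<longleftrightarrow> ?R")
proof
  assume ?L
  then show ?R by (rule exec_IfE) auto
next
  assume ?R
  then obtain u where "t = 1 + u" "exec w A C \<pi> (if regs s r \<noteq> 0 then c else d) s s' u q" by blast
  then show ?L by (cases "regs s r = 0") (simp_all only: if_True if_False simp_thms exec.IfTrue exec.IfFalse)
qed

lemma wp_IfNZ: "WP (IfNZ r c d) Q s \<longleftrightarrow>
    WP (if regs s r \<noteq> 0 then c else d) (\<lambda>s' t q. Q s' (1 + t) q) s"
  unfolding wp_def exec_IfNZ_iff by blast

lemma wp_Nil: "WP (block []) Q s \<longleftrightarrow> Q s 1 0"
  by (simp add: wp_Skip)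

lemma wp_Cons: "WP (block (c # cs)) Q s \<longleftrightarrow>
    WP c (\<lambda>s' t q. WP (block cs) (\<lambda>s'' t' q'. Q s'' (t + t') (q + q')) s') s"
  by (simp add: wp_Seq)

text \<open>The termination measure and the costs accumulated so far are arguments of the invariant.
  The measure need not be computable from the state, and amortised bounds can be stated inside the
  invariant.\<close>

lemma wp_WhileNZ:
  fixes m :: nat
  assumes "I m s 0 0"
    and step: "\<And>m s t q. I m s t q \<Longrightarrow> regs s r \<noteq> 0 \<Longrightarrow>
      WP c (\<lambda>s' t' q'. \<exists>m'<m. I m' s' (1 + t + t') (q + q')) s"
    and final: "\<And>m s t q. I m s t q \<Longrightarrow> regs s r = 0 \<Longrightarrow> Q s (1 + t) q"
  shows "WP (WhileNZ r c) Q s"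
proof -
  have "\<exists>s' t' q'. exec w A C \<pi> (WhileNZ r c) s s' t' q' \<and> Q s' (t + t') (q + q')"
    if "I m s t q" for m s t q
    using that
  proof (induction m arbitrary: s t q rule: less_induct)
    case (less m)
    show ?case
    proof (cases "regs s r = 0")
      case True
      then have "Q s (t + 1) (q + 0)" using final[OF less.prems] by simp
      then show ?thesis using exec.WhileFalse[of s r, OF True] by blast
    next
      case False
      then obtain s1 t1 q1 m1 where 1: "exec w A C \<pi> c s s1 t1 q1" "m1 < m" "I m1 s1 (1 + t + t1) (q + q1)"
        using step[OF less.prems] unfolding wp_def by blast
      obtain s' t' q' where "exec w A C \<pi> (WhileNZ r c) s1 s' t' q'" "Q s' (1 + t + t1 + t') (q + q1 + q')"
        using less.IH[OF 1(2,3)] by blast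
      then have "exec w A C \<pi> (WhileNZ r c) s s' (1 + t1 + t') (q1 + q')" "Q s' (t + (1 + t1 + t')) (q + (q1 + q'))"
        using exec.WhileTrue[OF False 1(1)] by (auto simp: algebra_simps)
      then show ?thesis by blast
    qed
  qed
  from this[OF assms(1)] show ?thesis by (simp add: wp_def)
qed

text \<open>
  Specifications of programs leave the postcondition \<open>Q\<close> open, so that they apply directly to the goals
  that remain after symbolic execution with these equations.
\<close>

lemmas wp_simps = wp_Skip wp_Const wp_Move wp_Bin wp_Load wp_Store wp_IfNZ wp_Nil wp_Cons

end

lemma binop_val_Add [simp]: "a + b < 2 ^ w \<Longrightarrow> binop_val w Add a b = a + b"
  by simp

lemma binop_val_Sub [simp]: "b \<le> a \<Longrightarrow> a < 2 ^ w \<Longrightarrow> binop_val w Sub a b = a - b"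
proof -
  assume "b \<le> a" "a < 2 ^ w"
  then have "a + (2 ^ w - b) = (a - b) + 2 ^ w" by simp
  then show ?thesis unfolding binop_val.simps using \<open>a < 2 ^ w\<close> by (simp only: mod_add_self2) simp
qed

declare binop_val.simps(1,2) [simp del]

declare block.simps [simp del]

section \<open>Minima of the levels of the heap\<close>

definition ismin :: "(nat \<Rightarrow> nat) \<Rightarrow> nat \<Rightarrow> nat set \<Rightarrow> bool" where
  "ismin key b E \<longleftrightarrow> (if b = 0 then E = {} else b \<in> E \<and> (\<forall>e\<in>E. key b \<le> key e))"

text \<open>\<open>lt e\<close> is the letter of node \<open>e\<close>. The space condition covers
  the nine blocks and the scratch cell, with room to spare so that address sums do not wrap
  around.\<close>

locale heap_ram = ram +
  fixes S :: nat and lt :: "nat \<Rightarrow> nat"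
  assumes space: "10 * S < 2 ^ w" and S_pos: "2 \<le> S" and dist: "distinct \<pi>"
begin

definition key :: "nat \<Rightarrow> nat" where "key e = idx \<pi> (lt e)"

text \<open>
  Memory is divided into blocks of \<open>S\<close> cells, starting at 0: the output, the queue of the layer
  computation, the bottlenecks, the log of all reported letters, the links of the linked lists, the
  results of the searches (0 if there is none yet), the lists of the heap (two blocks), and the minima
  of its levels. Cell \<open>9 * S\<close> is scratch. A node of the heap is the address of its letter in the log,
  and 0 is the null pointer.
\<close>

definition env :: "state \<Rightarrow> bool" where
  "env s \<longleftrightarrow> regs s 19 = 1 \<and> regs s 2 = S \<and> regs s 3 = 2 * S \<and> regs s 10 = 6 * S \<and> regs s 12 = 0"

definition node :: "state \<Rightarrow> nat \<Rightarrow> bool" where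
  "node s e \<longleftrightarrow> 3 * S \<le> e \<and> e < 4 * S \<and> mem s e = lt e \<and> lt e \<in> set \<pi>"

text \<open>Keeps in register 32 the node with the smaller letter among registers 32 and 33. Null
  pointers are dealt with first, so empty lists cost no comparison.\<close>

definition best :: com where
  "best = IfNZ 33 (IfNZ 32 (block [Load 34 32, Load 35 33, Compare 36 35 34, IfNZ 36 (Move 32 33) Skip])
    (Move 32 33)) Skip"

lemma wp_best:
  assumes "ismin key (regs s 32) E" "ismin key (regs s 33) E'" "\<And>e. e \<in> E \<union> E' \<Longrightarrow> node s e"
    and "\<And>s' t q. t \<le> 9 \<Longrightarrow> q \<le> 1 \<Longrightarrow> mem s' = mem s \<Longrightarrow> hist s' = hist s \<Longrightarrow>
      (\<forall>r. r \<notin> {32, 34, 35, 36} \<longrightarrow> regs s' r = regs s r) \<Longrightarrow>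
      ismin key (regs s' 32) (E \<union> E') \<Longrightarrow> Q s' t q"
  shows "WP best Q s"
proof (cases "regs s 32 = 0 \<or> regs s 33 = 0")
  case True
  then show ?thesis
    by (auto simp: best_def wp_simps intro!: assms(4)) (use assms(1,2) in \<open>auto simp: ismin_def\<close>)
next
  case False
  then have "node s (regs s 32)" "node s (regs s 33)" using assms(1-3) by (auto simp: ismin_def)
  then have lt: "mem s (regs s 32) = lt (regs s 32)" "lt (regs s 32) \<in> set \<pi>"
    "mem s (regs s 33) = lt (regs s 33)" "lt (regs s 33) \<in> set \<pi>"
    by (auto simp: node_def)
  have min: "regs s 32 \<in> E" "regs s 33 \<in> E'" "\<forall>e\<in>E. key (regs s 32) \<le> key e" "\<forall>e\<in>E'. key (regs s 33) \<le> key e"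
    using assms(1,2) False by (auto simp: ismin_def)
  have 1: "ismin key (regs s 33) (E \<union> E')" if "key (regs s 33) < key (regs s 32)"
    using min False that unfolding ismin_def by (metis Un_iff empty_iff less_imp_le order_trans)
  have 2: "ismin key (regs s 32) (E \<union> E')" if "\<not> key (regs s 33) < key (regs s 32)"
    using min False that unfolding ismin_def by (metis Un_iff empty_iff not_less order_trans)
  show ?thesis
    using False lt dist
    apply (simp add: best_def wp_simps wp_Compare precedes_iff_idx flip: key_def)
    apply (intro conjI impI)
     apply (rule assms(4); simp add: 1)
    apply (rule assms(4); simp add: 2)
    done
qed

definition fix_step :: com where
  "fix_step = block [
     Bin Sub 30 30 19,
     Bin Add 31 10 30,
     Bin Add 37 31 3,
     Bin Add 38 37 19,
     Load 32 38,
     Load 33 31,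
     best,
     Bin Add 38 31 2,
     Load 33 38,
     best,
     Store 37 32]"

definition fix_mins :: com where
  "fix_mins = WhileNZ 30 fix_step"

text \<open>Cell \<open>8 * S + j\<close> holds the minimum over the levels from \<open>j\<close>
  upwards, not that of level \<open>j\<close> alone. A change on level \<open>i\<close> then affects
  only the cells up to \<open>i\<close>, and cell \<open>8 * S\<close> holds the minimum of the
  whole heap.\<close>

definition below :: "(nat \<Rightarrow> nat list) \<Rightarrow> nat \<Rightarrow> nat set" where
  "below L j = (\<Union>k\<in>{j..<S}. set (L (6 * S + k)) \<union> set (L (7 * S + k)))"

lemma below_Suc: "j < S \<Longrightarrow> below L j = set (L (6 * S + j)) \<union> set (L (7 * S + j)) \<union> below L (Suc j)"
proof -
  assume "j < S"
  then have "{j..<S} = insert j {Suc j..<S}" by auto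
  then show ?thesis by (simp add: below_def)
qed

lemma wp_fix_step:
  assumes env: "env s" and c: "regs s 30 = Suc k" "Suc k < S"
    and hd: "ismin key (mem s (6 * S + k)) (set (L (6 * S + k)))"
            "ismin key (mem s (7 * S + k)) (set (L (7 * S + k)))"
    and sm: "ismin key (mem s (8 * S + Suc k)) (below L (Suc k))"
    and nodes: "\<And>e. e \<in> below L k \<Longrightarrow> node s e"
    and Q: "\<And>s' t q b. t \<le> 29 \<Longrightarrow> q \<le> 2 \<Longrightarrow> hist s' = hist s \<Longrightarrow> regs s' 30 = k \<Longrightarrow>
      mem s' = (mem s)(8 * S + k := b) \<Longrightarrow> ismin key b (below L k) \<Longrightarrow>
      (\<forall>r. r \<notin> {30..38} \<longrightarrow> regs s' r = regs s r) \<Longrightarrow> Q s' t q"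
  shows "WP fix_step Q s"
  using env c(2) space c(1) hd sm
  apply (simp add: fix_step_def wp_simps env_def)
  apply (rule wp_best[where E = "below L (Suc k)" and E' = "set (L (6 * S + k))"])
  apply simp
  apply simp
   apply (use nodes below_Suc[OF Suc_lessD[OF c(2)], of L] in \<open>auto simp: node_def\<close>)[1]
  apply (simp add: wp_simps)
  apply (rule wp_best[where E = "below L (Suc k) \<union> set (L (6 * S + k))" and E' = "set (L (7 * S + k))"])
  apply simp
  apply simp
   apply (use nodes below_Suc[OF Suc_lessD[OF c(2)], of L] in \<open>auto simp: node_def\<close>)[1]
  apply (simp add: wp_simps)
  apply (rule Q)
  apply (simp_all add: below_Suc[OF Suc_lessD[OF c(2)], of L] Un_ac)
  apply auto
  done

text \<open>On each level the minima of the two lists are their heads and the cell above supplies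
  the minimum of the higher levels, so two comparisons per level suffice.\<close>

lemma wp_fix_mins:
  assumes env: "env s" and c: "regs s 30 = Suc i" "Suc i < S"
    and hd: "\<And>j. j \<le> i \<Longrightarrow> ismin key (mem s (6 * S + j)) (set (L (6 * S + j)))"
            "\<And>j. j \<le> i \<Longrightarrow> ismin key (mem s (7 * S + j)) (set (L (7 * S + j)))"
    and sm: "\<And>j. i < j \<Longrightarrow> j < S \<Longrightarrow> ismin key (mem s (8 * S + j)) (below L j)"
    and nodes: "\<And>e. e \<in> below L 0 \<Longrightarrow> node s e"
    and Q: "\<And>s' t q. t \<le> 30 * Suc i + 1 \<Longrightarrow> q \<le> 2 * Suc i \<Longrightarrow> hist s' = hist s \<Longrightarrow>
      (\<forall>a. a < 8 * S \<or> 9 * S \<le> a \<longrightarrow> mem s' a = mem s a) \<Longrightarrow>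
      (\<forall>r. r \<notin> {30..38} \<longrightarrow> regs s' r = regs s r) \<Longrightarrow>
      (\<forall>j<S. ismin key (mem s' (8 * S + j)) (below L j)) \<Longrightarrow> Q s' t q"
  shows "WP fix_mins Q s"
  unfolding fix_mins_def
proof (rule wp_WhileNZ[where I = "\<lambda>m s' t q. regs s' 30 = m \<and> m \<le> Suc i \<and>
    t + 30 * m \<le> 30 * Suc i \<and> q + 2 * m \<le> 2 * Suc i \<and> hist s' = hist s \<and>
    (\<forall>a. a < 8 * S \<or> 9 * S \<le> a \<longrightarrow> mem s' a = mem s a) \<and>
    (\<forall>r. r \<notin> {30..38} \<longrightarrow> regs s' r = regs s r) \<and>
    (\<forall>j<S. m \<le> j \<longrightarrow> ismin key (mem s' (8 * S + j)) (below L j))" and m = "Suc i"], goal_cases)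
  case 1
  then show ?case using c sm by auto
next
  case (2 m u t q)
  then obtain k where m: "m = Suc k" by (cases m) auto
  have k: "k \<le> i" "Suc k < S" using 2 m c by auto
  show ?case
  proof (rule wp_fix_step[where L = L and k = k])
    show "env u" using env 2(1) by (auto simp: env_def)
    show "ismin key (mem u (6 * S + k)) (set (L (6 * S + k)))" "ismin key (mem u (7 * S + k)) (set (L (7 * S + k)))"
      using hd[OF k(1)] 2(1) k by auto
    have "\<forall>j<S. m \<le> j \<longrightarrow> ismin key (mem u (8 * S + j)) (below L j)" using 2(1) by blast
    then show "ismin key (mem u (8 * S + Suc k)) (below L (Suc k))"
      using m k(2) by (auto dest!: spec[of _ "Suc k"])
    show "node u e" if "e \<in> below L k" for e
    proof -
      have "e \<in> below L 0" using that by (auto simp: below_def)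
      then show ?thesis using nodes[of e] 2(1) by (auto simp: node_def)
    qed
  next
    fix s' and ta qa b :: nat
    assume a: "ta \<le> 29" "qa \<le> 2" "hist s' = hist u" "regs s' 30 = k" "mem s' = (mem u)(8 * S + k := b)"
      "ismin key b (below L k)" "\<forall>r. r \<notin> {30..38} \<longrightarrow> regs s' r = regs u r"
    have "ismin key (mem s' (8 * S + j)) (below L j)" if "j < S" "k \<le> j" for j
      using that 2(1) a m by (cases "j = k") auto
    then show "\<exists>m'<m. regs s' 30 = m' \<and> m' \<le> Suc i \<and>
      1 + t + ta + 30 * m' \<le> 30 * Suc i \<and> q + qa + 2 * m' \<le> 2 * Suc i \<and> hist s' = hist s \<and>
      (\<forall>a. a < 8 * S \<or> 9 * S \<le> a \<longrightarrow> mem s' a = mem s a) \<and>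
      (\<forall>r. r \<notin> {30..38} \<longrightarrow> regs s' r = regs s r) \<and>
      (\<forall>j<S. m' \<le> j \<longrightarrow> ismin key (mem s' (8 * S + j)) (below L j))"
      using 2(1) a m k by (intro exI[of _ k]) auto
  qed (use k m 2(1) in auto)
next
  case (3 m u t q)
  then show ?case by (intro Q) auto
qed

text \<open>\<open>nl m a xs\<close>: the address \<open>a\<close> heads the list \<open>xs\<close>.
  \<open>seg m c ds p\<close>: the links starting in cell \<open>c\<close> run through \<open>ds\<close> and end in cell \<open>p\<close>.\<close>

fun nl :: "(nat \<Rightarrow> nat) \<Rightarrow> nat \<Rightarrow> nat list \<Rightarrow> bool" where
  "nl m a [] \<longleftrightarrow> a = 0"
| "nl m a (x # xs) \<longleftrightarrow> a = x \<and> x \<noteq> 0 \<and> nl m (m (x + S)) xs"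

fun seg :: "(nat \<Rightarrow> nat) \<Rightarrow> nat \<Rightarrow> nat list \<Rightarrow> nat \<Rightarrow> bool" where
  "seg m c [] p \<longleftrightarrow> p = c"
| "seg m c (d # ds) p \<longleftrightarrow> m c = d \<and> d \<noteq> 0 \<and> seg m (d + S) ds p"

lemma nl_cong: "(\<And>x. x \<in> set xs \<Longrightarrow> m (x + S) = m' (x + S)) \<Longrightarrow> nl m a xs \<longleftrightarrow> nl m' a xs"
  by (induction xs arbitrary: a) auto

text \<open>Agreement at the end cell \<open>p\<close> is not demanded: the cells of the segment are
  distinct and following it stops at \<open>p\<close> without reading it. Hence overwriting
  \<open>p\<close> preserves the segment.\<close>

lemma seg_cong: "(\<And>x. x = c \<or> x \<in> (\<lambda>d. d + S) ` set ds \<Longrightarrow> x \<noteq> p \<Longrightarrow> m x = m' x) \<Longrightarrow>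
    distinct (c # map (\<lambda>d. d + S) ds) \<Longrightarrow> seg m c ds p \<Longrightarrow> seg m' c ds p"
proof (induction ds arbitrary: c)
  case (Cons d ds)
  have pend: "p \<in> (\<lambda>d. d + S) ` set (e # es)" if "seg m (e + S) es p" for e es
    using that by (induction es arbitrary: e) auto
  have "p \<noteq> c" using pend[of d ds] Cons.prems by auto
  then have "m' c = d" using Cons.prems(1)[of c] Cons.prems(3) by auto
  moreover have "seg m' (d + S) ds p"
    using Cons.prems by (intro Cons.IH) auto
  ultimately show ?case using Cons.prems by simp
qed simp

lemma seg_end: "seg m c ds p \<Longrightarrow> p = c \<or> p \<in> (\<lambda>d. d + S) ` set ds"
  by (induction ds arbitrary: c) auto

lemma seg_append: "seg m c (ds @ es) p \<longleftrightarrow> (\<exists>q. seg m c ds q \<and> seg m q es p)"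
  by (induction ds arbitrary: c) auto

lemma seg_nl: "seg m c ds p \<Longrightarrow> nl m (m p) xs \<Longrightarrow> nl m (m c) (ds @ xs)"
  by (induction ds arbitrary: c) auto

text \<open>Appending \<open>x\<close> to the output overwrites one cell, \<open>p\<close>, which is
  the scratch cell or the link of a node already output. The links of both remaining lists are
  untouched.\<close>

lemma merge_move:
  assumes "seg m (9 * S) ds p" "nl m x (x # xs)" "nl m b ys" "distinct (ds @ (x # xs) @ ys)"
    and nodes: "\<forall>e\<in>set (ds @ (x # xs) @ ys). 3 * S \<le> e \<and> e < 4 * S"
  shows "seg (m(p := x)) (9 * S) (ds @ [x]) (x + S)" "nl (m(p := x)) (m (x + S)) xs" "nl (m(p := x)) b ys"
    "p \<noteq> x + S" "p = 9 * S \<or> p \<in> (\<lambda>d. d + S) ` set ds"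
proof -
  show p: "p = 9 * S \<or> p \<in> (\<lambda>d. d + S) ` set ds" using seg_end[OF assms(1)] .
  have n: "p \<noteq> e + S" if "e \<in> set ((x # xs) @ ys)" for e
    using p that assms(4) nodes S_pos by fastforce
  then show "p \<noteq> x + S" by simp
  have "9 * S \<noteq> d + S" if "d \<in> set ds" for d
    using that nodes[rule_format, of d] S_pos by auto
  then have "distinct (9 * S # map (\<lambda>d. d + S) ds)"
    using assms(4) by (auto simp: distinct_map inj_on_def)
  then have "seg (m(p := x)) (9 * S) ds p"
    by (intro seg_cong[OF _ _ assms(1)]) auto
  then show "seg (m(p := x)) (9 * S) (ds @ [x]) (x + S)"
    using assms(2) by (auto simp: seg_append)
  have "nl m (m (x + S)) xs" using assms(2) by simp
  then show "nl (m(p := x)) (m (x + S)) xs"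
    by (subst nl_cong[where m' = m]) (use n in auto)
  show "nl (m(p := x)) b ys"
    by (subst nl_cong[where m' = m]) (use n assms(3) in auto)
qed

section \<open>Merging linked lists\<close>

definition merge_step :: com where
  "merge_step = block [
     Load 23 20,
     Load 24 21,
     Compare 25 23 24,
     IfNZ 25
       (block [Store 22 20, Bin Add 22 20 2, Load 20 22])
       (block [Store 22 21, Bin Add 22 21 2, Load 21 22]),
     IfNZ 20 (Move 26 21) (Move 26 20)]"

text \<open>The scratch cell is a dummy head, so appending is always a write to the cell addressed
  by register 22. Register 26 is set to a value that is 0 exactly if one of the lists is empty,
  which encodes the conjunction in the loop condition.\<close>

definition merge_lists :: com where
  "merge_lists = block [
     Bin Add 22 10 3,
     Bin Add 22 22 2,
     IfNZ 20 (Move 26 21) (Move 26 20),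
     WhileNZ 26 merge_step,
     IfNZ 20 (Store 22 20) (Store 22 21)]"

text \<open>\<open>ds\<close> is the output so far. Sortedness of both \<open>ds @ xs\<close> and
  \<open>ds @ ys\<close> says that the output precedes everything that remains, without relating
  \<open>xs\<close> to \<open>ys\<close>.\<close>

definition minv :: "state \<Rightarrow> nat set \<Rightarrow> nat list \<Rightarrow> nat list \<Rightarrow> nat list \<Rightarrow> state \<Rightarrow> bool" where
  "minv s0 N ds xs ys s \<longleftrightarrow>
     seg (mem s) (9 * S) ds (regs s 22) \<and> nl (mem s) (regs s 20) xs \<and> nl (mem s) (regs s 21) ys \<and>
     distinct (ds @ xs @ ys) \<and> set (ds @ xs @ ys) = N \<and>
     sorted (map key (ds @ xs)) \<and> sorted (map key (ds @ ys)) \<and> (\<forall>e\<in>N. node s e) \<and>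
     (regs s 26 = 0 \<longleftrightarrow> xs = [] \<or> ys = []) \<and>
     (\<forall>a. a \<noteq> 9 * S \<and> (a < 4 * S \<or> 5 * S \<le> a \<or> a - S \<notin> N) \<longrightarrow> mem s a = mem s0 a) \<and>
     (\<forall>r. r \<notin> {20..26} \<longrightarrow> regs s r = regs s0 r) \<and> hist s = hist s0"

lemma minv_nodes: "minv s0 N ds xs ys s \<Longrightarrow> \<forall>e\<in>set (ds @ xs @ ys). 3 * S \<le> e \<and> e < 4 * S"
  by (auto simp: minv_def node_def)

lemma nl_null: "nl m a xs \<Longrightarrow> a = 0 \<longleftrightarrow> xs = []"
  by (cases xs) auto

lemma wp_merge_step:
  assumes env: "env s" and inv: "minv s0 N ds (x # xs) (y # ys) s"
    and Q: "\<And>s' t q. t \<le> 14 \<Longrightarrow> q \<le> 1 \<Longrightarrow>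
      minv s0 N (ds @ [x]) xs (y # ys) s' \<or> minv s0 N (ds @ [y]) (x # xs) ys s' \<Longrightarrow> Q s' t q"
  shows "WP merge_step Q s"
proof -
  let ?p = "regs s 22"
  have lst: "seg (mem s) (9 * S) ds ?p" "nl (mem s) x (x # xs)" "nl (mem s) y (y # ys)"
    "distinct (ds @ (x # xs) @ (y # ys))" "distinct (ds @ (y # ys) @ (x # xs))" "regs s 20 = x" "regs s 21 = y"
    using inv by (auto simp: minv_def)
  have nodes: "node s x" "node s y" "\<forall>e\<in>N. node s e" using inv by (auto simp: minv_def)
  then have lt: "mem s x = lt x" "lt x \<in> set \<pi>" "mem s y = lt y" "lt y \<in> set \<pi>" "x + S < 2 ^ w" "y + S < 2 ^ w"
    using space by (auto simp: node_def)
  have nodes': "\<forall>e\<in>set (ds @ (y # ys) @ (x # xs)). 3 * S \<le> e \<and> e < 4 * S"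
    using minv_nodes[OF inv] by auto
  note mx = merge_move[OF lst(1,2,3,4) minv_nodes[OF inv]]
  note my = merge_move[OF lst(1,3,2,5) nodes']
  have p: "?p = 9 * S \<or> 4 * S \<le> ?p \<and> ?p < 5 * S \<and> ?p - S \<in> N"
    using mx(5) inv minv_nodes[OF inv] by (auto simp: minv_def)
  have node': "node u e" if "e \<in> N" "mem u = (mem s)(?p := v)" for u e v
    using nodes(3) that p by (auto simp: node_def)
  have xy: "x \<noteq> 0" "y \<noteq> 0" using lst by auto
  have fr: "(\<forall>a. a \<noteq> 9 * S \<and> (a < 4 * S \<or> 5 * S \<le> a \<or> a - S \<notin> N) \<longrightarrow> ((mem s)(?p := v)) a = mem s0 a)" for v
    using inv p by (auto simp: minv_def)
  have rest: "set (ds @ (x # xs) @ (y # ys)) = N" "\<forall>r. r \<notin> {20..26} \<longrightarrow> regs s r = regs s0 r" "hist s = hist s0"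
    using inv by (auto simp: minv_def)
  have srt: "sorted (map key (ds @ (x # xs)))" "sorted (map key (ds @ (y # ys)))"
    using inv by (auto simp: minv_def)
  have A: "minv s0 N (ds @ [x]) xs (y # ys) u"
    if u: "mem u = (mem s)(?p := x)" "regs u 20 = mem s (x + S)" "regs u 21 = y" "regs u 22 = x + S"
      "regs u 26 = 0 \<longleftrightarrow> mem s (x + S) = 0" "\<forall>r. r \<notin> {20..26} \<longrightarrow> regs u r = regs s r" "hist u = hist s"
      and le: "key x \<le> key y" for u
    unfolding minv_def
    using mx(1-3) nl_null[OF mx(2)] fr[of x] rest srt le lst(4) node'[OF _ u(1)] u by (auto simp: sorted_append)
  have B: "minv s0 N (ds @ [y]) (x # xs) ys u"
    if u: "mem u = (mem s)(?p := y)" "regs u 20 = x" "regs u 21 = mem s (y + S)" "regs u 22 = y + S"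
      "regs u 26 = 0 \<longleftrightarrow> mem s (y + S) = 0" "\<forall>r. r \<notin> {20..26} \<longrightarrow> regs u r = regs s r" "hist u = hist s"
      and le: "key y \<le> key x" for u
    unfolding minv_def
    using my(1-3) nl_null[OF my(2)] fr[of y] rest srt le lst(4) node'[OF _ u(1)] u by (auto simp: sorted_append)
  show ?thesis
  proof (cases "precedes \<pi> (lt x) (lt y)")
    case True
    then have le: "key x \<le> key y" using lt dist by (simp add: precedes_iff_idx key_def)
    show ?thesis
      using env lt lst(6,7) True mx(4) xy
      apply (simp add: merge_step_def wp_simps wp_Compare env_def)
      apply (rule conjI; rule impI; rule Q; (simp; fail)?; rule disjI1; rule A)
                     apply (simp_all add: le)
      done
  next
    case False
    then have le: "key y \<le> key x" using lt dist by (simp add: precedes_iff_idx key_def)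
    show ?thesis
      using env lt lst(6,7) False my(4) xy
      apply (simp add: merge_step_def wp_simps wp_Compare env_def)
      apply (rule Q; (simp; fail)?; rule disjI2; rule B)
             apply (simp_all add: le)
      done
  qed
qed

lemma seg_store: "seg m c ds p \<Longrightarrow> nl m a xs \<Longrightarrow> distinct (c # map (\<lambda>d. d + S) (ds @ xs)) \<Longrightarrow>
    nl (m(p := a)) ((m(p := a)) c) (ds @ xs)"
proof (rule seg_nl)
  assume a: "seg m c ds p" "nl m a xs" "distinct (c # map (\<lambda>d. d + S) (ds @ xs))"
  show "seg (m(p := a)) c ds p" using a by (intro seg_cong[OF _ _ a(1)]) auto
  have "p \<notin> (\<lambda>d. d + S) ` set xs" using seg_end[OF a(1)] a(3) by (auto simp: image_iff)
  then show "nl (m(p := a)) ((m(p := a)) p) xs" using a(2) by (subst nl_cong[where m' = m]) auto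
qed

lemma wp_merge_lists:
  assumes env: "env s" and xs: "nl (mem s) (regs s 20) xs" and ys: "nl (mem s) (regs s 21) ys"
    and d: "distinct (xs @ ys)" and srt: "sorted (map key xs)" "sorted (map key ys)"
    and nodes: "\<And>e. e \<in> set xs \<union> set ys \<Longrightarrow> node s e"
    and Q: "\<And>s' t q zs. t \<le> 16 * (length xs + length ys) + 12 \<Longrightarrow> q \<le> length xs + length ys \<Longrightarrow>
      nl (mem s') (mem s' (9 * S)) zs \<Longrightarrow> set zs = set xs \<union> set ys \<Longrightarrow> distinct zs \<Longrightarrow>
      sorted (map key zs) \<Longrightarrow> length zs = length xs + length ys \<Longrightarrow>
      (\<forall>a. a \<noteq> 9 * S \<and> (a < 4 * S \<or> 5 * S \<le> a \<or> a - S \<notin> set xs \<union> set ys) \<longrightarrow> mem s' a = mem s a) \<Longrightarrow>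
      (\<forall>r. r \<notin> {20..26} \<longrightarrow> regs s' r = regs s r) \<Longrightarrow> hist s' = hist s \<Longrightarrow> Q s' t q"
  shows "WP merge_lists Q s"
proof -
  let ?N = "set xs \<union> set ys"
  have loop: "WP (WhileNZ 26 merge_step) R u"
    if u: "minv s ?N [] xs ys u"
      and R: "\<And>s' t q ds xs' ys'. t \<le> 16 * (length xs + length ys) + 1 \<Longrightarrow> q \<le> length xs + length ys \<Longrightarrow>
        minv s ?N ds xs' ys' s' \<Longrightarrow> xs' = [] \<or> ys' = [] \<Longrightarrow> R s' t q" for R u
  proof (rule wp_WhileNZ[where m = "length xs + length ys" and I = "\<lambda>m s' t q. \<exists>ds xs' ys'.
      minv s ?N ds xs' ys' s' \<and> m = length xs' + length ys' \<and> t + 16 * m \<le> 16 * (length xs + length ys) \<and>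
      q + m \<le> length xs + length ys"], goal_cases)
    case 1
    then show ?case using u by fastforce
  next
    case (2 m u t q)
    then obtain ds xs' ys' where i: "minv s ?N ds xs' ys' u" "m = length xs' + length ys'"
      "t + 16 * m \<le> 16 * (length xs + length ys)" "q + m \<le> length xs + length ys" by blast
    have "xs' \<noteq> []" "ys' \<noteq> []" using i(1) 2(2) by (auto simp: minv_def)
    then obtain x xs'' y ys'' where e: "xs' = x # xs''" "ys' = y # ys''" by (meson neq_Nil_conv)
    have "env u" using env i(1) by (auto simp: minv_def env_def)
    then show ?case
    proof (rule wp_merge_step[OF _ i(1)[unfolded e]], goal_cases)
      case (1 s' ta qa)
      then show ?case
      proof (elim disjE, goal_cases)
        case 1
        then show ?case using i e
          by (intro exI[of _ "length xs'' + length (y # ys'')"] conjI exI) (assumption | simp)+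
      next
        case 2
        then show ?case using i e
          by (intro exI[of _ "length (x # xs'') + length ys''"] conjI exI) (assumption | simp)+
      qed
    qed
  next
    case (3 m u t q)
    then obtain ds xs' ys' where i: "minv s ?N ds xs' ys' u" "m = length xs' + length ys'"
      "t + 16 * m \<le> 16 * (length xs + length ys)" "q + m \<le> length xs + length ys" by blast
    have "xs' = [] \<or> ys' = []" using i(1) 3(2) by (auto simp: minv_def)
    then show ?case using i by (intro R[OF _ _ i(1)]) auto
  qed
  have fin: "Q s' t q" if m: "minv s ?N ds xs' ys' u" "xs' = [] \<or> ys' = []"
      and s': "mem s' = (mem u)(regs u 22 := (if regs u 20 = 0 then regs u 21 else regs u 20))"
        "regs s' = regs u" "hist s' = hist u"
      and t: "t \<le> 16 * (length xs + length ys) + 12" "q \<le> length xs + length ys" for ds xs' ys' u s' t q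
  proof -
    let ?zs = "if xs' = [] then ys' else xs'"
    let ?a = "if xs' = [] then regs u 21 else regs u 20"
    have "regs u 20 = 0 \<longleftrightarrow> xs' = []" using m nl_null by (auto simp: minv_def)
    note s' = s'[unfolded this]
    have sg: "seg (mem u) (9 * S) ds (regs u 22)" "nl (mem u) ?a ?zs" using m by (auto simp: minv_def)
    have dz: "distinct (ds @ ?zs)" "set (ds @ ?zs) = ?N" "sorted (map key (ds @ ?zs))"
      using m by (auto simp: minv_def)
    have nd: "\<forall>e\<in>?N. 3 * S \<le> e \<and> e < 4 * S" using minv_nodes[OF m(1)] m(1) by (auto simp: minv_def)
    have "9 * S \<noteq> e + S" if "e \<in> ?N" for e using nd[rule_format, OF that] S_pos by linarith
    then have "9 * S \<notin> (\<lambda>d. d + S) ` set (ds @ ?zs)" using dz(2) by blast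
    then have "distinct (9 * S # map (\<lambda>d. d + S) (ds @ ?zs))"
      using dz(1) by (simp only: distinct.simps distinct_map set_map) (auto simp: inj_on_def)
    from seg_store[OF sg this] have n: "nl (mem s') (mem s' (9 * S)) (ds @ ?zs)" using s' by simp
    have "regs u 22 = 9 * S \<or> 4 * S \<le> regs u 22 \<and> regs u 22 < 5 * S \<and> regs u 22 - S \<in> ?N"
      using seg_end[OF sg(1)] nd dz(2) by auto
    then have fr: "\<forall>a. a \<noteq> 9 * S \<and> (a < 4 * S \<or> 5 * S \<le> a \<or> a - S \<notin> ?N) \<longrightarrow> mem s' a = mem s a"
      using s' m(1) by (auto simp: minv_def)
    have "card ?N = length xs + length ys"
      using d by (simp add: card_Un_disjoint distinct_card)
    then have "length (ds @ ?zs) = length xs + length ys"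
      using dz(1,2) by (metis distinct_card)
    then show ?thesis
      using m s' by (intro Q[OF t n dz(2,1,3) _ fr]) (auto simp: minv_def)
  qed
  have init: "minv s ?N [] xs ys u" if "mem u = mem s" "hist u = hist s" "regs u 22 = 9 * S"
    "regs u 20 = regs s 20" "regs u 21 = regs s 21" "\<forall>r. r \<notin> {20..26} \<longrightarrow> regs u r = regs s r"
    "regs u 26 = (if regs s 20 = 0 then 0 else regs s 21)" for u
    using that xs ys d srt nodes nl_null[OF xs] nl_null[OF ys] by (auto simp: minv_def node_def)
  show ?thesis
    using env space
    apply (simp add: merge_lists_def wp_simps env_def)
    apply (intro conjI impI)
     apply (rule loop, rule init; simp)
     apply (simp add: wp_simps)
     apply (intro conjI impI)
      apply (rule fin, assumption, assumption; simp)
     apply (rule fin, assumption, assumption; simp)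
    apply (rule loop, rule init; simp)
    apply (simp add: wp_simps)
    apply (intro conjI impI)
     apply (rule fin, assumption, assumption; simp)
    apply (rule fin, assumption, assumption; simp)
    done
qed

section \<open>The heap\<close>

text \<open>Each level \<open>i\<close> has two cells, at \<open>6 * S + i\<close> and \<open>7 * S + i\<close>. Address 0 stands
  for the list that is carried from level to level, whose head is in a register.\<close>

definition cells :: "nat set" where "cells = {6 * S..<8 * S}"

text \<open>\<open>h\<close> supplies the heads and \<open>m\<close> the links. In use they differ
  only at address 0: in memory this cell belongs to the output, whereas here it stands for the
  register with the head of the carried list.\<close>

definition lists :: "(nat \<Rightarrow> nat) \<Rightarrow> (nat \<Rightarrow> nat) \<Rightarrow> (nat \<Rightarrow> nat list) \<Rightarrow> bool" where
  "lists h m L \<longleftrightarrow> (\<forall>c. if c \<in> insert 0 cells then nl m (h c) (L c) else L c = []) \<and>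
     (\<forall>c. distinct (L c) \<and> sorted (map key (L c))) \<and>
     (\<forall>c c'. c \<noteq> c' \<longrightarrow> set (L c) \<inter> set (L c') = {})"

definition nds :: "(nat \<Rightarrow> nat list) \<Rightarrow> nat set" where
  "nds L = (\<Union>c. set (L c))"

text \<open>\<open>arr i\<close> is the time, measured in insertions, at which a list most recently arrived at
  level \<open>i\<close>. A second arrival is needed to fill both cells and a third one to trigger a merge, so
  consecutive arrivals at level \<open>i\<close> are \<open>2 ^ i\<close> insertions apart.\<close>

definition aged :: "(nat \<Rightarrow> nat list) \<Rightarrow> (nat \<Rightarrow> nat) \<Rightarrow> (nat \<Rightarrow> nat) \<Rightarrow> bool" where
  "aged L arr r \<longleftrightarrow> (\<forall>i<S. arr (Suc i) \<le> arr i \<and>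
     (L (6 * S + i) \<noteq> [] \<and> L (7 * S + i) \<noteq> [] \<longrightarrow> arr (Suc i) + 2 ^ i \<le> arr i) \<and>
     (\<forall>e\<in>set (L (6 * S + i)) \<union> set (L (7 * S + i)). r e \<le> arr i \<and> (0 < i \<longrightarrow> r e + 2 ^ (i - 1) \<le> arr i)))"

definition level :: "nat \<Rightarrow> nat" where
  "level c = (if c < 7 * S then c - 6 * S else c - 7 * S)"

text \<open>The potential pays for the merges: each merge moves its elements up by one level.\<close>

definition pot :: "(nat \<Rightarrow> nat list) \<Rightarrow> nat" where
  "pot L = (\<Sum>c\<in>cells. level c * length (L c))"

text \<open>\<open>N\<close> counts the insertions so far, and \<open>r e\<close> is the number of
  the insertion of \<open>e\<close>. The arrival times exist only in the proof and are hidden by the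
  quantifier. Injectivity of \<open>key\<close> makes the minimum a unique node, which deletion
  relies on.\<close>

definition heap :: "(nat \<Rightarrow> nat list) \<Rightarrow> (nat \<Rightarrow> nat) \<Rightarrow> nat \<Rightarrow> nat set \<Rightarrow> state \<Rightarrow> bool" where
  "heap L r N E s \<longleftrightarrow> lists ((mem s)(0 := 0)) (mem s) L \<and> nds L = E \<and> (\<forall>e\<in>E. node s e) \<and> inj_on key E \<and>
     (\<forall>j<S. ismin key (mem s (8 * S + j)) (below L j)) \<and> (\<exists>arr. aged L arr r \<and> arr 0 \<le> N)"

lemma pot_upd: "c \<in> cells \<Longrightarrow> pot (L(c := xs)) + level c * length (L c) = pot L + level c * length xs"
  unfolding pot_def by (subst (1 2) sum.remove[of cells c]) (auto simp: cells_def)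

lemma pot_upd_0: "pot (L(0 := xs)) = pot L"
  unfolding pot_def using S_pos by (auto simp: cells_def intro!: sum.cong)

lemma level_simps: "i < S \<Longrightarrow> level (6 * S + i) = i" "level (7 * S + i) = i"
  by (auto simp: level_def)

lemma cells_simps: "i < S \<Longrightarrow> 6 * S + i \<in> cells" "i < S \<Longrightarrow> 7 * S + i \<in> cells" "0 \<notin> cells"
  using S_pos by (auto simp: cells_def)

lemma below_subset: "below L j \<subseteq> nds L"
  by (auto simp: below_def nds_def)

lemma nl_frame: "nl m a xs \<Longrightarrow> \<forall>e\<in>set xs. 3 * S \<le> e \<and> e < 4 * S \<Longrightarrow>
    (\<And>a. 4 * S \<le> a \<Longrightarrow> a < 5 * S \<Longrightarrow> m' a = m a) \<Longrightarrow> nl m' a xs"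
  by (subst nl_cong[where m' = m]) auto

lemma nl_ismin: "nl m a xs \<Longrightarrow> sorted (map key xs) \<Longrightarrow> ismin key a (set xs)"
  by (cases xs) (auto simp: ismin_def)

lemma nds_below: "lists h m L \<Longrightarrow> nds L = below L 0 \<union> set (L 0)"
proof -
  assume l: "lists h m L"
  have "x \<in> below L 0 \<union> set (L 0)" if x: "x \<in> set (L c)" for x c
  proof (cases "c = 0")
    case False
    then have c: "c \<in> cells" using l x unfolding lists_def by (metis empty_iff empty_set insert_iff)
    have "\<exists>k<S. c = 6 * S + k \<or> c = 7 * S + k"
      by (cases "c < 7 * S", rule exI[of _ "c - 6 * S"], use c in \<open>force simp: cells_def\<close>,
          rule exI[of _ "c - 7 * S"], use c in \<open>force simp: cells_def\<close>)
    then obtain k where "k \<in> {0..<S}" "c = 6 * S + k \<or> c = 7 * S + k" by auto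
    then show ?thesis using x unfolding below_def by blast
  qed (use x in auto)
  then show ?thesis by (auto simp: nds_def below_def)
qed

section \<open>Insertion into the heap\<close>

definition insert_step :: com where
  "insert_step = block [
     Load 20 42,
     Bin Add 44 42 2,
     Load 21 44,
     IfNZ 20
       (IfNZ 21
         (block [
           merge_lists,
           Store 42 41,
           Store 44 12,
           Bin Add 45 10 3,
           Bin Add 45 45 2,
           Load 41 45,
           Bin Add 42 42 19])
         (block [Store 44 41, Const 43 0]))
       (block [Store 42 41, Const 43 0])]"

definition insert_node :: com where
  "insert_node = block [
     Bin Add 41 40 2,
     Store 41 12,
     Bin Add 41 40 3,
     Store 41 12,
     Move 41 40,
     Move 42 10,
     Const 43 1,
     WhileNZ 43 insert_step,
     Bin Sub 30 42 10,
     Bin Add 30 30 19,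
     fix_mins]"

definition ins_inv :: "(nat \<Rightarrow> nat) \<Rightarrow> nat \<Rightarrow> nat set \<Rightarrow> nat \<Rightarrow> (nat \<Rightarrow> nat list) \<Rightarrow> (nat \<Rightarrow> nat) \<Rightarrow>
    nat \<Rightarrow> state \<Rightarrow> bool" where
  "ins_inv r N E i L arr a s \<longleftrightarrow> i < S \<and> regs s 42 = 6 * S + i \<and>
     lists ((mem s)(0 := a)) (mem s) L \<and> nds L = E \<and> (\<forall>e\<in>E. node s e) \<and>
     (\<forall>j<S. i < j \<longrightarrow> ismin key (mem s (8 * S + j)) (below L j)) \<and> aged L arr r \<and> arr 0 \<le> N"

text \<open>What a list carried to level \<open>i\<close> during insertion number \<open>N\<close>
  must satisfy to be recorded as an arrival there. The level just left has received its list at time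
  \<open>N\<close> and holds only that one, so the gap condition between levels \<open>i - 1\<close>
  and \<open>i\<close> is void there.\<close>

definition ins_carry :: "(nat \<Rightarrow> nat) \<Rightarrow> nat \<Rightarrow> nat \<Rightarrow> (nat \<Rightarrow> nat list) \<Rightarrow> (nat \<Rightarrow> nat) \<Rightarrow> bool" where
  "ins_carry r N i L arr \<longleftrightarrow> arr i + 2 ^ i \<le> N \<and> (0 < i \<longrightarrow> arr (i - 1) = N \<and> L (7 * S + (i - 1)) = []) \<and>
     (\<forall>e\<in>set (L 0). r e \<le> N \<and> (0 < i \<longrightarrow> r e + 2 ^ (i - 1) \<le> N))"

lemma below_upd:
  assumes "i < j" "c = 6 * S + i \<or> c = 7 * S + i" "i < S"
  shows "below (L(c := xs)) j = below L j"
  unfolding below_def by (rule SUP_cong[OF refl]) (use assms in auto)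

lemma below_upd_0: "below (L(0 := xs)) j = below L j"
  unfolding below_def by (rule SUP_cong[OF refl]) (use S_pos in auto)

lemma aged_0: "aged (L(0 := xs)) arr r \<longleftrightarrow> aged L arr r"
  unfolding aged_def using S_pos by simp

lemma aged_put:
  assumes a: "aged L arr r" and c: "ins_carry r N i L arr" and i: "i < S" "cl = 6 * S + i \<or> cl = 7 * S + i"
    and e: "L cl = []" and N: "arr 0 \<le> N"
  shows "aged (L(cl := L 0)) (arr(i := N)) r" "(arr(i := N)) 0 \<le> N"
proof -
  have le: "arr i \<le> N" using c by (simp add: ins_carry_def)
  have "(arr(i := N)) (Suc j) \<le> (arr(i := N)) j \<and>
     ((L(cl := L 0)) (6 * S + j) \<noteq> [] \<and> (L(cl := L 0)) (7 * S + j) \<noteq> [] \<longrightarrow> (arr(i := N)) (Suc j) + 2 ^ j \<le> (arr(i := N)) j) \<and>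
     (\<forall>e\<in>set ((L(cl := L 0)) (6 * S + j)) \<union> set ((L(cl := L 0)) (7 * S + j)).
        r e \<le> (arr(i := N)) j \<and> (0 < j \<longrightarrow> r e + 2 ^ (j - 1) \<le> (arr(i := N)) j))"
    if j: "j < S" for j
  proof -
    have aj: "arr (Suc j) \<le> arr j" "L (6 * S + j) \<noteq> [] \<and> L (7 * S + j) \<noteq> [] \<longrightarrow> arr (Suc j) + 2 ^ j \<le> arr j"
      "\<forall>e\<in>set (L (6 * S + j)) \<union> set (L (7 * S + j)). r e \<le> arr j \<and> (0 < j \<longrightarrow> r e + 2 ^ (j - 1) \<le> arr j)"
      using a j unfolding aged_def by blast+
    show ?thesis
    proof (cases "j = i")
      case True
      let ?X = "(L(cl := L 0)) (6 * S + j)" and ?Y = "(L(cl := L 0)) (7 * S + j)"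
      have sub: "set ?X \<union> set ?Y \<subseteq> set (L (6 * S + j)) \<union> set (L (7 * S + j)) \<union> set (L 0)" by auto
      have c': "arr j + 2 ^ j \<le> N" "\<forall>e\<in>set (L 0). r e \<le> N \<and> (0 < j \<longrightarrow> r e + 2 ^ (j - 1) \<le> N)"
        using c True unfolding ins_carry_def by blast+
      have "r e \<le> N \<and> (0 < j \<longrightarrow> r e + 2 ^ (j - 1) \<le> N)" if "e \<in> set ?X \<union> set ?Y" for e
        using sub that aj(3) c'(2) le True by (meson Un_iff order_trans subsetD)
      moreover have "arr (Suc j) + 2 ^ j \<le> N" using aj(1) c'(1) by simp
      ultimately show ?thesis using True aj(1) le by auto
    next
      case False
      have ne: "cl \<noteq> 6 * S + j" "cl \<noteq> 7 * S + j" using False i j by auto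
      show ?thesis
      proof (cases "Suc j = i")
        case True
        then have "arr j = N" using c by (auto simp: ins_carry_def)
        moreover have "L (6 * S + j) = [] \<or> L (7 * S + j) = []"
          using c True by (auto simp: ins_carry_def)
        ultimately show ?thesis using aj ne True by auto
      next
        case F2: False
        then show ?thesis using aj ne False by simp
      qed
    qed
  qed
  then show "aged (L(cl := L 0)) (arr(i := N)) r" unfolding aged_def by blast
  show "(arr(i := N)) 0 \<le> N" using N by simp
qed

text \<open>The two older lists are merged and the newcomer stays behind, so that a new node is not
  swept to a high level by a cascade of merges. Two full cells mean a gap of \<open>2 ^ i\<close>
  between the arrival times of levels \<open>i + 1\<close> and \<open>i\<close>, and the carry adds
  another \<open>2 ^ i\<close> up to \<open>N\<close>; the sum is the gap needed one level
  higher.\<close>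

lemma aged_merge:
  assumes a: "aged L arr r" and c: "ins_carry r N i L arr" and i: "Suc i < S"
    and ne: "L (6 * S + i) \<noteq> []" "L (7 * S + i) \<noteq> []" and N: "arr 0 \<le> N"
    and zs: "set zs = set (L (6 * S + i)) \<union> set (L (7 * S + i))"
  defines "L' \<equiv> L(6 * S + i := L 0, 7 * S + i := [], 0 := zs)"
  shows "aged L' (arr(i := N)) r" "(arr(i := N)) 0 \<le> N" "ins_carry r N (Suc i) L' (arr(i := N))"
proof -
  have a': "arr (Suc j) \<le> arr j" "L (6 * S + j) \<noteq> [] \<and> L (7 * S + j) \<noteq> [] \<longrightarrow> arr (Suc j) + 2 ^ j \<le> arr j"
      "\<forall>e\<in>set (L (6 * S + j)) \<union> set (L (7 * S + j)). r e \<le> arr j \<and> (0 < j \<longrightarrow> r e + 2 ^ (j - 1) \<le> arr j)"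
    if "j < S" for j using a that unfolding aged_def by blast+
  have c': "arr i + 2 ^ i \<le> N" "0 < i \<longrightarrow> arr (i - 1) = N \<and> L (7 * S + (i - 1)) = []"
     "\<forall>e\<in>set (L 0). r e \<le> N \<and> (0 < i \<longrightarrow> r e + 2 ^ (i - 1) \<le> N)"
    using c unfolding ins_carry_def by blast+
  have L': "L' (6 * S + j) = (if j = i then L 0 else L (6 * S + j))" "L' (7 * S + j) = (if j = i then [] else L (7 * S + j))"
    if "j < S" for j using that i by (auto simp: L'_def)
  have "(arr(i := N)) (Suc j) \<le> (arr(i := N)) j \<and>
     (L' (6 * S + j) \<noteq> [] \<and> L' (7 * S + j) \<noteq> [] \<longrightarrow> (arr(i := N)) (Suc j) + 2 ^ j \<le> (arr(i := N)) j) \<and>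
     (\<forall>e\<in>set (L' (6 * S + j)) \<union> set (L' (7 * S + j)).
        r e \<le> (arr(i := N)) j \<and> (0 < j \<longrightarrow> r e + 2 ^ (j - 1) \<le> (arr(i := N)) j))"
    if j: "j < S" for j
  proof (cases "j = i")
    case True
    then show ?thesis unfolding L'[OF j] using a'(1)[OF j] c'(1,3) by auto
  next
    case False
    show ?thesis
    proof (cases "Suc j = i")
      case True
      then have "arr j = N" "L (7 * S + j) = []" using c'(2) by auto
      then show ?thesis unfolding L'[OF j] using a'[OF j] True by auto
    next
      case F2: False
      then show ?thesis unfolding L'[OF j] using a'[OF j] False by simp
    qed
  qed
  then show "aged L' (arr(i := N)) r" unfolding aged_def by blast
  show "(arr(i := N)) 0 \<le> N" using N by simp
  have i': "i < S" using i by simp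
  have "arr (Suc i) + 2 ^ i \<le> arr i" using a'(2)[OF i'] ne by blast
  then have 1: "arr (Suc i) + 2 ^ Suc i \<le> N" using c'(1) by simp
  have "r e \<le> N \<and> r e + 2 ^ i \<le> N" if "e \<in> set zs" for e
  proof -
    have "r e \<le> arr i" using a'(3)[OF i'] that zs by blast
    then show ?thesis using c'(1) by linarith
  qed
  then show "ins_carry r N (Suc i) L' (arr(i := N))"
    unfolding ins_carry_def using 1 L'[OF i'] by (simp add: L'_def)
qed

lemma listsD:
  assumes "lists h m L"
  shows "c \<in> insert 0 cells \<Longrightarrow> nl m (h c) (L c)" "c \<notin> insert 0 cells \<Longrightarrow> L c = []"
    "distinct (L c)" "sorted (map key (L c))" "c \<noteq> c' \<Longrightarrow> set (L c) \<inter> set (L c') = {}"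
  using assms unfolding lists_def by metis+

lemma lists_put:
  assumes l: "lists (m(0 := a)) m L" and n: "\<forall>e\<in>nds L. 3 * S \<le> e \<and> e < 4 * S"
    and c: "c \<in> cells" "L c = []"
  defines "L' \<equiv> L(c := L 0, 0 := [])"
  shows "lists ((m(c := a))(0 := 0)) (m(c := a)) L'" "nds L' = nds L"
proof -
  note l' = listsD[OF l]
  have c0: "c \<noteq> 0" "6 * S \<le> c" using c S_pos by (auto simp: cells_def)
  have nl: "nl (m(c := a)) v (L d)" if "nl m v (L d)" for v d
    by (rule nl_frame[OF that]) (use n c0 in \<open>auto simp: nds_def\<close>)
  show "lists ((m(c := a))(0 := 0)) (m(c := a)) L'"
    unfolding lists_def
  proof (intro conjI allI impI, goal_cases)
    case (1 d)
    show ?case using l'(1)[of d] l'(1)[of 0] l'(2)[of d] c0 c nl by (auto simp: L'_def)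
  next
    case (2 d)
    then show ?case using l'(3,4) by (simp add: L'_def)
  next
    case (3 d)
    then show ?case using l'(3,4) by (simp add: L'_def)
  next
    case (4 d d')
    then show ?case using l'(5)[of d d'] l'(5)[of 0 d'] l'(5)[of d 0] by (auto simp: L'_def)
  qed
  have "set (L' d) \<subseteq> nds L" for d by (auto simp: L'_def nds_def)
  moreover have "set (L d) \<subseteq> nds L'" for d
  proof -
    have "set (L d) \<subseteq> set (L' (if d = 0 then c else d))" using c c0 by (auto simp: L'_def)
    then show ?thesis by (auto simp: nds_def)
  qed
  ultimately show "nds L' = nds L" unfolding nds_def by blast
qed

lemma lists_merge:
  assumes l: "lists (m(0 := a)) m L" and n: "\<forall>e\<in>nds L. 3 * S \<le> e \<and> e < 4 * S"
    and c: "c \<in> cells" "c' \<in> cells" "c \<noteq> c'"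
    and zs: "nl m2 (m2 (9 * S)) zs" "set zs = set (L c) \<union> set (L c')" "distinct zs" "sorted (map key zs)"
    and fr: "\<forall>b. b \<noteq> 9 * S \<and> (b < 4 * S \<or> 5 * S \<le> b \<or> b - S \<notin> set (L c) \<union> set (L c')) \<longrightarrow> m2 b = m b"
  defines "L' \<equiv> L(c := L 0, c' := [], 0 := zs)" and "m3 \<equiv> m2(c := a, c' := 0)"
  shows "lists (m3(0 := m3 (9 * S))) m3 L'" "nds L' = nds L" "m3 (9 * S) = m2 (9 * S)"
proof -
  note l' = listsD[OF l]
  have c0: "c \<noteq> 0" "6 * S \<le> c" "c < 8 * S" "c' \<noteq> 0" "6 * S \<le> c'" "c' < 8 * S" using c S_pos by (auto simp: cells_def)
  then show m3: "m3 (9 * S) = m2 (9 * S)" by (auto simp: m3_def)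
  have nl2: "nl m3 v xs" if "nl m2 v xs" "set xs \<subseteq> nds L" for v xs
    by (rule nl_frame[OF that(1)]) (use n c0 that in \<open>auto simp: m3_def\<close>)
  have nl: "nl m3 v (L d)" if "nl m v (L d)" "d \<noteq> c" "d \<noteq> c'" for v d
  proof (rule nl2)
    show "nl m2 v (L d)"
    proof (subst nl_cong[where m' = m])
      fix x assume x: "x \<in> set (L d)"
      then have "3 * S \<le> x" "x < 4 * S" using n by (auto simp: nds_def)
      moreover have "x \<notin> set (L c) \<union> set (L c')" using x l'(5)[of d c] l'(5)[of d c'] that by auto
      ultimately show "m2 (x + S) = m (x + S)" using fr by simp
    qed (rule that)
    show "set (L d) \<subseteq> nds L" by (auto simp: nds_def)
  qed
  have zs3: "nl m3 (m3 (9 * S)) zs" unfolding m3 by (rule nl2[OF zs(1)]) (use zs(2) in \<open>auto simp: nds_def\<close>)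
  have m3': "m3 d = (if d = c' then 0 else if d = c then a else m d)" if "d \<in> cells" for d
    using that fr S_pos by (auto simp: m3_def cells_def)
  show "lists (m3(0 := m3 (9 * S))) m3 L'"
    unfolding lists_def
  proof (intro conjI allI impI, goal_cases)
    case (1 d)
    show ?case
    proof (cases "d \<in> insert 0 cells")
      case True
      consider "d = 0" | "d = c" | "d = c'" | "d \<noteq> 0" "d \<noteq> c" "d \<noteq> c'" by blast
      then have "nl m3 ((m3(0 := m3 (9 * S))) d) (L' d)"
      proof cases
        case 1
        then show ?thesis using zs3 by (simp add: L'_def)
      next
        case 2
        have "nl m3 a (L 0)" using l'(1)[of 0] c0 by (intro nl) auto
        then show ?thesis using 2 c0 c m3'[OF c(1)] by (simp add: L'_def)
      next
        case 3
        then show ?thesis using c0 c m3'[OF c(2)] by (simp add: L'_def)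
      next
        case 4
        then have "nl m3 (m d) (L d)" using l'(1)[of d] True by (intro nl) auto
        then show ?thesis using 4 True m3'[of d] by (simp add: L'_def)
      qed
      then show ?thesis using True by simp
    next
      case False
      then show ?thesis using l'(2)[of d] c by (auto simp: L'_def)
    qed
  next
    case (2 d)
    then show ?case using l'(3) zs(3) by (simp add: L'_def)
  next
    case (3 d)
    then show ?case using l'(4) zs(4) by (simp add: L'_def)
  next
    case (4 d d')
    have *: "set zs \<inter> set (L e) = {}" if "e \<noteq> c" "e \<noteq> c'" for e
      using zs(2) l'(5)[of c e] l'(5)[of c' e] that by auto
    have z0: "set zs \<inter> set (L 0) = {}" using * c0 by auto
    show ?case using 4 *[of d] *[of d'] z0 l'(5)[of d d'] l'(5)[of 0 d'] l'(5)[of d 0]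
      by (auto simp: L'_def)
  qed
  have "set (L' d) \<subseteq> nds L" for d using zs(2) by (auto simp: L'_def nds_def)
  moreover have "set (L d) \<subseteq> nds L'" for d
  proof -
    have "set (L d) \<subseteq> set (L' (if d = 0 then c else if d = c \<or> d = c' then 0 else d))"
      using c c0 zs(2) by (auto simp: L'_def)
    then show ?thesis by (auto simp: nds_def)
  qed
  ultimately show "nds L' = nds L" unfolding nds_def by blast
qed

end

definition frame :: "nat set \<Rightarrow> nat set \<Rightarrow> state \<Rightarrow> state \<Rightarrow> bool" where
  "frame R M s s' \<longleftrightarrow> hist s' = hist s \<and> (\<forall>r. r \<notin> R \<longrightarrow> regs s' r = regs s r) \<and>
     (\<forall>a. a \<notin> M \<longrightarrow> mem s' a = mem s a)"

lemma frame_refl: "frame R M s s"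
  by (simp add: frame_def)

lemma frame_trans: "frame R M s s' \<Longrightarrow> frame R M s' s'' \<Longrightarrow> frame R M s s''"
  by (auto simp: frame_def)

context heap_ram
begin

lemma w_pos: "0 < w"
  using space S_pos by (cases w) auto

lemma node_frame: "node s e \<Longrightarrow> mem s' e = mem s e \<Longrightarrow> node s' e"
  by (simp add: node_def)

definition ins_regs :: "nat set" where "ins_regs = {20..26} \<union> {41..45}"
definition ins_mem :: "nat set" where "ins_mem = {4 * S..<5 * S} \<union> {6 * S..<8 * S} \<union> {9 * S}"

lemma ins_stop:
  assumes inv: "ins_inv r N E i L arr a s" and c: "ins_carry r N i L arr"
    and cl: "cl = 6 * S + i \<or> cl = 7 * S + i" "L cl = []"
    and u: "mem u = (mem s)(cl := a)" "regs u 42 = regs s 42"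
  shows "\<exists>L' arr'. ins_inv r N E i L' arr' 0 u \<and> L' 0 = [] \<and> pot L' = pot L + i * length (L 0)"
proof (intro exI conjI)
  let ?L = "L(cl := L 0, 0 := [])"
  have i: "i < S" and l: "lists ((mem s)(0 := a)) (mem s) L" and E: "nds L = E" "\<forall>e\<in>E. node s e"
    and sm: "\<forall>j<S. i < j \<longrightarrow> ismin key (mem s (8 * S + j)) (below L j)" and ag: "aged L arr r" "arr 0 \<le> N"
    using inv by (auto simp: ins_inv_def)
  have cl': "cl \<in> cells" "4 * S \<le> cl" "cl < 8 * S" "level cl = i" using cl(1) i by (auto simp: cells_simps level_simps)
  have bd: "\<forall>e\<in>nds L. 3 * S \<le> e \<and> e < 4 * S" using E by (auto simp: node_def)
  note p = lists_put[OF l bd cl'(1) cl(2)]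
  have "ismin key (mem u (8 * S + j)) (below ?L j)" if "j < S" "i < j" for j
    using sm that u cl' below_upd[OF that(2) cl(1) i, of L "L 0"] by (simp add: below_upd_0)
  moreover have "node u e" if "e \<in> E" for e
    using E(2) that u(1) cl' by (auto simp: node_def)
  moreover have "aged ?L (arr(i := N)) r" using aged_put(1)[OF ag(1) c i cl ag(2)] by (simp only: aged_0)
  ultimately show "ins_inv r N E i ?L (arr(i := N)) 0 u"
    using p i E u inv aged_put(2)[OF ag(1) c i cl ag(2)] unfolding ins_inv_def by simp
  show "?L 0 = []" by simp
  show "pot ?L = pot L + i * length (L 0)"
    using pot_upd[OF cl'(1), of L "L 0"] cl(2) cl'(4) by (simp only: pot_upd_0) simp
qed

text \<open>The carried list is counted as if it were already stored on its target level. With this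
  convention the potential grows by exactly the number of merged nodes, each of which rises by one
  level.\<close>

lemma ins_merge:
  assumes inv: "ins_inv r N E i L arr a s" and c: "ins_carry r N i L arr" and i: "Suc i < S"
    and ne: "L (6 * S + i) \<noteq> []" "L (7 * S + i) \<noteq> []"
    and zs: "nl m2 (m2 (9 * S)) zs" "set zs = set (L (6 * S + i)) \<union> set (L (7 * S + i))" "distinct zs" "sorted (map key zs)"
      "length zs = length (L (6 * S + i)) + length (L (7 * S + i))"
    and fr: "\<forall>b. b \<noteq> 9 * S \<and> (b < 4 * S \<or> 5 * S \<le> b \<or> b - S \<notin> set (L (6 * S + i)) \<union> set (L (7 * S + i))) \<longrightarrow> m2 b = mem s b"
    and u: "mem u = m2(6 * S + i := a, 7 * S + i := 0)" "regs u 42 = 6 * S + Suc i"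
  shows "\<exists>L' arr'. ins_inv r N E (Suc i) L' arr' (m2 (9 * S)) u \<and> ins_carry r N (Suc i) L' arr' \<and>
    pot L' + Suc i * length (L' 0) = pot L + i * length (L 0) + length zs"
proof (intro exI conjI)
  let ?L = "L(6 * S + i := L 0, 7 * S + i := [], 0 := zs)"
  have i': "i < S" and l: "lists ((mem s)(0 := a)) (mem s) L" and E: "nds L = E" "\<forall>e\<in>E. node s e"
    and sm: "\<forall>j<S. i < j \<longrightarrow> ismin key (mem s (8 * S + j)) (below L j)" and ag: "aged L arr r" "arr 0 \<le> N"
    using inv by (auto simp: ins_inv_def)
  have bd: "\<forall>e\<in>nds L. 3 * S \<le> e \<and> e < 4 * S" using E by (auto simp: node_def)
  have cc: "6 * S + i \<in> cells" "7 * S + i \<in> cells" "6 * S + i \<noteq> 7 * S + i" using i' S_pos by (auto simp: cells_simps)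
  note p = lists_merge[OF l bd cc zs(1-4) fr, folded u(1)]
  have mu: "mem u b = mem s b" if "b < 4 * S \<or> 8 * S \<le> b \<and> b \<noteq> 9 * S" for b
    using that fr u(1) i' by auto
  have "ismin key (mem u (8 * S + j)) (below ?L j)" if "j < S" "Suc i < j" for j
  proof -
    have ij: "i < j" using that by simp
    have "below ?L j = below L j"
      using below_upd[OF ij _ i', of "6 * S + i" L "L 0"] below_upd[OF ij _ i', of "7 * S + i" "L(6 * S + i := L 0)" "[]"]
      by (simp add: below_upd_0)
    then show ?thesis using sm that ij mu[of "8 * S + j"] by simp
  qed
  moreover have "node u e" if "e \<in> E" for e
    using E(2) that mu[of e] by (auto simp: node_def)
  moreover note g = aged_merge[OF ag(1) c i ne ag(2) zs(2)]
  ultimately show "ins_inv r N E (Suc i) ?L (arr(i := N)) (m2 (9 * S)) u"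
    using p i E u(2) unfolding ins_inv_def by simp
  show "ins_carry r N (Suc i) ?L (arr(i := N))" by (rule g(3))
  have "pot (L(6 * S + i := L 0)) + i * length (L (6 * S + i)) = pot L + i * length (L 0)"
    using pot_upd[OF cc(1), of L "L 0"] i' by (simp add: level_simps)
  moreover have "pot (L(6 * S + i := L 0, 7 * S + i := [])) + i * length (L (7 * S + i)) = pot (L(6 * S + i := L 0))"
    using pot_upd[OF cc(2), of "L(6 * S + i := L 0)" "[]"] i' S_pos by (simp add: level_simps)
  moreover have "length (?L 0) = length zs" by simp
  ultimately show "pot ?L + Suc i * length (?L 0) = pot L + i * length (L 0) + length zs"
    using zs(5) by (simp only: pot_upd_0) (simp add: algebra_simps)
qed

lemma wp_insert_step:
  assumes env: "env s" and inv: "ins_inv r N E i L arr (regs s 41) s" and c: "ins_carry r N i L arr"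
    and N: "N + 2 \<le> S"
    and stop: "\<And>s' t q L' arr'. t \<le> 12 \<Longrightarrow> q = 0 \<Longrightarrow> ins_inv r N E i L' arr' 0 s' \<Longrightarrow> L' 0 = [] \<Longrightarrow>
      pot L' = pot L + i * length (L 0) \<Longrightarrow> regs s' 43 = 0 \<Longrightarrow> frame ins_regs ins_mem s s' \<Longrightarrow> Q s' t q"
    and cont: "\<And>s' t q L' arr' k. t \<le> 16 * k + 30 \<Longrightarrow> q \<le> k \<Longrightarrow> ins_inv r N E (Suc i) L' arr' (regs s' 41) s' \<Longrightarrow>
      ins_carry r N (Suc i) L' arr' \<Longrightarrow> pot L' + Suc i * length (L' 0) = pot L + i * length (L 0) + k \<Longrightarrow> 2 \<le> k \<Longrightarrow>
      regs s' 43 = regs s 43 \<Longrightarrow> frame ins_regs ins_mem s s' \<Longrightarrow> Q s' t q"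
  shows "WP insert_step Q s"
proof -
  have i: "i < S" and r42: "regs s 42 = 6 * S + i" and l: "lists ((mem s)(0 := regs s 41)) (mem s) L"
    and E: "nds L = E" "\<forall>e\<in>E. node s e" using inv by (auto simp: ins_inv_def)
  have "arr i + 2 ^ i \<le> N" using c by (simp add: ins_carry_def)
  \<comment> \<open>Reaching level \<open>i\<close> takes at least \<open>2 ^ i\<close> insertions,
    so the levels cannot run past the \<open>S\<close> cells reserved for them.\<close>
  then have "i < N" using less_exp[of i] by linarith
  then have i': "Suc i < S" using N by simp
  note l' = listsD[OF l]
  have nlx: "nl (mem s) (mem s (6 * S + i)) (L (6 * S + i))" and nly: "nl (mem s) (mem s (7 * S + i)) (L (7 * S + i))"
    using l'(1)[of "6 * S + i"] l'(1)[of "7 * S + i"] i S_pos by (auto simp: cells_simps)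
  note nx = nl_null[OF nlx] and ny = nl_null[OF nly]
  have sp: "7 * S + i < 2 ^ w" "Suc (6 * S + i) < 2 ^ w" using space i by auto
  consider "mem s (6 * S + i) = 0" | "mem s (6 * S + i) \<noteq> 0" "mem s (7 * S + i) = 0"
    | "mem s (6 * S + i) \<noteq> 0" "mem s (7 * S + i) \<noteq> 0" by blast
  then show ?thesis
  proof cases
    case 1
    show ?thesis
      using env 1 r42 sp space
      apply (simp add: insert_step_def wp_simps env_def)
      apply (rule exE[OF ins_stop[OF inv c _ nx[THEN iffD1, OF 1]]])
         apply simp
        prefer 3
        apply (elim exE conjE)
        apply (rule stop, simp, simp, assumption+)
      using i S_pos by (auto simp: frame_def ins_regs_def ins_mem_def)
  next
    case 2
    show ?thesis
      using env 2 r42 sp space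
      apply (simp add: insert_step_def wp_simps env_def)
      apply (rule exE[OF ins_stop[OF inv c _ ny[THEN iffD1, OF 2(2)]]])
         apply simp
        prefer 3
        apply (elim exE conjE)
        apply (rule stop, simp, simp, assumption+)
      using i S_pos by (auto simp: frame_def ins_regs_def ins_mem_def)
  next
    case 3
    have ne: "L (6 * S + i) \<noteq> []" "L (7 * S + i) \<noteq> []" using 3 nx ny by auto
    have nodes: "node s e" if "e \<in> set (L (6 * S + i)) \<union> set (L (7 * S + i))" for e
      using E that by (auto simp: nds_def)
    have dj: "distinct (L (6 * S + i) @ L (7 * S + i))" using l'(3) l'(5)[of "6 * S + i" "7 * S + i"] S_pos by simp
    have K: "Q u t q"
      if zs: "nl m2 (m2 (9 * S)) zs" "set zs = set (L (6 * S + i)) \<union> set (L (7 * S + i))" "distinct zs"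
          "sorted (map key zs)" "length zs = length (L (6 * S + i)) + length (L (7 * S + i))"
        and fr: "\<forall>b. b \<noteq> 9 * S \<and> (b < 4 * S \<or> 5 * S \<le> b \<or> b - S \<notin> set (L (6 * S + i)) \<union> set (L (7 * S + i))) \<longrightarrow> m2 b = mem s b"
        and u: "mem u = m2(6 * S + i := regs s 41, 7 * S + i := 0)" "regs u 42 = 6 * S + Suc i"
          "regs u 41 = m2 (9 * S)" "regs u 43 = regs s 43" "hist u = hist s" "\<forall>r. r \<notin> ins_regs \<longrightarrow> regs u r = regs s r"
        and t: "t \<le> 16 * length zs + 30" "q \<le> length zs" for m2 zs u t q
    proof -
      obtain L' arr' where L': "ins_inv r N E (Suc i) L' arr' (m2 (9 * S)) u" "ins_carry r N (Suc i) L' arr'"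
        "pot L' + Suc i * length (L' 0) = pot L + i * length (L 0) + length zs"
        using ins_merge[OF inv c i' ne zs fr u(1,2)] by blast
      have "2 \<le> length zs" using ne zs(5) by (cases "L (6 * S + i)"; cases "L (7 * S + i)") auto
      moreover have "mem u a = mem s a" if a: "a \<notin> ins_mem" for a
      proof -
        have "a \<noteq> 9 * S" "a < 4 * S \<or> 5 * S \<le> a" "a \<noteq> 6 * S + i" "a \<noteq> 7 * S + i"
          using a i by (auto simp: ins_mem_def)
        moreover from this have "m2 a = mem s a" using fr by blast
        ultimately show ?thesis using u(1) by simp
      qed
      ultimately show ?thesis
        using u L' by (intro cont[OF t, of L' arr']) (auto simp: frame_def)
    qed
    have ne': "3 * S \<noteq> i" "2 * S \<noteq> i" using i by auto
    show ?thesis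
      using env 3 r42 sp space ne'
      apply (simp add: insert_step_def wp_simps env_def)
      apply (rule wp_merge_lists[where xs = "L (6 * S + i)" and ys = "L (7 * S + i)"])
             apply (simp add: env_def)
            apply (simp add: nlx)
           apply (simp add: nly)
          apply (rule dj)
         apply (rule l'(4))
        apply (rule l'(4))
       apply (rule node_frame[OF nodes], assumption, simp)
      apply (simp add: wp_simps)
      apply (rule K, assumption+)
             apply simp
            apply (simp add: fun_upd_twist)
           apply (simp_all add: ins_regs_def)
      done
  qed
qed

definition heap_regs :: "nat set" where "heap_regs = {20..26} \<union> {30..38} \<union> {41..45}"
definition heap_mem :: "nat set" where "heap_mem = {4 * S..<5 * S} \<union> {6 * S..9 * S}"

lemma wp_fix_heap:
  assumes env: "env v" and v: "regs v 30 = Suc i" "Suc i < S"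
    and l: "lists ((mem v)(0 := 0)) (mem v) L'" and E': "nds L' = E" "\<forall>e\<in>E. node v e" and inj: "inj_on key E"
    and sm: "\<forall>j<S. i < j \<longrightarrow> ismin key (mem v (8 * S + j)) (below L' j)" and ag: "aged L' arr' r" "arr' 0 \<le> N"
    and R: "\<And>s' t q. t \<le> 30 * Suc i + 1 \<Longrightarrow> q \<le> 2 * Suc i \<Longrightarrow> heap L' r N E s' \<Longrightarrow>
        frame {30..38} {8 * S..<9 * S} v s' \<Longrightarrow> R s' t q"
  shows "WP fix_mins R v"
proof -
    note l' = listsD[OF l]
    have hd: "ismin key (mem v c) (set (L' c))" if "c \<in> cells" for c
      using nl_ismin[OF _ l'(4)[of c], of "mem v" "mem v c"] l'(1)[of c] that cells_simps(3) by (auto split: if_splits)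
    show ?thesis
    proof (rule wp_fix_mins[where L = L', OF env v], goal_cases)
      case (1 j)
      then show ?case using v(2) by (intro hd) (simp add: cells_simps)
    next
      case (2 j)
      then show ?case using v(2) by (intro hd) (simp add: cells_simps)
    next
      case (3 j)
      then show ?case using sm by simp
    next
      case (4 e)
      then show ?case using E' below_subset[of L' 0] by blast
    next
      case (5 s' t q)
      have f: "frame {30..38} {8 * S..<9 * S} v s'" using 5 by (auto simp: frame_def)
      have nl: "nl (mem s') a xs" if "nl (mem v) a xs" "set xs \<subseteq> E" for a xs
        by (rule nl_frame[OF that(1)]) (use E' that 5(4) in \<open>auto simp: node_def\<close>)
      have "lists ((mem s')(0 := 0)) (mem s') L'"
        unfolding lists_def
      proof (intro conjI allI impI, goal_cases)
        case (1 c)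
        have "nl (mem s') (mem s' c) (L' c)" if "c \<in> cells"
        proof -
          have "mem s' c = mem v c" using that 5(4) by (auto simp: cells_def)
          moreover have "nl (mem v) (mem v c) (L' c)" using l'(1)[of c] that cells_simps(3) by (auto split: if_splits)
          moreover have "set (L' c) \<subseteq> E" using E'(1) unfolding nds_def by blast
          ultimately show ?thesis using nl by simp
        qed
        then show ?case using l'(1)[of 0] nl_null[of "mem v" 0 "L' 0"] l'(2)[of c] by (auto simp: cells_simps)
      qed (use l'(3,4) l'(5) in auto)
      moreover have "node s' x" if "x \<in> E" for x
        using E' that 5(4) by (auto simp: node_def)
      ultimately have "heap L' r N E s'" using E'(1) 5(6) ag inj unfolding heap_def by blast
      then show ?case by (intro R 5(1,2) f)
    qed
qed

text \<open>A merge of \<open>k \<ge> 2\<close> nodes raises the potential by \<open>k\<close>. Its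
  time \<open>16 * k + 30\<close>, one unit for the loop and 32 units set aside for updating the
  minimum of a level fit into \<open>48 * k\<close>; its \<open>k\<close> comparisons and two for
  that minimum fit into \<open>2 * k\<close>. This fixes the factors 48 and 2.\<close>

lemma wp_insert_node:
  assumes env: "env s" and heap: "heap L r N E s" and e: "node s (regs s 40)" "key (regs s 40) \<notin> key ` E"
    and r: "r (regs s 40) = Suc N" and N: "N + 3 \<le> S"
    and Q: "\<And>s' t q L'. t + 48 * pot L \<le> 48 * pot L' + 80 \<Longrightarrow> q + 2 * pot L \<le> 2 * pot L' + 2 \<Longrightarrow>
      heap L' r (Suc N) (insert (regs s 40) E) s' \<Longrightarrow> mem s' (regs s 40 + 2 * S) = 0 \<Longrightarrow>
      frame heap_regs (insert (regs s 40 + 2 * S) heap_mem) s s' \<Longrightarrow> Q s' t q"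
  shows "WP insert_node Q s"
proof -
  let ?e = "regs s 40"
  let ?E = "insert ?e E"
  have eb: "3 * S \<le> ?e" "?e < 4 * S" using e(1) by (auto simp: node_def)
  have l: "lists ((mem s)(0 := 0)) (mem s) L" and E: "nds L = E" "\<forall>e\<in>E. node s e" and inj: "inj_on key E"
    and sm: "\<forall>j<S. ismin key (mem s (8 * S + j)) (below L j)" using heap by (auto simp: heap_def)
  obtain arr where ag: "aged L arr r" "arr 0 \<le> N" using heap by (auto simp: heap_def)
  note l' = listsD[OF l]
  have L0: "L 0 = []" using l'(1)[of 0] nl_null[of "mem s" 0 "L 0"] by simp
  have eE: "?e \<notin> E" using e(2) by blast
  let ?L = "L(0 := [?e])"
  have start: "ins_inv r (Suc N) ?E 0 ?L arr ?e u \<and> ins_carry r (Suc N) 0 ?L arr"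
    if u: "mem u = (mem s)(?e + S := 0, ?e + 2 * S := 0)" "regs u 42 = 6 * S" for u
  proof -
    have mu: "mem u b = mem s b" if "b < 4 * S \<or> 6 * S \<le> b" for b using that u eb by auto
    have nlu: "nl (mem u) v (L c)" if "nl (mem s) v (L c)" for v c
    proof (subst nl_cong[where m' = "mem s"])
      fix x assume x: "x \<in> set (L c)"
      then have "x \<in> E" using E(1) by (auto simp: nds_def)
      then have "x \<noteq> ?e" "x + S < 5 * S" using eE E(2) by (auto simp: node_def)
      then show "mem u (x + S) = mem s (x + S)" using u eb by simp
    qed (rule that)
    have "lists ((mem u)(0 := ?e)) (mem u) ?L"
      unfolding lists_def
    proof (intro conjI allI impI, goal_cases)
      case (1 c)
      have "nl (mem u) ?e [?e]" using u eb by simp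
      moreover have "nl (mem u) (mem u c) (L c)" if "c \<in> cells"
        using nlu[OF l'(1)[of c, simplified]] that mu[of c] S_pos by (auto simp: cells_def split: if_splits)
      ultimately show ?case using l'(2)[of c] by (auto simp: cells_simps)
    next
      case (2 c)
      then show ?case using l'(3) by simp
    next
      case (3 c)
      then show ?case using l'(4) by simp
    next
      case (4 c c')
      have "?e \<notin> set (L d)" for d using eE E(1) by (auto simp: nds_def)
      then show ?case using 4 l'(5)[of c c'] by auto
    qed
    moreover have "nds ?L = ?E"
    proof -
      have "set (?L c) \<subseteq> ?E" for c using E(1) by (auto simp: nds_def)
      moreover have "set (L c) \<subseteq> set (?L c)" for c using L0 by auto
      moreover have "?e \<in> set (?L 0)" by simp
      ultimately show ?thesis unfolding nds_def E(1)[symmetric, unfolded nds_def] by blast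
    qed
    moreover have "node u x" if "x \<in> ?E" for x
      using that e(1) E(2) mu[of x] by (auto simp: node_def)
    moreover have "ismin key (mem u (8 * S + j)) (below ?L j)" if "j < S" for j
      using sm that mu[of "8 * S + j"] by (simp add: below_upd_0)
    ultimately show ?thesis using u S_pos ag r
      by (auto simp: ins_inv_def ins_carry_def aged_0)
  qed
  have loop: "WP (WhileNZ 43 insert_step) R u"
    if u: "mem u = (mem s)(?e + S := 0, ?e + 2 * S := 0)" "regs u 42 = 6 * S" "regs u 41 = ?e" "env u" "regs u 43 = 1"
      and R: "\<And>s' t q i L' arr'. t + 48 * pot L + 32 * i \<le> 48 * pot L' + 14 \<Longrightarrow> q + 2 * pot L + 2 * i \<le> 2 * pot L' \<Longrightarrow>
        Suc i < S \<Longrightarrow> ins_inv r (Suc N) ?E i L' arr' 0 s' \<Longrightarrow> L' 0 = [] \<Longrightarrow> frame ins_regs ins_mem u s' \<Longrightarrow> R s' t q"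
    for R u
  proof (rule wp_WhileNZ[where m = S and I = "\<lambda>m s' t q. frame ins_regs ins_mem u s' \<and> (\<exists>i L' arr'.
      (regs s' 43 = 0 \<longrightarrow> t + 48 * pot L + 32 * i \<le> 48 * pot L' + 13 \<and> q + 2 * pot L + 2 * i \<le> 2 * pot L' \<and>
        m = 0 \<and> Suc i < S \<and> ins_inv r (Suc N) ?E i L' arr' 0 s' \<and> L' 0 = []) \<and>
      (regs s' 43 \<noteq> 0 \<longrightarrow> t + 48 * pot L + 32 * i \<le> 48 * (pot L' + i * length (L' 0)) \<and>
        q + 2 * pot L + 2 * i \<le> 2 * (pot L' + i * length (L' 0)) \<and>
        m = S - i \<and> ins_inv r (Suc N) ?E i L' arr' (regs s' 41) s' \<and> ins_carry r (Suc N) i L' arr'))"], goal_cases)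
    case 1
    have "pot ?L = pot L" by (simp add: pot_upd_0)
    then show ?case using start[OF u(1,2)] u frame_refl
      by (intro conjI exI[of _ 0] exI[of _ ?L] exI[of _ arr]) auto
  next
    case (2 m v t q)
    then obtain i L' arr' where i: "t + 48 * pot L + 32 * i \<le> 48 * (pot L' + i * length (L' 0))"
        "q + 2 * pot L + 2 * i \<le> 2 * (pot L' + i * length (L' 0))"
        "m = S - i" "ins_inv r (Suc N) ?E i L' arr' (regs v 41) v" "ins_carry r (Suc N) i L' arr'" by blast
    have fr: "frame ins_regs ins_mem u v" using 2 by blast
    have iS: "i < S" using i(4) by (simp add: ins_inv_def)
    have env': "env v" using u(4) fr by (auto simp: env_def frame_def ins_regs_def)
    have "arr' i + 2 ^ i \<le> Suc N" using i(5) by (simp add: ins_carry_def)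
    then have "i < Suc N" using less_exp[of i] by linarith
    then have i': "Suc i < S" using N by simp
    have N': "Suc N + 2 \<le> S" using N by simp
    show ?case
    proof (rule wp_insert_step[OF env' i(4,5) N'], goal_cases)
      case (1 s' t' q' L'' arr'')
      then show ?case using i(1,2,3) i' iS frame_trans[OF fr]
        by - (rule exI[of _ 0], intro conjI, simp, simp, rule exI[of _ i], rule exI[of _ L''], rule exI[of _ arr''], simp)
    next
      case (2 s' t' q' L'' arr'' k)
      then show ?case using i(1,2,3) i' iS frame_trans[OF fr] \<open>regs v 43 \<noteq> 0\<close>
        by - (rule exI[of _ "S - Suc i"], intro conjI, simp, simp, rule exI[of _ "Suc i"], rule exI[of _ L''], rule exI[of _ arr''], simp)
    qed
  next
    case (3 m v t q)
    then obtain i L' arr' where "t + 48 * pot L + 32 * i \<le> 48 * pot L' + 13" "q + 2 * pot L + 2 * i \<le> 2 * pot L'"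
      "Suc i < S" "ins_inv r (Suc N) ?E i L' arr' 0 v" "L' 0 = []" by blast
    then show ?case using 3 by (intro R[of "1 + t" i L' q arr']) auto
  qed
  have fin: "frame heap_regs (insert (?e + 2 * S) heap_mem) s s''" "mem s'' (?e + 2 * S) = 0"
    if f1: "frame ins_regs ins_mem u s'" and f2: "frame {30..38} {8 * S..<9 * S} v s''"
      and v: "mem v = mem s'" "hist v = hist s'" "\<forall>r. r \<noteq> 30 \<longrightarrow> regs v r = regs s' r"
      and u: "mem u = (mem s)(?e + S := 0, ?e + 2 * S := 0)" "hist u = hist s" "\<forall>r. r \<notin> {41..45} \<longrightarrow> regs u r = regs s r"
    for s'' v s' u
  proof -
    have "mem s'' b = mem u b" if "b \<notin> heap_mem" for b
    proof -
      have "b \<notin> ins_mem" "b \<notin> {8 * S..<9 * S}" using that by (auto simp: ins_mem_def heap_mem_def)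
      then show ?thesis using f1 f2 v(1) by (simp add: frame_def)
    qed
    moreover have "?e + S \<in> heap_mem" "?e + 2 * S \<notin> heap_mem" using eb by (auto simp: heap_mem_def)
    moreover have "regs s'' r = regs s r" if "r \<notin> heap_regs" for r
    proof -
      have "r \<notin> ins_regs" "r \<notin> {30..38}" "r \<notin> {41..45}" "r \<noteq> 30" using that by (auto simp: ins_regs_def heap_regs_def)
      then show ?thesis using f1 f2 v(3) u(3) unfolding frame_def by metis
    qed
    moreover have "hist s'' = hist s" using f1 f2 v u by (simp add: frame_def)
    ultimately show "frame heap_regs (insert (?e + 2 * S) heap_mem) s s''" "mem s'' (?e + 2 * S) = 0"
      unfolding frame_def using u(1) by (auto simp: fun_upd_def)
  qed
  show ?thesis
    using env eb space w_pos
    apply (simp add: insert_node_def wp_simps env_def)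
    apply (rule loop)
         apply (simp add: fun_upd_twist)
        apply simp
       apply simp
      apply (simp add: env_def)
     apply simp
    subgoal premises prems for s' t q i L' arr'
    proof -
      have r: "regs s' 42 = 6 * S + i" "regs s' 10 = 6 * S" "regs s' 19 = 1" and env': "env s'"
        using prems by (auto simp: ins_inv_def frame_def ins_regs_def env_def)
      show ?thesis
        using r space prems(8)
        apply simp
        apply (rule wp_fix_heap[of _ i L' "insert (regs s 40) E" arr' r "Suc N"])
                 apply (use env' in \<open>simp add: env_def; fail\<close>)
                apply simp
               apply (rule prems)
              apply (use prems(9) in \<open>simp add: ins_inv_def; fail\<close>)
             apply (use prems(9) in \<open>simp add: ins_inv_def; fail\<close>)
            apply (use prems(9) in \<open>simp add: ins_inv_def node_def; fail\<close>)
           apply (use inj e(2) eE in \<open>simp; fail\<close>)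
          apply (use prems(9) in \<open>simp add: ins_inv_def; fail\<close>)
         apply (use prems(9) in \<open>simp add: ins_inv_def; fail\<close>)
        apply (use prems(9) in \<open>simp add: ins_inv_def; fail\<close>)
        apply (rule Q[of _ L'])
            apply (use prems in \<open>simp; fail\<close>)
           apply (use prems in \<open>simp; fail\<close>)
          apply assumption
         apply (rule fin(2)[OF prems(11)], assumption; simp)
        apply (rule fin(1)[OF prems(11)], assumption; simp)
        done
    qed
    done
qed

section \<open>Deletion of the minimum\<close>

definition pop_node :: com where
  "pop_node = block [
     Move 42 10,
     Bin Add 44 42 3,
     Bin Add 44 44 19,
     Load 45 44,
     Bin Equal 43 45 40,
     WhileNZ 43 (block [
       Bin Add 42 42 19,
       Bin Add 44 44 19,
       Load 45 44,
       Bin Equal 43 45 40]),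
     Bin Add 45 40 2,
     Load 45 45,
     Load 44 42,
     Bin Equal 43 44 40,
     IfNZ 43 (Store 42 45) (block [Bin Add 44 42 2, Store 44 45]),
     Bin Sub 30 42 10,
     Bin Add 30 30 19,
     fix_mins]"

text \<open>The level \<open>i\<close> of the minimum is found by equality tests, and the minimum
  heads one of the two lists there. Its age makes \<open>i\<close> logarithmic in the number of
  insertions after its own. The potential falls by \<open>i\<close>, so the deletion is the place
  where the \<open>i\<close> merges that lifted the node are paid for.\<close>

lemma wp_pop_node:
  assumes env: "env s" and heap: "heap L r N E s" and E: "E \<noteq> {}" and e: "regs s 40 = mem s (8 * S)"
    and N: "N + 2 \<le> S"
    and Q: "\<And>s' t q L' i. t \<le> 40 * i + 60 \<Longrightarrow> q \<le> 2 * i + 2 \<Longrightarrow> heap L' r N (E - {regs s 40}) s' \<Longrightarrow>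
      pot L = pot L' + i \<Longrightarrow> i = 0 \<or> r (regs s 40) + 2 ^ (i - 1) \<le> N \<Longrightarrow>
      frame heap_regs heap_mem s s' \<Longrightarrow> Q s' t q"
  shows "WP pop_node Q s"
proof -
  define e where "e = mem s (8 * S)"
  have l: "lists ((mem s)(0 := 0)) (mem s) L" and E': "nds L = E" "\<forall>e\<in>E. node s e" and inj: "inj_on key E"
    and sm: "\<And>j. j < S \<Longrightarrow> ismin key (mem s (8 * S + j)) (below L j)" using heap by (auto simp: heap_def)
  obtain arr where ag: "aged L arr r" "arr 0 \<le> N" using heap by (auto simp: heap_def)
  note l' = listsD[OF l]
  have L0: "L 0 = []" using l'(1)[of 0] nl_null[of "mem s" 0 "L 0"] by simp
  have b0: "below L 0 = E" using nds_below[OF l] L0 E'(1) by simp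
  have "ismin key e E" using sm[of 0] S_pos b0 by (simp add: e_def)
  then have e0: "e \<noteq> 0" "e \<in> E" "\<And>x. x \<in> E \<Longrightarrow> key e \<le> key x" using E by (auto simp: ismin_def split: if_splits)
  have uniq: "x = e" if "x \<in> E" "key x \<le> key e" for x
    using inj e0(2,3) that by (metis inj_onD le_antisym)
  have eb: "3 * S \<le> e" "e < 4 * S" using E'(2) e0(2) by (auto simp: node_def)
  obtain i where i: "i < S" "e \<in> set (L (6 * S + i)) \<union> set (L (7 * S + i))"
    using e0(2) b0 by (auto simp: below_def)
  have arr: "arr j \<le> N" if "j \<le> S" for j
    using that
  proof (induction j)
    case (Suc j)
    then show ?case using ag(1) unfolding aged_def by (metis Suc_le_eq less_imp_le order_trans)
  qed (use ag in simp)
  have age: "i = 0 \<or> r e + 2 ^ (i - 1) \<le> N"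
    using ag(1) i arr[of i] unfolding aged_def by (metis gr0I less_imp_le order_trans)
  have iS: "Suc i < S"
  proof (cases "i = 0")
    case False
    then have "i - 1 < N" using age less_exp[of "i - 1"] by linarith
    then show ?thesis using N False by linarith
  qed (use S_pos N in auto)
  obtain cl where cl: "cl = 6 * S + i \<or> cl = 7 * S + i" "e \<in> set (L cl)" using i by auto
  have clc: "cl \<in> cells" "cl \<noteq> 0" "4 * S \<le> cl" "cl < 8 * S" using cl(1) i(1) S_pos by (auto simp: cells_simps)
  have nlc: "nl (mem s) (mem s c) (L c)" if "c \<in> cells" for c
    using l'(1)[of c] that cells_simps(3) by (auto split: if_splits)
  obtain y xs where yxs: "L cl = y # xs" using cl(2) by (cases "L cl") auto
  have "key y \<le> key e" using l'(4)[of cl] cl(2) yxs by auto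
  moreover have "y \<in> E" using E'(1) yxs unfolding nds_def by (metis UN_I UNIV_I list.set_intros(1))
  ultimately have "y = e" using uniq by blast
  then have Lcl: "L cl = e # xs" using yxs by simp
  have mcl: "mem s cl = e" "nl (mem s) (mem s (e + S)) xs" using nlc[OF clc(1)] Lcl by auto
  have only: "e \<notin> set (L c)" if "c \<noteq> cl" for c using l'(5)[OF that] cl(2) by blast
  \<comment> \<open>The stored minima coincide with \<open>e\<close> up to its level and differ from
    it on the next one. The scan therefore stops exactly at level \<open>i\<close>.\<close>
  have SM: "mem s (8 * S + Suc j) = e \<longleftrightarrow> j < i" if "j \<le> i" for j
  proof
    assume j: "j < i"
    then have "e \<in> below L (Suc j)" using i unfolding below_def by auto
    then have "mem s (8 * S + Suc j) \<in> below L (Suc j)" "key (mem s (8 * S + Suc j)) \<le> key e"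
      using sm[of "Suc j"] j i(1) by (auto simp: ismin_def split: if_splits)
    then show "mem s (8 * S + Suc j) = e" using uniq below_subset[of L] E'(1) by blast
  next
    assume eq: "mem s (8 * S + Suc j) = e"
    show "j < i"
    proof (rule ccontr)
      assume "\<not> j < i"
      then have ji: "j = i" using that by simp
      have "e \<in> below L (Suc i)" using sm[of "Suc i"] iS eq ji e0(1) by (auto simp: ismin_def)
      then obtain k where k: "Suc i \<le> k" "k < S" "e \<in> set (L (6 * S + k)) \<union> set (L (7 * S + k))"
        by (auto simp: below_def)
      have "6 * S + k \<noteq> cl" "7 * S + k \<noteq> cl" using cl(1) k i(1) by auto
      then show False using k(3) only by blast
    qed
  qed
  have x_iff: "mem s (6 * S + i) = e \<longleftrightarrow> cl = 6 * S + i"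
  proof
    assume m: "mem s (6 * S + i) = e"
    then have "L (6 * S + i) \<noteq> []" using nlc[of "6 * S + i"] i(1) e0(1) by (auto simp: cells_simps)
    then have "e \<in> set (L (6 * S + i))" using nlc[of "6 * S + i"] i(1) m
      by (cases "L (6 * S + i)") (auto simp: cells_simps)
    then show "cl = 6 * S + i" using only[of "6 * S + i"] by metis
  qed (use mcl in auto)
  let ?L = "L(cl := xs)"
  have fin: "WP fix_mins R v"
    if v: "mem v = (mem s)(cl := mem s (e + S))" "regs v 30 = Suc i" "env v" "hist v = hist s"
        "\<forall>r. r \<notin> heap_regs \<longrightarrow> regs v r = regs s r"
      and R: "\<And>s' t q. t \<le> 30 * Suc i + 1 \<Longrightarrow> q \<le> 2 * Suc i \<Longrightarrow> heap ?L r N (E - {e}) s' \<Longrightarrow>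
        frame heap_regs heap_mem s s' \<Longrightarrow> R s' t q" for R v
  proof (rule wp_fix_heap[OF v(3,2) iS, of ?L "E - {e}" arr r N])
    have nlv: "nl (mem v) a ys" if "nl (mem s) a ys" "set ys \<subseteq> E" for a ys
      by (rule nl_frame[OF that(1)]) (use E' that clc cl(1) v(1) in \<open>auto simp: node_def\<close>)
    have sub: "set (L c) \<subseteq> E" for c using E'(1) unfolding nds_def by blast
    show "lists ((mem v)(0 := 0)) (mem v) ?L"
      unfolding lists_def
    proof (intro conjI allI impI, goal_cases)
      case (1 c)
      have "nl (mem v) (mem v c) (?L c)" if "c \<in> cells"
      proof (cases "c = cl")
        case True
        have "set xs \<subseteq> E" using sub[of cl] Lcl by simp
        then show ?thesis using True v(1) nlv[OF mcl(2)] by simp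
      next
        case False
        then show ?thesis using v(1) nlv[OF nlc[OF that] sub] by simp
      qed
      then show ?case using l'(2)[of c] L0 clc by (auto simp: cells_simps)
    next
      case (2 c)
      then show ?case using l'(3)[of c] l'(3)[of cl] Lcl by simp
    next
      case (3 c)
      then show ?case using l'(4)[of c] l'(4)[of cl] Lcl by simp
    next
      case (4 c c')
      then show ?case using l'(5)[of c c'] Lcl by auto
    qed
    have "e \<notin> set xs" using l'(3)[of cl] Lcl by simp
    then have "set (?L c) = set (L c) - {e}" for c using only[of c] Lcl by (cases "c = cl") auto
    then show "nds ?L = E - {e}" using E'(1) unfolding nds_def by blast
    show "\<forall>x\<in>E - {e}. node v x" using E'(2) v(1) clc(3) by (auto simp: node_def)
    show "inj_on key (E - {e})" using inj by (rule inj_on_subset) auto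
    show "\<forall>j<S. i < j \<longrightarrow> ismin key (mem v (8 * S + j)) (below ?L j)"
      using sm below_upd[OF _ cl(1) i(1)] v(1) clc(4) by simp
    have lsub: "set (?L c) \<subseteq> set (L c)" "?L c \<noteq> [] \<Longrightarrow> L c \<noteq> []" for c using Lcl by (auto split: if_splits)
    show "aged ?L arr r" unfolding aged_def
    proof (intro allI impI)
      fix j assume j: "j < S"
      show "arr (Suc j) \<le> arr j \<and>
        (?L (6 * S + j) \<noteq> [] \<and> ?L (7 * S + j) \<noteq> [] \<longrightarrow> arr (Suc j) + 2 ^ j \<le> arr j) \<and>
        (\<forall>e\<in>set (?L (6 * S + j)) \<union> set (?L (7 * S + j)). r e \<le> arr j \<and> (0 < j \<longrightarrow> r e + 2 ^ (j - 1) \<le> arr j))"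
        using ag(1)[unfolded aged_def, rule_format, OF j] lsub[of "6 * S + j"] lsub[of "7 * S + j"] by blast
    qed
    show "arr 0 \<le> N" by (rule ag)
    fix s' t q
    assume a: "t \<le> 30 * Suc i + 1" "q \<le> 2 * Suc i" "heap ?L r N (E - {e}) s'" "frame {30..38} {8 * S..<9 * S} v s'"
    have "mem s' b = mem s b" if "b \<notin> heap_mem" for b
    proof -
      have "b \<notin> {8 * S..<9 * S}" "b \<noteq> cl" using that clc cl(1) by (auto simp: heap_mem_def)
      then show ?thesis using a(4) v(1) by (simp add: frame_def)
    qed
    moreover have "regs s' x = regs s x" if "x \<notin> heap_regs" for x
    proof -
      have "x \<notin> {30..38}" using that by (auto simp: heap_regs_def)
      then show ?thesis using a(4) v(5) that by (simp add: frame_def)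
    qed
    ultimately have "frame heap_regs heap_mem s s'" using a(4) v(4) by (simp add: frame_def)
    then show "R s' t q" by (intro R a)
  qed
  have "level cl = i" using cl(1) i(1) by (auto simp: level_simps)
  then have pot: "pot L = pot ?L + i"
    using pot_upd[OF clc(1), of L xs] Lcl by simp
  have loop: "WP (WhileNZ 43 (block [Bin Add 42 42 19, Bin Add 44 44 19, Load 45 44, Bin Equal 43 45 40])) R u"
    if u: "mem u = mem s" "regs u 42 = 6 * S" "regs u 44 = Suc (8 * S)" "regs u 43 = of_bool (mem s (Suc (8 * S)) = e)"
        "regs u 40 = e" "regs u 19 = 1"
      and R: "\<And>s' t. t \<le> 6 * i + 1 \<Longrightarrow> regs s' 42 = 6 * S + i \<Longrightarrow> frame {42..45} {} u s' \<Longrightarrow> R s' t 0" for R u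
  proof (rule wp_WhileNZ[where m = i and I = "\<lambda>m s' t q. frame {42..45} {} u s' \<and> q = 0 \<and>
      (\<exists>j\<le>i. m = i - j \<and> t \<le> 6 * j \<and> regs s' 42 = 6 * S + j \<and> regs s' 44 = 8 * S + Suc j \<and>
        (regs s' 43 = 0 \<longleftrightarrow> \<not> j < i))"], goal_cases)
    case 1
    then show ?case using u SM[of 0] by (auto intro!: frame_refl exI[of _ 0])
  next
    case (2 m v t q)
    then obtain j where j: "j \<le> i" "m = i - j" "t \<le> 6 * j" "regs v 42 = 6 * S + j" "regs v 44 = 8 * S + Suc j" "j < i"
      by auto
    have v: "mem v = mem s" "regs v 40 = e" "regs v 19 = 1" "q = 0" "frame {42..45} {} u v"
      using 2 u by (auto simp: frame_def)
    have "Suc (Suc (8 * S + j)) < 2 ^ w" "Suc (6 * S + j) < 2 ^ w" using space iS j by auto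
    then show ?case using v j SM[of "Suc j"]
      by (simp add: wp_simps) (intro conjI exI[of _ "i - Suc j"] exI[of _ "Suc j"]; auto simp: frame_def)
  next
    case (3 m v t q)
    then have "frame {42..45} {} u v" "regs v 42 = 6 * S + i" "t \<le> 6 * i" "q = 0" by auto
    then show ?case using R[of "1 + t" v] by simp
  qed
  have Q': "Q s' t q" if "t \<le> 40 * i + 60" "q \<le> 2 * i + 2" "heap ?L r N (E - {e}) s'" "frame heap_regs heap_mem s s'" for s' t q
    using Q[of t i q ?L s'] that pot age e by (simp add: e_def)
  have r40: "regs s 40 = e" using e by (simp add: e_def)
  show ?thesis
    using env space r40 S_pos
    apply (simp add: pop_node_def wp_simps env_def split del: split_of_bool)
    apply (rule loop)
          apply simp
         apply simp
        apply simp
       apply simp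
      apply simp
     apply simp
    subgoal premises prems for s' t
    proof -
      have s': "regs s' 42 = 6 * S + i" "regs s' 10 = 6 * S" "regs s' 19 = 1" "regs s' 2 = S" "regs s' 40 = e" "env s'"
          "mem s' = mem s" "hist s' = hist s" "\<forall>r. r \<notin> {42..45} \<longrightarrow> regs s' r = regs s r"
        using prems by (auto simp: frame_def env_def)
      have sp: "e + S < 2 ^ w" "7 * S + i < 2 ^ w" "Suc i < 2 ^ w" "6 * S + i < 2 ^ w" using space eb i(1) by auto
      show ?thesis
      proof (cases "cl = 6 * S + i")
        case True
        have t: "mem s (6 * S + i) = e" using x_iff True by blast
        show ?thesis
          using s'(1-5,7) sp t
          apply (simp add: wp_simps)
          apply (rule fin)
               apply (simp add: True)
              apply simp
             apply (use s'(6) in \<open>simp add: env_def; fail\<close>)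
            apply (use s'(8) in \<open>simp; fail\<close>)
           apply (use s'(9) in \<open>simp add: heap_regs_def; fail\<close>)
          apply (rule Q'; use prems(5) in simp)
          done
      next
        case False
        then have cl': "cl = 7 * S + i" using cl(1) by blast
        have t: "mem s (6 * S + i) \<noteq> e" using x_iff False by blast
        show ?thesis
          using s'(1-5,7) sp t
          apply (simp add: wp_simps)
          apply (rule fin)
               apply (simp add: cl')
              apply simp
             apply (use s'(6) in \<open>simp add: env_def; fail\<close>)
            apply (use s'(8) in \<open>simp; fail\<close>)
           apply (use s'(9) in \<open>simp add: heap_regs_def; fail\<close>)
          apply (rule Q'; use prems(5) in simp)
          done
      qed
    qed
    done
qed

section \<open>Exponential search\<close>

definition search_step :: com where
  "search_step = block [
     Bin Add 35 29 32,
     Bin Less 36 8 35,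
     IfNZ 36 (Const 37 0) (block [Bin Sub 36 35 19, Load 36 36, Compare 37 36 34]),
     IfNZ 37
       (block [Move 29 35, IfNZ 33 (Bin Add 32 32 32) (Bin Shr 32 32 19)])
       (block [Const 33 0, Bin Shr 32 32 19])]"

definition search :: com where
  "search = block [Move 29 7, Const 32 1, Const 33 1, Load 34 40, WhileNZ 32 search_step]"

text \<open>The probe looks at the entry with index \<open>j + g - 1\<close>, so it succeeds iff at
  least \<open>j + g\<close> bottlenecks precede \<open>b\<close>. A probe beyond the end of the
  array counts as failed and makes no comparison.\<close>

lemma wp_search_step:
  assumes env: "env s" and ce: "regs s 8 = 2 * S + length cs" "length cs < S"
    and cs: "\<And>j. j < length cs \<Longrightarrow> mem s (2 * S + j) = cs ! j" "set cs \<subseteq> set \<pi>" and b: "regs s 34 = b" "b \<in> set \<pi>"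
    and d: "\<And>j. j < length cs \<Longrightarrow> precedes \<pi> (cs ! j) b \<longleftrightarrow> j < d" "d \<le> length cs"
    and j: "regs s 29 = 2 * S + j" "j \<le> d" and g: "regs s 32 = g" "0 < g" "g \<le> S"
    and Q: "\<And>s' t q. t \<le> 15 \<Longrightarrow> q \<le> 1 \<Longrightarrow> frame {29, 32, 33, 35, 36, 37} {} s s' \<Longrightarrow>
       (if j + g \<le> d then regs s' 29 = 2 * S + (j + g) \<and> regs s' 33 = regs s 33 \<and>
          regs s' 32 = (if regs s 33 \<noteq> 0 then g + g else g div 2)
        else regs s' 29 = 2 * S + j \<and> regs s' 33 = 0 \<and> regs s' 32 = g div 2) \<Longrightarrow> Q s' t q"
  shows "WP search_step Q s"
proof -
  have one: "regs s 19 = 1" using env by (simp add: env_def)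
  have sp: "2 * S + j + g < 2 ^ w" "g + g < 2 ^ w" using space j d(2) ce(2) g by auto
  have shr: "drop_bit (Suc 0) g = g div 2" by (simp add: drop_bit_eq_div)
  show ?thesis
  proof (cases "length cs < j + g")
    case True
    then have "\<not> j + g \<le> d" using d(2) by simp
    then show ?thesis using one ce j g sp True shr
      by (simp add: search_step_def wp_simps) (rule Q; simp add: frame_def)
  next
    case False
    define i where "i = j + g - 1"
    have i: "2 * S + j + g - Suc 0 = 2 * S + i" "i < length cs" "j + g = Suc i" using g(2) False by (auto simp: i_def)
    have m: "mem s (2 * S + i) = cs ! i" "cs ! i \<in> set \<pi>" using cs i(2) by auto
    have p: "precedes \<pi> (cs ! i) b \<longleftrightarrow> j + g \<le> d" using d(1)[OF i(2)] i(3) by auto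
    show ?thesis
      using one ce j g sp False shr m b p i(1)
      apply (simp add: search_step_def wp_simps wp_Compare split del: split_of_bool)
      apply (intro conjI impI; rule Q; simp add: frame_def)
      done
  qed
qed

lemma wp_search:
  assumes env: "env s" and ce: "regs s 8 = 2 * S + length cs" "length cs < S"
    and cs: "\<And>j. j < length cs \<Longrightarrow> mem s (2 * S + j) = cs ! j" "set cs \<subseteq> set \<pi>" and b: "mem s (regs s 40) = b" "b \<in> set \<pi>"
    and d: "\<And>j. j < length cs \<Longrightarrow> precedes \<pi> (cs ! j) b \<longleftrightarrow> j < d" "d \<le> length cs"
    and c: "regs s 7 = 2 * S + c" "c \<le> d"
    and Q: "\<And>s' t q. t \<le> 32 * floor_log (d - c + 1) + 24 \<Longrightarrow> q \<le> 2 * floor_log (d - c + 1) + 1 \<Longrightarrow>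
       frame ({29} \<union> {32..37}) {} s s' \<Longrightarrow> regs s' 29 = 2 * S + d \<Longrightarrow> Q s' t q"
  shows "WP search Q s"
proof -
  let ?lg = "floor_log (d - c + 1)"
  \<comment> \<open>The stages of the search. While doubling, \<open>k\<close> successes have led to
    \<open>j = c + 2 ^ k - 1\<close>; while halving, the target lies less than
    \<open>2 * 2 ^ k\<close> beyond \<open>j\<close>; the last disjunct is the end. \<open>m\<close>
    bounds the remaining probes. A failed doubling probe lowers it from
    \<open>2 * ?lg + 1 - k\<close> to \<open>k\<close>, a decrease because
    \<open>k \<le> ?lg\<close>.\<close>
  define J where "J m s' \<longleftrightarrow> (\<exists>j\<le>d. regs s' 29 = 2 * S + j \<and>
        ((\<exists>k. regs s' 33 \<noteq> 0 \<and> regs s' 32 = 2 ^ k \<and> Suc j = c + 2 ^ k \<and> m + k = 2 * ?lg + 1) \<or>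
         (\<exists>k. regs s' 33 = 0 \<and> regs s' 32 = 2 ^ k \<and> d < j + 2 * 2 ^ k \<and> m = Suc k) \<or>
         regs s' 33 = 0 \<and> regs s' 32 = 0 \<and> j = d \<and> m = 0))" for m and s' :: state
  have loop: "WP (WhileNZ 32 search_step) R u"
    if u: "regs u 29 = 2 * S + c" "regs u 32 = 1" "regs u 33 = 1" "regs u 34 = b" "frame ({29} \<union> {32..37}) {} s u"
      and R: "\<And>s' t q. t \<le> 16 * (2 * ?lg + 1) + 1 \<Longrightarrow> q \<le> 2 * ?lg + 1 \<Longrightarrow>
        frame ({29} \<union> {32..37}) {} s s' \<Longrightarrow> regs s' 29 = 2 * S + d \<Longrightarrow> R s' t q" for R u
  proof (rule wp_WhileNZ[where m = "2 * ?lg + 1" and I = "\<lambda>m s' t q. frame ({29} \<union> {32..37}) {} s s' \<and>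
      regs s' 34 = b \<and> t + 16 * m \<le> 16 * (2 * ?lg + 1) \<and> q + m \<le> 2 * ?lg + 1 \<and> regs s' 32 \<le> S \<and>
      J m s'"], goal_cases)
    case 1
    then show ?case using u S_pos c(2) by (auto simp: J_def intro!: exI[of _ c] disjI1 exI[of _ 0])
  next
    case (2 m v t q)
    then obtain j where j: "j \<le> d" "regs v 29 = 2 * S + j" and cs2:
        "(\<exists>k. regs v 33 \<noteq> 0 \<and> regs v 32 = 2 ^ k \<and> Suc j = c + 2 ^ k \<and> m + k = 2 * ?lg + 1) \<or>
         (\<exists>k. regs v 33 = 0 \<and> regs v 32 = 2 ^ k \<and> d < j + 2 * 2 ^ k \<and> m = Suc k)" unfolding J_def by auto
    have v: "frame ({29} \<union> {32..37}) {} s v" "regs v 34 = b" "t + 16 * m \<le> 16 * (2 * ?lg + 1)" "q + m \<le> 2 * ?lg + 1" "regs v 32 \<le> S"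
      using 2(1) by blast+
    have mem: "mem v = mem s" using v(1) by (auto simp: frame_def)
    have "env v" "regs v 8 = 2 * S + length cs" using v(1) env ce by (auto simp: frame_def env_def)
    note step = wp_search_step[OF this ce(2) cs(1)[folded mem] cs(2) v(2) b(2) d j(2,1) refl _ v(5)]
    have lgle: "k \<le> ?lg" if "2 ^ k \<le> d - c + 1" for k
      using floor_log_mono[THEN monoD, OF that] by simp
    have half: "(2::nat) ^ k div 2 = (if k = 0 then 0 else 2 ^ (k - 1))" for k by (cases k) auto
    from cs2 show ?case
    proof (elim disjE exE conjE, goal_cases)
      case (1 k)
      have k: "k \<le> ?lg" using 1(3) j(1) by (intro lgle) auto
      show ?case
      proof (rule step, goal_cases)
        case a: (4 s' t' q')
        have fr: "frame ({29} \<union> {32..37}) {} s s'" "regs s' 34 = b" using v(1,2) a(3) by (auto simp: frame_def)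
        show ?case
        proof (cases "j + 2 ^ k \<le> d")
          case True
          then have "2 ^ Suc k \<le> d - c + 1" using 1(3) by simp
          then have k': "Suc k \<le> ?lg" by (rule lgle)
          have "2 * 2 ^ k \<le> S" using True 1(3) d(2) ce(2) by simp
          have "J (m - 1) s'" unfolding J_def
            by (rule exI[of _ "j + 2 ^ k"]) (use True a 1 k' in \<open>auto intro!: disjI1 exI[of _ "Suc k"]\<close>)
          then show ?thesis using True a 1 v fr k' \<open>2 * 2 ^ k \<le> S\<close>
            by (intro exI[of _ "m - 1"]) auto
        next
          case False
          then have "J k s'" unfolding J_def
            by (intro exI[of _ j]) (use a 1 j in \<open>auto simp: half gr0_conv_Suc\<close>)
          then show ?thesis using False a 1 v fr k
            by (intro exI[of _ k]) auto
        qed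
      qed (use 1 in simp_all)
    next
      case (2 k)
      show ?case
      proof (rule step, goal_cases)
        case a: (4 s' t' q')
        have fr: "frame ({29} \<union> {32..37}) {} s s'" "regs s' 34 = b" using v(1,2) a(3) by (auto simp: frame_def)
        show ?case
        proof (cases "j + 2 ^ k \<le> d")
          case True
          then have "J k s'" unfolding J_def
            by (intro exI[of _ "j + 2 ^ k"]) (use a 2 in \<open>auto simp: half gr0_conv_Suc\<close>)
          then show ?thesis using True a 2 v fr
            by (intro exI[of _ k]) auto
        next
          case False
          then have "J k s'" unfolding J_def
            by (intro exI[of _ j]) (use a 2 j in \<open>auto simp: half gr0_conv_Suc\<close>)
          then show ?thesis using False a 2 v fr
            by (intro exI[of _ k]) auto
        qed
      qed (use 2 in simp_all)
    qed
  next
    case (3 m v t q)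
    then have "frame ({29} \<union> {32..37}) {} s v" "regs v 29 = 2 * S + d" "t \<le> 16 * (2 * ?lg + 1)" "q \<le> 2 * ?lg + 1"
      unfolding J_def by auto
    then show ?case by (intro R) auto
  qed
  show ?thesis
    using c(1) b w_pos
    apply (simp add: search_def wp_simps)
    apply (rule loop)
        apply (simp_all add: frame_def)
    apply (rule Q; simp add: frame_def)
    done
qed

end

section \<open>Sorting, given the bottlenecks\<close>

text \<open>The log of the complete run is determined by \<open>C\<close> and \<open>\<pi>\<close>
  beforehand, so the letter of a node can be fixed before it is reported. The 2 in
  \<open>S = card \<Sigma> + 2\<close> is what insertion asks for: with at most \<open>n - 1\<close>
  earlier insertions, \<open>N + 3 \<le> S\<close>.\<close>

locale sorting = heap_ram w A C \<pi> S lt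
  for w :: nat and A :: "nat list set" and C :: "nat candidate_ds" and \<pi> :: "nat list" and S :: nat and lt :: "nat \<Rightarrow> nat" +
  fixes \<Sigma> :: "nat set" and p :: "nat \<Rightarrow> nat set \<Rightarrow> bool" and cs :: "nat list"
  assumes fin: "finite \<Sigma>" and mps: "mps \<Sigma> p" and A_def: "A = mps_language \<Sigma> p" and ds: "is_candidate_ds \<Sigma> p C"
    and perm: "\<pi> \<in> antimatroid_perms \<Sigma> (mps_language \<Sigma> p)" and bot: "bottlenecks \<Sigma> p \<Sigma> cs"
    and S_def: "S = card \<Sigma> + 2" and lt_def: "lt = (\<lambda>e. rlog C \<pi> ! (e - 3 * S))"
begin

abbreviation "R \<equiv> rlog C \<pi>"
abbreviation "n \<equiv> card \<Sigma>"

lemma n_S: "n + 2 \<le> S"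
  by (simp add: S_def)

lemma perm_facts: "distinct \<pi>" "set \<pi> = \<Sigma>" "length \<pi> = n" "\<pi> \<in> A"
  using antimatroid_permsD[OF perm] A_def by (auto simp: distinct_card[symmetric])

lemma take_in_A: "take k \<pi> \<in> A"
  using perm_facts(4) take_in_mps_language A_def by blast

lemma R_facts: "distinct R" "set R = \<Sigma>" "length R = n"
proof -
  have "distinct R \<and> set R = set \<pi> \<union> {y \<in> \<Sigma> - set \<pi>. p y (set \<pi>)}"
    using rlog_props[OF mps ds] perm_facts(4) A_def by blast
  then show "distinct R" "set R = \<Sigma>" using perm_facts(2) by auto
  then show "length R = n" by (metis distinct_card)
qed

section \<open>Counting reports, bottlenecks and insertions along the run\<close>

abbreviation "rl k \<equiv> length (rlog C (take k \<pi>))"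

lemma rlog_take_eq: "rlog C (take k \<pi>) = take (rl k) R"
  using rlog_take[of C \<pi> k] by auto

lemma rl_le: "rl k \<le> n"
  using rlog_take_eq[of k] R_facts(3) by (metis length_take min.cobounded1)

lemma nth_in_rlog_iff: "j < n \<Longrightarrow> R ! j \<in> set (rlog C (take k \<pi>)) \<longleftrightarrow> j < rl k"
proof -
  assume "j < n"
  then have "R ! j \<in> set (take (rl k) R) \<longleftrightarrow> j < rl k"
    using R_facts in_set_take_iff_idx[OF R_facts(1), of "R ! j" "rl k"] nth_mem[of j R]
    by (simp add: idx_nth)
  then show ?thesis by (subst rlog_take_eq)
qed

lemma rlog_take_set: "set (rlog C (take k \<pi>)) = set (take k \<pi>) \<union> {y \<in> \<Sigma> - set (take k \<pi>). p y (set (take k \<pi>))}"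
  using rlog_props[OF mps ds] take_in_A[of k] A_def by blast

lemma rlog_Suc: "k < n \<Longrightarrow> rlog C (take (Suc k) \<pi>) = rlog C (take k \<pi>) @ reports C (take (Suc k) \<pi>)"
  using perm_facts(3) by (simp add: take_Suc_conv_app_nth rlog_snoc)

definition cc :: "nat \<Rightarrow> nat" where
  "cc k = card (set cs \<inter> set (take k \<pi>))"

lemma cc_mono: "i \<le> j \<Longrightarrow> cc i \<le> cc j"
  unfolding cc_def by (rule card_take_mono)

lemma cs_facts: "distinct cs" "set cs \<subseteq> \<Sigma>"
  using bot by (auto simp: bottlenecks_def)

lemma length_cs: "length cs \<le> n"
  using cs_facts fin by (metis card_mono distinct_card)

lemma cc_le: "cc k \<le> length cs"
  unfolding cc_def using cs_facts(1) by (metis List.finite_set card_mono distinct_card inf_le1)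

lemma cc_prefix: "set cs \<inter> set (take k \<pi>) = set (take (cc k) cs)"
  unfolding cc_def using bottlenecks_prefix[OF mps bot] take_in_A[of k] A_def by blast

lemma cs_nth_in_take_iff: "j < length cs \<Longrightarrow> cs ! j \<in> set (take k \<pi>) \<longleftrightarrow> j < cc k"
  using cc_prefix[of k] in_set_take_iff_idx[OF cs_facts(1), of "cs ! j" "cc k"] idx_nth[OF cs_facts(1), of j]
  by (metis Int_iff nth_mem)

lemma next_chain:
  assumes "x \<in> set cs" "x \<notin> set (take k \<pi>)" "x \<in> set (rlog C (take k \<pi>))"
  shows "cc k < length cs" "x = cs ! cc k"
proof -
  have "take k \<pi> @ [x] \<in> mps_language \<Sigma> p"
    using assms take_in_A[of k] rlog_take_set[of k] by (simp add: snoc_in_mps_language_iff A_def)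
  from next_bottleneck[OF mps bot this assms(1)] show "cc k < length cs" "x = cs ! cc k"
    by (auto simp: cc_def)
qed

lemma cc_Suc: "k < n \<Longrightarrow> cc (Suc k) = (if \<pi> ! k \<in> set cs then Suc (cc k) else cc k)"
proof -
  assume k: "k < n"
  then have s: "set (take (Suc k) \<pi>) = insert (\<pi> ! k) (set (take k \<pi>))"
    using perm_facts(3) by (simp add: take_Suc_conv_app_nth)
  have "\<pi> ! k \<notin> set (take k \<pi>)" using k perm_facts by (simp add: in_set_take_iff_idx idx_nth)
  then show ?thesis unfolding cc_def s by (auto simp: Int_insert_right)
qed

text \<open>Bottlenecks never enter the heap, so this is the number of insertions caused by the
  first \<open>m\<close> entries of the log. It serves as the clock of the heap.\<close>

definition nb :: "nat \<Rightarrow> nat" where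
  "nb m = length (filter (\<lambda>y. y \<notin> set cs) (take m R))"

definition rk :: "nat \<Rightarrow> nat" where
  "rk e = nb (Suc (e - 3 * S))"

definition nodes :: "nat \<Rightarrow> nat \<Rightarrow> nat set" where
  "nodes m k = {e. 3 * S \<le> e \<and> e < 3 * S + m \<and> lt e \<notin> set cs \<and> lt e \<notin> set (take k \<pi>)}"

text \<open>The address of the first bottleneck after \<open>b\<close>, or the end of the array. It
  is never 0, so 0 can mark a search that has not been made.\<close>

definition tg :: "nat \<Rightarrow> nat" where
  "tg b = 2 * S + cc (idx \<pi> b)"

text \<open>
  In the middle of an iteration, \<open>k\<close> letters have been removed from the heap and the list of
  bottlenecks, but only \<open>h\<close> letters have been output. The first \<open>m\<close> letters of the log have been
  processed, and \<open>G\<close> contains the letters whose search has been paid for.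
\<close>

definition run :: "nat \<Rightarrow> nat \<Rightarrow> nat \<Rightarrow> nat set \<Rightarrow> (nat \<Rightarrow> nat list) \<Rightarrow> state \<Rightarrow> bool" where
  "run k h m G L s \<longleftrightarrow> k \<le> n \<and> h \<le> n \<and> env s \<and> regs s 0 = n \<and> regs s 8 = 2 * S + length cs \<and> regs s 7 = 2 * S + cc k \<and>
     regs s 9 = 3 * S + m \<and> regs s 11 = h \<and> hist s = Some (take h \<pi>) \<and>
     (\<forall>j<length cs. mem s (2 * S + j) = cs ! j) \<and> (\<forall>j<rl h. mem s (3 * S + j) = R ! j) \<and>
     (\<forall>j<h. mem s j = \<pi> ! j) \<and> (\<forall>b\<in>G. b \<in> \<Sigma> - set cs \<and> idx R b < m) \<and> heap L rk (nb m) (nodes m k) s \<and>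
     (\<forall>e\<in>nodes m k. (mem s (e + 2 * S) = 0 \<and> lt e \<notin> G) \<or> mem s (e + 2 * S) = tg (lt e))"

lemma nb_Suc: "m < n \<Longrightarrow> nb (Suc m) = (if R ! m \<in> set cs then nb m else Suc (nb m))"
  using R_facts(3) by (simp add: nb_def take_Suc_conv_app_nth)

lemma nb_le: "nb m \<le> n"
  unfolding nb_def by (metis length_filter_le R_facts(3) length_take min.cobounded1 order_trans)

lemma nb_less: "m < n \<Longrightarrow> nb m < n"
proof -
  assume "m < n"
  then have "length (take m R) < n" using R_facts(3) by simp
  then show ?thesis unfolding nb_def by (metis length_filter_le order_le_less_trans)
qed

section \<open>Passing the reported letters to the heap\<close>

definition handle_step :: com where
  "handle_step = block [
     Load 48 9,
     Load 49 7,
     Bin Equal 49 48 49,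
     Bin Less 50 7 8,
     Bin And 49 49 50,
     IfNZ 49 Skip (block [Move 40 9, insert_node]),
     Bin Add 9 9 19,
     Bin Less 47 9 46]"

definition handle :: com where
  "handle = block [
     Bin Add 46 9 51,
     Bin Less 47 9 46,
     WhileNZ 47 handle_step]"

lemma lt_node: "lt (3 * S + j) = R ! j"
  by (simp add: lt_def)

lemma key_inj:
  assumes "i < n" "j < n" "key (3 * S + i) = key (3 * S + j)"
  shows "i = j"
proof -
  have "R ! i \<in> set \<pi>" "R ! j \<in> set \<pi>" using assms R_facts perm_facts(2) by (metis nth_mem)+
  then have "R ! i = R ! j" using assms(3) by (simp add: key_def lt_node idx_inj)
  then show ?thesis using assms R_facts by (simp add: nth_eq_iff_index_eq)
qed

lemma nodesE: "e \<in> nodes m k \<Longrightarrow> (\<And>j. e = 3 * S + j \<Longrightarrow> j < m \<Longrightarrow> R ! j \<notin> set cs \<Longrightarrow> R ! j \<notin> set (take k \<pi>) \<Longrightarrow> P) \<Longrightarrow> P"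
  unfolding nodes_def by clarsimp (metis add_diff_inverse_nat lt_node nat_add_left_cancel_less not_less)

lemma nodes_Suc:
  "nodes (Suc m) k = (if R ! m \<in> set cs \<or> R ! m \<in> set (take k \<pi>) then nodes m k else insert (3 * S + m) (nodes m k))"
  unfolding nodes_def using lt_node[of m] by (auto simp: less_Suc_eq)

lemma and_of_bool: "Bit_Operations.and (of_bool P) (of_bool Q) = (of_bool (P \<and> Q) :: nat)"
  by (cases P; cases Q) simp_all

lemma wp_handle_step:
  assumes run: "run k k m G L s" and m: "m < rl k" and k: "R ! m \<notin> set (take k \<pi>)" and r46: "regs s 46 = 3 * S + rl k"
    and Q: "\<And>s' t q L'. t + 48 * pot L \<le> 48 * pot L' + 100 + 100 * (nb (Suc m) - nb m) \<Longrightarrow>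
      q + 2 * pot L \<le> 2 * pot L' + 2 * (nb (Suc m) - nb m) \<Longrightarrow>
      run k k (Suc m) G L' s' \<Longrightarrow> regs s' 46 = 3 * S + rl k \<Longrightarrow> regs s' 47 = of_bool (Suc m < rl k) \<Longrightarrow> Q s' t q"
  shows "WP handle_step Q s"
proof -
  have mn: "m < n" using m rl_le[of k] by simp
  have G: "R ! m \<notin> G" using run mn R_facts by (auto simp: run_def idx_nth)
  have rs: "env s" "regs s 9 = 3 * S + m" "regs s 7 = 2 * S + cc k" "regs s 8 = 2 * S + length cs" "regs s 19 = 1"
    "mem s (3 * S + m) = R ! m" and chain: "\<forall>j<length cs. mem s (2 * S + j) = cs ! j"
    using run m by (auto simp: run_def env_def)
  have sp: "3 * S + m < 2 ^ w" "Suc (3 * S + m) < 2 ^ w" using space mn n_S by auto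
  \<comment> \<open>A newly reported letter that is a bottleneck must be the next one. The bound
    test guards against the cell behind the last bottleneck, which holds an arbitrary word.\<close>
  have chk: "R ! m = mem s (2 * S + cc k) \<and> cc k < length cs \<longleftrightarrow> R ! m \<in> set cs"
  proof
    assume "R ! m = mem s (2 * S + cc k) \<and> cc k < length cs"
    then show "R ! m \<in> set cs" using chain by auto
  next
    assume "R ! m \<in> set cs"
    then have "cc k < length cs" "R ! m = cs ! cc k" using next_chain[OF _ k] nth_in_rlog_iff[OF mn] m by auto
    then show "R ! m = mem s (2 * S + cc k) \<and> cc k < length cs" using chain by auto
  qed
  show ?thesis
  proof (cases "R ! m \<in> set cs")
    case True
    have fin: "run k k (Suc m) G L u"
      if "mem u = mem s" "hist u = hist s" "regs u 9 = 3 * S + Suc m" "\<forall>r. r \<notin> {9} \<union> {46..50} \<longrightarrow> regs u r = regs s r" for u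
      using run that True mn by (auto simp: run_def nodes_Suc nb_Suc env_def heap_def node_def)
    show ?thesis
      using rs sp chk True r46 mn
      apply (simp add: handle_step_def wp_simps env_def and_of_bool split del: split_of_bool)
      apply (rule Q[of _ L])
          apply (simp add: nb_Suc)
         apply (simp add: nb_Suc)
        apply (rule fin; simp)
       apply simp
      apply simp
      done
  next
    case False
    let ?e = "3 * S + m"
    have N: "nb m + 3 \<le> S" using nb_less[OF mn] n_S by simp
    have "R ! m \<in> set \<pi>" using mn R_facts perm_facts(2) by (metis nth_mem)
    then have nd: "node u ?e" if "mem u = mem s" for u
      using that rs(6) mn n_S by (auto simp: node_def lt_node)
    have ke: "key ?e \<notin> key ` nodes m k"
    proof
      assume "key ?e \<in> key ` nodes m k"
      then obtain e where "e \<in> nodes m k" "key ?e = key e" by blast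
      moreover from this(1) obtain j where "e = 3 * S + j" "j < m" by (rule nodesE)
      ultimately show False using key_inj[of m j] mn by simp
    qed
    have rke: "rk ?e = Suc (nb m)" using False mn by (simp add: rk_def nb_Suc)
    have fin: "run k k (Suc m) G L' u"
      if h: "heap L' rk (Suc (nb m)) (insert ?e (nodes m k)) s'" "mem s' (?e + 2 * S) = 0"
        and f: "frame heap_regs (insert (?e + 2 * S) heap_mem) v s'"
        and v: "mem v = mem s" "hist v = hist s" "\<forall>r. r \<notin> {40} \<union> {46..50} \<longrightarrow> regs v r = regs s r"
        and u: "mem u = mem s'" "hist u = hist s'" "regs u 9 = 3 * S + Suc m" "\<forall>r. r \<notin> {9} \<union> {46..50} \<longrightarrow> regs u r = regs s' r"
      for u v s' L'
    proof -
      have ru: "regs u r = regs s r" if "r \<in> {0, 2, 3, 7, 8, 10, 11, 12, 19}" for r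
        using that f v(3) u(4) by (auto simp: frame_def heap_regs_def)
      have mu: "mem u a = mem s a" if "a \<notin> heap_mem" "a \<noteq> ?e + 2 * S" for a
        using that f v(1) u(1) by (auto simp: frame_def)
      have lo: "a < 4 * S \<Longrightarrow> a \<notin> heap_mem \<and> a \<noteq> ?e + 2 * S" for a by (auto simp: heap_mem_def)
      have "mem u (e + 2 * S) = mem s (e + 2 * S)" if "e \<in> nodes m k" for e
        using that mn n_S by (intro mu) (auto simp: nodes_def heap_mem_def)
      moreover have "heap L' rk (nb (Suc m)) (nodes (Suc m) k) u"
        using h(1) u(1) False k mn by (simp add: heap_def nodes_Suc nb_Suc node_def)
      moreover have "mem u (?e + 2 * S) = 0" using h(2) u(1) by simp
      moreover have "hist u = hist s" using f v u by (simp add: frame_def)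
      ultimately show ?thesis
        using run False k G u(3) ru mu[OF conjunct1[OF lo] conjunct2[OF lo]] n_S mn length_cs rl_le[of k]
        by (auto simp: run_def nodes_Suc nb_Suc env_def lt_node)
    qed
    show ?thesis
      using rs sp chk False r46 mn
      apply (simp add: handle_step_def wp_simps env_def and_of_bool split del: split_of_bool)
      apply (rule conjI, blast)
      apply (rule wp_insert_node[where L = L and r = rk and N = "nb m" and E = "nodes m k"])
           apply (simp add: env_def)
          apply (use run in \<open>simp add: run_def heap_def node_def; fail\<close>)
         apply (simp add: nd)
        apply (use ke in \<open>simp; fail\<close>)
       apply (use rke in \<open>simp; fail\<close>)
      apply (rule N)
      subgoal premises prems for s' t q L'
      proof -
        have "regs s' 9 = ?e" "regs s' 19 = 1" "regs s' 46 = 3 * S + rl k"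
          using prems by (auto simp: frame_def heap_regs_def)
        then show ?thesis
          using sp
          apply (simp split del: split_of_bool)
          apply (rule Q[of _ L'])
              apply (use prems False mn in \<open>simp add: nb_Suc; fail\<close>)
             apply (use prems False mn in \<open>simp add: nb_Suc; fail\<close>)
            apply (rule fin[of L' s'])
                    apply (use prems in \<open>simp; fail\<close>)
                   apply (use prems in \<open>simp; fail\<close>)
                  apply (use prems(16) in \<open>simp; fail\<close>)
                 apply simp
                apply simp
               apply simp
              apply simp
             apply simp
            apply simp
           apply simp
          apply simp
         apply simp
          done
      qed
      done
  qed
qed

lemma nb_mono: "i \<le> j \<Longrightarrow> nb i \<le> nb j"
  unfolding nb_def by (metis filter_append le_add1 length_append min.absorb1 take_add take_take le_Suc_ex)

lemma wp_handle:
  assumes run: "run k k m G L s" and m: "m \<le> rl k" and new: "\<And>j. m \<le> j \<Longrightarrow> j < rl k \<Longrightarrow> R ! j \<notin> set (take k \<pi>)"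
    and cnt: "regs s 51 = rl k - m"
    and Q: "\<And>s' t q L'. t + 48 * pot L \<le> 48 * pot L' + 10 + 101 * (rl k - m) + 100 * (nb (rl k) - nb m) \<Longrightarrow>
      q + 2 * pot L \<le> 2 * pot L' + 2 * (nb (rl k) - nb m) \<Longrightarrow> run k k (rl k) G L' s' \<Longrightarrow> Q s' t q"
  shows "WP handle Q s"
proof -
  have loop: "WP (WhileNZ 47 handle_step) W u"
    if u: "run k k m G L u" "regs u 46 = 3 * S + rl k" "regs u 47 = of_bool (m < rl k)"
      and W: "\<And>s' t q L'. t + 48 * pot L \<le> 48 * pot L' + 1 + 101 * (rl k - m) + 100 * (nb (rl k) - nb m) \<Longrightarrow>
        q + 2 * pot L \<le> 2 * pot L' + 2 * (nb (rl k) - nb m) \<Longrightarrow> run k k (rl k) G L' s' \<Longrightarrow> W s' t q" for W u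
  proof (rule wp_WhileNZ[where m = "rl k - m" and I = "\<lambda>v s' t q. \<exists>i L'. m \<le> i \<and> i \<le> rl k \<and> v = rl k - i \<and>
      run k k i G L' s' \<and> regs s' 46 = 3 * S + rl k \<and> regs s' 47 = of_bool (i < rl k) \<and>
      t + 48 * pot L \<le> 48 * pot L' + 101 * (i - m) + 100 * (nb i - nb m) \<and>
      q + 2 * pot L \<le> 2 * pot L' + 2 * (nb i - nb m)"], goal_cases)
    case 1
    show ?case by (rule exI[of _ m], rule exI[of _ L]) (use u m in simp)
  next
    case (2 v u' t q)
    then obtain i L' where i: "m \<le> i" "i \<le> rl k" "v = rl k - i" "run k k i G L' u'" "regs u' 46 = 3 * S + rl k"
      "regs u' 47 = of_bool (i < rl k)" "t + 48 * pot L \<le> 48 * pot L' + 101 * (i - m) + 100 * (nb i - nb m)"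
      "q + 2 * pot L \<le> 2 * pot L' + 2 * (nb i - nb m)" by blast
    have lt: "i < rl k" using i(6) 2(2) by (simp split: if_splits)
    have nbm: "nb m \<le> nb i" "nb i \<le> nb (Suc i)" using i(1) by (simp_all add: nb_mono)
    have eqs: "nb (Suc i) - nb m = (nb (Suc i) - nb i) + (nb i - nb m)" "Suc i - m = Suc (i - m)"
      using nbm i(1) by simp_all
    show ?case
    proof (rule wp_handle_step[OF i(4) lt new[OF i(1) lt] i(5)], goal_cases)
      case (1 s' t' q' L'')
      then show ?case using lt i(1,3,7,8)
        by - (rule exI[of _ "rl k - Suc i"], rule conjI, simp, rule exI[of _ "Suc i"], rule exI[of _ L''], simp add: eqs)
    qed
  next
    case (3 v u' t q)
    then obtain i L' where i: "m \<le> i" "i \<le> rl k" "run k k i G L' u'"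
      "regs u' 47 = of_bool (i < rl k)" "t + 48 * pot L \<le> 48 * pot L' + 101 * (i - m) + 100 * (nb i - nb m)"
      "q + 2 * pot L \<le> 2 * pot L' + 2 * (nb i - nb m)" by blast
    then have "i = rl k" using 3 by simp
    then show ?case using i by (intro W[of _ L']) auto
  qed
  have "3 * S + rl k < 2 ^ w" using rl_le[of k] space n_S by simp
  then show ?thesis
    using cnt m run
    apply (simp add: handle_def wp_simps run_def split del: split_of_bool)
    apply (rule loop)
       apply (simp add: run_def env_def heap_def node_def)
      apply simp
     apply simp
    apply (rule Q)
      prefer 3
      apply assumption
     apply simp
    apply simp
    done
qed

end

context heap_ram
begin

lemma heap_frame:
  assumes h: "heap L r N E s" and m: "\<And>a. a \<in> E \<or> 4 * S \<le> a \<and> a < 5 * S \<or> 6 * S \<le> a \<and> a < 9 * S \<Longrightarrow> mem s' a = mem s a"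
  shows "heap L r N E s'"
proof -
  have l: "lists ((mem s)(0 := 0)) (mem s) L" and E: "nds L = E" "\<forall>e\<in>E. node s e"
    using h by (auto simp: heap_def)
  note l' = listsD[OF l]
  have "lists ((mem s')(0 := 0)) (mem s') L"
    unfolding lists_def
  proof (intro conjI allI impI, goal_cases)
    case (1 c)
    have "nl (mem s') (((mem s')(0 := 0)) c) (L c)" if "c \<in> insert 0 cells"
    proof (rule nl_frame)
      have "((mem s')(0 := 0)) c = ((mem s)(0 := 0)) c" using that m[of c] by (auto simp: cells_def)
      then show "nl (mem s) (((mem s')(0 := 0)) c) (L c)" using l'(1)[OF that] by simp
      show "\<forall>e\<in>set (L c). 3 * S \<le> e \<and> e < 4 * S" using E by (auto simp: nds_def node_def)
    qed (use m in simp)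
    then show ?case using l'(2)[of c] by simp
  qed (use l'(3,4,5) in auto)
  moreover have "\<forall>e\<in>E. node s' e" using E(2) m by (auto simp: node_def)
  moreover have "\<forall>j<S. ismin key (mem s' (8 * S + j)) (below L j)" using h m by (simp add: heap_def)
  ultimately show ?thesis using h unfolding heap_def by blast
qed

end

context sorting
begin

text \<open>
  \<open>avl b\<close> is the time at which \<open>b\<close> becomes available. Between then and its output, \<open>dst b\<close>
  bottlenecks are output; between its insertion into the heap and its output, \<open>insb b\<close> letters are
  inserted.
\<close>

definition avl :: "nat \<Rightarrow> nat" where "avl b = (LEAST j. p b (set (take j \<pi>)))"
definition dst :: "nat \<Rightarrow> nat" where "dst b = cc (idx \<pi> b) - cc (avl b)"
definition insb :: "nat \<Rightarrow> nat" where "insb b = nb (rl (idx \<pi> b)) - nb (idx R b)"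
text \<open>Deletion from level \<open>i\<close> makes at most \<open>2 * i + 2\<close> comparisons
  and releases potential \<open>i\<close> with weight 2, in total \<open>4 * i + 2\<close>. The
  formula follows from \<open>i \<le> floor_log (insb b) + 1\<close>.\<close>

definition pop_cost :: "nat \<Rightarrow> nat" where "pop_cost b = 4 * floor_log (insb b) + 6"
definition search_cost :: "nat \<Rightarrow> nat" where "search_cost b = 2 * floor_log (dst b + 1) + 1"

lemma node_letter:
  assumes e: "e \<in> nodes (rl k) k" and k: "k \<le> n"
  shows "lt e \<in> \<Sigma> - set cs" "lt e \<notin> set (take k \<pi>)" "k \<le> idx \<pi> (lt e)" "avl (lt e) \<le> k"
    "e = 3 * S + idx R (lt e)" "idx R (lt e) < rl k"
proof -
  obtain j where j: "e = 3 * S + j" "j < rl k" "R ! j \<notin> set cs" "R ! j \<notin> set (take k \<pi>)" using e by (rule nodesE)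
  have jn: "j < n" using j(2) rl_le[of k] by simp
  have lt: "lt e = R ! j" using j(1) by (simp add: lt_node)
  have in\<Sigma>: "R ! j \<in> \<Sigma>" using jn R_facts by (metis nth_mem)
  show "lt e \<in> \<Sigma> - set cs" "lt e \<notin> set (take k \<pi>)" using lt j in\<Sigma> by auto
  show "k \<le> idx \<pi> (lt e)" using j(4) in\<Sigma> lt perm_facts in_set_take_iff_idx[OF perm_facts(1), of "R ! j" k] by auto
  have "R ! j \<in> set (rlog C (take k \<pi>))" using nth_in_rlog_iff[OF jn] j(2) by blast
  then have "p (R ! j) (set (take k \<pi>))" using rlog_take_set[of k] j(4) by blast
  then show "avl (lt e) \<le> k" unfolding avl_def lt by (rule Least_le)
  show "e = 3 * S + idx R (lt e)" "idx R (lt e) < rl k" using j jn lt R_facts by (simp_all add: idx_nth)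
qed

lemma next_letter:
  assumes k: "k < n"
  shows "\<pi> ! k \<notin> set (take k \<pi>)" "\<pi> ! k \<in> set (rlog C (take k \<pi>))" "\<pi> ! k \<in> \<Sigma>" "idx \<pi> (\<pi> ! k) = k"
proof -
  show 1: "idx \<pi> (\<pi> ! k) = k" using k perm_facts by (simp add: idx_nth)
  show 2: "\<pi> ! k \<notin> set (take k \<pi>)" using k perm_facts 1 by (simp add: in_set_take_iff_idx)
  show 3: "\<pi> ! k \<in> \<Sigma>" using k perm_facts by (metis nth_mem)
  have "p (\<pi> ! k) (set (take k \<pi>))" using antimatroid_permsD(4)[OF perm 3] 1 by simp
  then show "\<pi> ! k \<in> set (rlog C (take k \<pi>))" using rlog_take_set[of k] 2 3 by blast
qed

lemma next_chain_letter:
  assumes "k < n" "\<pi> ! k \<in> set cs"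
  shows "cc k < length cs" "\<pi> ! k = cs ! cc k"
  using next_chain[OF assms(2)] next_letter[OF assms(1)] by auto

lemma next_nonchain_node:
  assumes k: "k < n" and x: "\<pi> ! k \<notin> set cs"
  shows "3 * S + idx R (\<pi> ! k) \<in> nodes (rl k) k" "lt (3 * S + idx R (\<pi> ! k)) = \<pi> ! k"
proof -
  note nx = next_letter[OF k]
  let ?j = "idx R (\<pi> ! k)"
  have R: "\<pi> ! k \<in> set R" using nx(3) R_facts by simp
  show lt: "lt (3 * S + ?j) = \<pi> ! k" using nth_idx[OF R] by (simp add: lt_node)
  have jn: "?j < n" using idx_less_length[OF R] R_facts by simp
  have "?j < rl k" using nth_in_rlog_iff[OF jn, of k] nx(2) nth_idx[OF R] by simp
  then show "3 * S + ?j \<in> nodes (rl k) k" using lt x nx(1) by (simp add: nodes_def)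
qed

lemma key_lt: "key e = idx \<pi> (lt e)"
  by (simp add: key_def)

text \<open>The next letter of \<open>\<pi>\<close> is available. If it is not a bottleneck it lies
  in the heap, and then it is the minimum. If it is one, it is output before the minimum and counted
  among the bottlenecks preceding it, so the two counts differ.\<close>

lemma min_node:
  assumes k: "k < n" and e: "e \<in> nodes (rl k) k" and min: "\<And>x. x \<in> nodes (rl k) k \<Longrightarrow> key e \<le> key x"
  shows "cc k \<le> cc (idx \<pi> (lt e))"
    "cc (idx \<pi> (lt e)) = cc k \<Longrightarrow> \<pi> ! k = lt e"
    "cc (idx \<pi> (lt e)) \<noteq> cc k \<Longrightarrow> \<pi> ! k \<in> set cs"
proof -
  have kn: "k \<le> n" using k by simp
  note b = node_letter[OF e kn] and nx = next_letter[OF k]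
  show "cc k \<le> cc (idx \<pi> (lt e))" by (rule cc_mono[OF b(3)])
  have nonchain: "\<pi> ! k = lt e" if "\<pi> ! k \<notin> set cs"
  proof -
    have "idx \<pi> (lt e) \<le> idx \<pi> (\<pi> ! k)"
      using min[OF next_nonchain_node(1)[OF k that]] next_nonchain_node(2)[OF k that] by (simp add: key_lt)
    then have "idx \<pi> (lt e) = idx \<pi> (\<pi> ! k)" using b(3) nx(4) by simp
    then show ?thesis using idx_inj[of "lt e" \<pi> "\<pi> ! k"] b(1) nx(3) perm_facts(2) by auto
  qed
  show "\<pi> ! k = lt e" if "cc (idx \<pi> (lt e)) = cc k"
  proof (rule nonchain, rule notI)
    assume c: "\<pi> ! k \<in> set cs"
    note ch = next_chain_letter[OF k c]
    have "idx \<pi> (lt e) \<noteq> k" using c b(1) nth_idx[of "lt e" \<pi>] perm_facts(2) by auto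
    then have "k < idx \<pi> (lt e)" using b(3) by simp
    then have "cs ! cc k \<in> set (take (idx \<pi> (lt e)) \<pi>)"
      using ch(2) nx(3,4) perm_facts in_set_take_iff_idx[OF perm_facts(1), of "\<pi> ! k"] by simp
    then show False using cs_nth_in_take_iff[OF ch(1)] that by simp
  qed
  show "\<pi> ! k \<in> set cs" if "cc (idx \<pi> (lt e)) \<noteq> cc k"
    using nonchain that nx(4) by metis
qed

lemma run_chain:
  assumes r: "run k k m G L v" and k: "k < n" "\<pi> ! k \<in> set cs"
    and u: "mem u = mem v" "hist u = hist v" "regs u 7 = 2 * S + Suc (cc k)"
      "\<forall>r\<in>{0, 2, 3, 8, 9, 10, 11, 12, 19}. regs u r = regs v r"
  shows "run (Suc k) k m G L u"
proof -
  have "set (take (Suc k) \<pi>) = insert (\<pi> ! k) (set (take k \<pi>))"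
    using k perm_facts(3) by (simp add: take_Suc_conv_app_nth)
  then have "nodes m (Suc k) = nodes m k" using k(2) unfolding nodes_def by auto
  moreover have "heap L rk (nb m) (nodes m k) v" using r by (simp add: run_def)
  then have "heap L rk (nb m) (nodes m k) u" by (rule heap_frame) (simp add: u(1))
  ultimately show ?thesis using r u k by (simp add: run_def env_def cc_Suc)
qed

lemma run_pop:
  assumes r: "run k k m G L v" and k: "k < n" and e: "e \<in> nodes m k" "\<pi> ! k = lt e" and m: "m \<le> n"
    and h: "heap L' rk (nb m) (nodes m k - {e}) u"
    and u: "\<And>a. a \<notin> heap_mem \<Longrightarrow> mem u a = mem v a" "hist u = hist v"
      "\<forall>r\<in>{0, 2, 3, 7, 8, 9, 10, 11, 12, 19}. regs u r = regs v r"
  shows "run (Suc k) k m G L' u"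
proof -
  obtain j where j: "e = 3 * S + j" "j < m" "R ! j \<notin> set cs" using e(1) by (rule nodesE)
  have "set (take (Suc k) \<pi>) = insert (lt e) (set (take k \<pi>))"
    using k perm_facts(3) e by (simp add: take_Suc_conv_app_nth)
  moreover have "x = e" if x: "x \<in> nodes m k" "lt x = lt e" for x
  proof -
    obtain i where i: "x = 3 * S + i" "i < m" using x(1) by (rule nodesE)
    then have "R ! i = R ! j" using x(2) j(1) by (simp add: lt_node)
    then show ?thesis using i j m R_facts by (simp add: nth_eq_iff_index_eq)
  qed
  ultimately have nodes: "nodes m (Suc k) = nodes m k - {e}" unfolding nodes_def by auto
  have lo: "a < 4 * S \<Longrightarrow> a \<notin> heap_mem" for a by (auto simp: heap_mem_def)
  have tgu: "mem u (x + 2 * S) = mem v (x + 2 * S)" if "x \<in> nodes m k" for x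
    using that m n_S by (intro u) (auto simp: nodes_def heap_mem_def)
  have "lt e \<notin> set cs" using e(1) by (simp add: nodes_def)
  then have cc: "cc (Suc k) = cc k" using e(2) k by (simp add: cc_Suc)
  have chain: "mem u (2 * S + j) = mem v (2 * S + j)" if "j < length cs" for j
    using that length_cs n_S by (intro u lo) simp
  have V: "mem u (3 * S + j) = mem v (3 * S + j)" if "j < rl k" for j
    using that rl_le[of k] n_S by (intro u lo) simp
  have out: "mem u j = mem v j" if "j < k" for j using that k n_S by (intro u lo) simp
  show ?thesis using r u(2,3) k h nodes cc chain V out tgu by (auto simp: run_def env_def)
qed

lemma run_target:
  assumes r: "run k k m G L s" and e: "e \<in> nodes m k" and m: "m \<le> n"
    and u: "mem u = (mem s)(e + 2 * S := tg (lt e))" "hist u = hist s"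
      "\<forall>r\<in>{0, 2, 3, 7, 8, 9, 10, 11, 12, 19}. regs u r = regs s r"
  shows "run k k m (insert (lt e) G) L u"
proof -
  obtain j where j: "e = 3 * S + j" "j < m" "R ! j \<notin> set cs" using e(1) by (rule nodesE)
  have inj: "x = e" if x: "x \<in> nodes m k" "lt x = lt e" for x
  proof -
    obtain i where i: "x = 3 * S + i" "i < m" using x(1) by (rule nodesE)
    then have "R ! i = R ! j" using x(2) j(1) by (simp add: lt_node)
    then show ?thesis using i j m R_facts by (simp add: nth_eq_iff_index_eq)
  qed
  have eb: "3 * S \<le> e" "e < 4 * S" using j m n_S by auto
  have "heap L rk (nb m) (nodes m k) s" using r by (simp add: run_def)
  then have h: "heap L rk (nb m) (nodes m k) u"
  proof (rule heap_frame)
    fix a assume "a \<in> nodes m k \<or> 4 * S \<le> a \<and> a < 5 * S \<or> 6 * S \<le> a \<and> a < 9 * S"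
    then have "a \<noteq> e + 2 * S" using eb m n_S by (auto simp: nodes_def)
    then show "mem u a = mem s a" using u(1) by simp
  qed
  have lt: "lt e \<in> \<Sigma> - set cs" "idx R (lt e) < m"
    using j m R_facts nth_mem[of j R] by (auto simp: lt_node idx_nth)
  have tgs: "(mem u (x + 2 * S) = 0 \<and> lt x \<notin> insert (lt e) G) \<or> mem u (x + 2 * S) = tg (lt x)"
    if "x \<in> nodes m k" for x
    using that r inj[OF that] u(1) unfolding run_def by (cases "x = e") auto
  have low: "mem u a = mem s a" if "a < 4 * S" for a using that u(1) eb by simp
  have chain: "mem u (2 * S + j) = mem s (2 * S + j)" if "j < length cs" for j
    using that length_cs n_S by (intro low) simp
  have V: "mem u (3 * S + j) = mem s (3 * S + j)" if "j < rl k" for j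
    using that rl_le[of k] n_S by (intro low) simp
  have out: "mem u j = mem s j" if "j < k" for j using that r n_S by (intro low) (simp add: run_def)
  show ?thesis using r u(2,3) h lt tgs chain V out unfolding run_def env_def by simp
qed

end

context heap_ram
begin

lemma heap_min:
  assumes h: "heap L r N E s"
  shows "mem s (8 * S) = 0 \<longleftrightarrow> E = {}" "E \<noteq> {} \<Longrightarrow> mem s (8 * S) \<in> E"
    "x \<in> E \<Longrightarrow> key (mem s (8 * S)) \<le> key x"
proof -
  have l: "lists ((mem s)(0 := 0)) (mem s) L" and E: "nds L = E" using h by (auto simp: heap_def)
  have "L 0 = []" using listsD(1)[OF l, of 0] nl_null[of "mem s" 0 "L 0"] by simp
  then have "below L 0 = E" using nds_below[OF l] E by simp
  moreover have "ismin key (mem s (8 * S + 0)) (below L 0)"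
    using h S_pos unfolding heap_def by (metis less_le_trans pos2)
  ultimately have "ismin key (mem s (8 * S)) E" by simp
  then show "mem s (8 * S) = 0 \<longleftrightarrow> E = {}" "E \<noteq> {} \<Longrightarrow> mem s (8 * S) \<in> E"
    "x \<in> E \<Longrightarrow> key (mem s (8 * S)) \<le> key x" by (auto simp: ismin_def split: if_splits)
qed

definition take_letter :: com where
  "take_letter = block [
     Bin Equal 56 29 7,
     IfNZ 56
       (block [Load 53 40, pop_node])
       (block [Load 53 7, Bin Add 7 7 19])]"

text \<open>The place found by a search remains valid, since the array of bottlenecks is fixed and
  only the pointer in register 7 advances. Once it is stored, a letter can wait as the minimum for
  any number of iterations at the price of equality tests.\<close>

definition select_next :: com where
  "select_next = block [
     Bin Add 54 10 3,
     Load 40 54,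
     IfNZ 40
       (block [
         Bin Add 55 40 3,
         Load 29 55,
         IfNZ 29 Skip (block [search, Store 55 29]),
         take_letter])
       (block [Load 53 7, Bin Add 7 7 19])]"

end

context sorting
begin

lemma run_env: "run k h m G L s \<Longrightarrow> env s"
  by (simp add: run_def)

lemma wp_take_letter:
  assumes run: "run k k (rl k) G L v" and k: "k < n" and e: "regs v 40 = mem v (8 * S)" and ne: "nodes (rl k) k \<noteq> {}"
    and r29: "regs v 29 = tg (lt (regs v 40))"
    and Q: "\<And>s' t q L'. t + 48 * pot L \<le> 48 * pot L' + 10 + 100 * (if \<pi> ! k \<in> set cs then 0 else pop_cost (\<pi> ! k)) \<Longrightarrow>
      q + 2 * pot L \<le> 2 * pot L' + (if \<pi> ! k \<in> set cs then 0 else pop_cost (\<pi> ! k)) \<Longrightarrow>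
      run (Suc k) k (rl k) G L' s' \<Longrightarrow> regs s' 53 = \<pi> ! k \<Longrightarrow> Q s' t q"
  shows "WP take_letter Q v"
proof -
  let ?e = "regs v 40"
  have heap: "heap L rk (nb (rl k)) (nodes (rl k) k) v" and r7: "regs v 7 = 2 * S + cc k" and r19: "regs v 19 = 1"
    and chain: "\<forall>j<length cs. mem v (2 * S + j) = cs ! j" using run by (auto simp: run_def env_def)
  have e': "?e \<in> nodes (rl k) k" "\<And>x. x \<in> nodes (rl k) k \<Longrightarrow> key ?e \<le> key x"
    using heap_min[OF heap] ne e by auto
  note b = node_letter[OF e'(1) less_imp_le[OF k]]
  have mn: "cc (idx \<pi> (lt ?e)) = cc k \<Longrightarrow> \<pi> ! k = lt ?e" "cc (idx \<pi> (lt ?e)) \<noteq> cc k \<Longrightarrow> \<pi> ! k \<in> set cs"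
    using min_node(2,3)[OF k e'(1)] e'(2) by blast+
  have eq: "regs v 29 = regs v 7 \<longleftrightarrow> cc (idx \<pi> (lt ?e)) = cc k" using r29 r7 by (simp add: tg_def)
  have me: "mem v ?e = lt ?e" using heap e'(1) by (auto simp: heap_def node_def)
  show ?thesis
  proof (cases "cc (idx \<pi> (lt ?e)) = cc k")
    case True
    then have x: "\<pi> ! k = lt ?e" by (rule mn(1))
    then have nc: "\<pi> ! k \<notin> set cs" using b(1) by simp
    have ik: "idx \<pi> (lt ?e) = k" using next_letter(4)[OF k] x by simp
    have N: "nb (rl k) + 2 \<le> S" using nb_le[of "rl k"] n_S by simp
    have "R ! idx R (lt ?e) = lt ?e" using b(1) R_facts by (simp add: nth_idx)
    moreover have "idx R (lt ?e) < n" using b(6) rl_le[of k] by simp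
    moreover have "?e - 3 * S = idx R (lt ?e)" using b(5) by linarith
    ultimately have rke: "rk ?e = Suc (nb (idx R (lt ?e)))" using b(1) unfolding rk_def by (simp add: nb_Suc)
    \<comment> \<open>\<open>rk\<close> counts the letter's own insertion while \<open>insb\<close>
      starts just before it, so the age bound of the deletion yields
      \<open>2 ^ (i - 1) \<le> insb (\<pi> ! k)\<close>.\<close>
    have lev: "i \<le> Suc (floor_log (insb (\<pi> ! k)))" if "i = 0 \<or> rk ?e + 2 ^ (i - 1) \<le> nb (rl k)" for i
    proof (cases "i = 0")
      case False
      then have "2 ^ (i - 1) \<le> insb (\<pi> ! k)" using that rke x ik by (simp add: insb_def)
      then have "i - 1 \<le> floor_log (insb (\<pi> ! k))" using floor_log_mono[THEN monoD] by fastforce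
      then show ?thesis by simp
    qed simp
    show ?thesis
      using True eq e me
      apply (simp add: take_letter_def wp_simps)
      apply (rule wp_pop_node[where L = L and r = rk and N = "nb (rl k)" and E = "nodes (rl k) k"])
           apply (use run_env[OF run] in \<open>simp add: env_def; fail\<close>)
          apply (rule heap_frame[OF heap]; simp)
         apply (rule ne)
        apply simp
       apply (rule N)
      subgoal premises prems for s' t q L' i
      proof -
        have i: "i \<le> Suc (floor_log (insb (\<pi> ! k)))" by (rule lev) (use prems(9) in simp)
        have "run (Suc k) k (rl k) G L' s'"
          by (rule run_pop[OF run k e'(1) x rl_le, of L'])
            (use prems in \<open>auto simp: frame_def heap_regs_def\<close>)
        moreover have "regs s' 53 = \<pi> ! k" using prems x by (auto simp: frame_def heap_regs_def)
        ultimately show ?thesis using prems(5,6,8) i nc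
          by (intro Q[of _ L']) (auto simp: pop_cost_def)
      qed
      done
  next
    case False
    then have x: "\<pi> ! k \<in> set cs" by (rule mn(2))
    note nx = next_chain_letter[OF k x]
    have sp: "Suc (2 * S + cc k) < 2 ^ w" using nx(1) length_cs n_S space by simp
    show ?thesis
      using False eq r7 r19 sp chain nx
      apply (simp add: take_letter_def wp_simps)
      apply (rule Q[of _ L])
         apply simp
        apply simp
       apply (rule run_chain[OF run k x]; simp)
      apply simp
      done
  qed
qed

lemma wp_select_next:
  assumes run: "run k k (rl k) G L s" and k: "k < n"
    and Q: "\<And>s' t q L' G'. t + 48 * pot L + 100 * sum search_cost G \<le>
        48 * pot L' + 60 + 100 * (if \<pi> ! k \<in> set cs then 0 else pop_cost (\<pi> ! k)) + 100 * sum search_cost G' \<Longrightarrow>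
      q + 2 * pot L + sum search_cost G \<le> 2 * pot L' + (if \<pi> ! k \<in> set cs then 0 else pop_cost (\<pi> ! k)) + sum search_cost G' \<Longrightarrow>
      run (Suc k) k (rl k) G' L' s' \<Longrightarrow> regs s' 53 = \<pi> ! k \<Longrightarrow> Q s' t q"
  shows "WP select_next Q s"
proof -
  have heap: "heap L rk (nb (rl k)) (nodes (rl k) k) s" and rs: "regs s 7 = 2 * S + cc k" "regs s 19 = 1"
      "regs s 10 = 6 * S" "regs s 3 = 2 * S" "regs s 8 = 2 * S + length cs" and env: "env s"
    and chain: "\<forall>j<length cs. mem s (2 * S + j) = cs ! j"
    and tgs: "\<forall>e\<in>nodes (rl k) k. (mem s (e + 2 * S) = 0 \<and> lt e \<notin> G) \<or> mem s (e + 2 * S) = tg (lt e)"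
    and G: "G \<subseteq> \<Sigma>" using run by (auto simp: run_def env_def)
  let ?e = "mem s (8 * S)"
  show ?thesis
  proof (cases "nodes (rl k) k = {}")
    case True
    then have e0: "?e = 0" using heap_min(1)[OF heap] by simp
    have x: "\<pi> ! k \<in> set cs" using next_nonchain_node(1)[OF k] True by auto
    note nx = next_chain_letter[OF k x]
    have sp: "Suc (2 * S + cc k) < 2 ^ w" using nx(1) length_cs n_S space by simp
    show ?thesis
      using e0 rs sp space chain nx
      apply (simp add: select_next_def wp_simps)
      apply (rule Q[of _ L G])
         apply simp
        apply simp
       apply (rule run_chain[OF run k x]; simp)
      apply simp
      done
  next
    case ne: False
    have e': "?e \<in> nodes (rl k) k" using heap_min(2)[OF heap ne] .
    have e0: "?e \<noteq> 0" using heap_min(1)[OF heap] ne by simp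
    note b = node_letter[OF e' less_imp_le[OF k]]
    have me: "mem s ?e = lt ?e" "lt ?e \<in> set \<pi>" "?e < 4 * S" using heap e' by (auto simp: heap_def node_def)
    have sp: "?e + 2 * S < 2 ^ w" using me(3) space by simp
    show ?thesis
    proof (cases "mem s (?e + 2 * S) = 0")
      case False
      then have r29: "mem s (?e + 2 * S) = tg (lt ?e)" using bspec[OF tgs e'] by simp
      have run': "run k k (rl k) G L u" if "mem u = mem s" "hist u = hist s"
         "\<forall>r\<in>{0, 2, 3, 7, 8, 9, 10, 11, 12, 19}. regs u r = regs s r" for u
      proof -
        have "heap L rk (nb (rl k)) (nodes (rl k) k) u" by (rule heap_frame[OF heap]) (simp add: that)
        then show ?thesis using run that by (simp add: run_def env_def)
      qed
      show ?thesis
        using e0 rs sp space False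
        apply (simp add: select_next_def wp_simps)
        apply (rule wp_take_letter[OF run' k _ ne])
             apply simp
            apply simp
           apply simp
          apply simp
         apply (simp add: r29)
        subgoal for s' t q L'
          by (rule Q[of _ L' G]) simp_all
        done
    next
      case True
      then have bG: "lt ?e \<notin> G" using bspec[OF tgs e'] S_pos by (simp add: tg_def)
      have lcs: "length cs < S" using length_cs n_S by simp
      have d: "precedes \<pi> (cs ! j) (lt ?e) \<longleftrightarrow> j < cc (idx \<pi> (lt ?e))" if "j < length cs" for j
      proof -
        have m: "cs ! j \<in> set \<pi>" using that cs_facts(2) perm_facts(2) by (metis nth_mem subsetD)
        have "precedes \<pi> (cs ! j) (lt ?e) \<longleftrightarrow> cs ! j \<in> set (take (idx \<pi> (lt ?e)) \<pi>)"
          using m me(2) dist by (simp add: precedes_iff_idx in_set_take_iff_idx)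
        then show ?thesis using cs_nth_in_take_iff[OF that] by simp
      qed
      have c: "cc k \<le> cc (idx \<pi> (lt ?e))" by (rule cc_mono[OF b(3)])
      \<comment> \<open>The search starts at the current bottleneck. The letter became available no
        later than now, so the distance searched is at most \<open>dst\<close>.\<close>
      have "cc (avl (lt ?e)) \<le> cc k" by (rule cc_mono[OF b(4)])
      then have "floor_log (cc (idx \<pi> (lt ?e)) - cc k + 1) \<le> floor_log (dst (lt ?e) + 1)"
        by (intro floor_log_mono[THEN monoD]) (simp add: dst_def)
      then have sc: "2 * floor_log (cc (idx \<pi> (lt ?e)) - cc k + 1) + 1 \<le> search_cost (lt ?e)" by (simp add: search_cost_def)
      have sumG: "sum search_cost (insert (lt ?e) G) = search_cost (lt ?e) + sum search_cost G"
        using bG finite_subset[OF G fin] by simp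
      have sub: "set cs \<subseteq> set \<pi>" using cs_facts perm_facts by simp
      show ?thesis
        using e0 rs sp space True
        apply (simp add: select_next_def wp_simps)
        apply (rule wp_search[where cs = cs and b = "lt ?e" and d = "cc (idx \<pi> (lt ?e))" and c = "cc k"])
                   apply (use env in \<open>simp add: env_def; fail\<close>)
                  apply simp
                 apply (rule lcs)
                apply (use chain in \<open>simp; fail\<close>)
               apply (rule sub)
              apply (use me in \<open>simp; fail\<close>)
             apply (rule me)
            apply (erule d)
           apply (rule cc_le)
          apply simp
         apply (rule c)
        subgoal premises prems for s' t q
        proof -
          have s': "regs s' 55 = ?e + 2 * S" "regs s' 29 = tg (lt ?e)" "mem s' = mem s" "hist s' = hist s" "regs s' 40 = ?e"
            "\<forall>r\<in>{0, 2, 3, 7, 8, 9, 10, 11, 12, 19}. regs s' r = regs s r"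
            using prems by (auto simp: frame_def tg_def)
          have run': "run k k (rl k) (insert (lt ?e) G) L (s'\<lparr>mem := (mem s)(?e + 2 * S := tg (lt ?e))\<rparr>)"
            by (rule run_target[OF run e' rl_le]) (use s' in simp_all)
          show ?thesis
            using s'(1-3)
            apply (simp add: wp_simps)
            apply (rule wp_take_letter[OF run' k _ ne])
              apply (use s' me(3) S_pos in \<open>simp; fail\<close>)
             apply (use s' in \<open>simp; fail\<close>)
            subgoal for s'' t' q' L'
              by (rule Q[of _ L' "insert (lt ?e) G"]) (use prems(10,11) sc sumG in \<open>simp_all split: if_splits\<close>)
            done
        qed
        done
    qed
  qed
qed

section \<open>The main loop and its budget\<close>

definition iterate :: com where
  "iterate = block [
     select_next,
     Store 11 53,
     Bin Add 11 11 19,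
     CallStep 53 9 51,
     handle,
     Bin Less 52 11 0]"

definition main_loop :: com where
  "main_loop = block [Bin Less 52 11 0, WhileNZ 52 iterate]"

text \<open>Amortised comparisons up to time \<open>k\<close>: two per insertion, plus the deletions
  and the searches made so far, \<open>G\<close> being the set of letters searched. A multiple of
  the same quantity, together with the cost of the data structure, bounds the time.\<close>

definition budget :: "nat \<Rightarrow> nat set \<Rightarrow> nat" where
  "budget k G = 2 * nb (rl k) + sum pop_cost (set (take k \<pi>) - set cs) + sum search_cost G"

lemma rl_Suc: "k < n \<Longrightarrow> rl (Suc k) = rl k + length (reports C (take (Suc k) \<pi>))"
  by (simp add: rlog_Suc)

lemma report_cost: "1 + length (reports C (take k \<pi>)) \<le> cost C (take k \<pi>)"
  using ds take_in_A[of k] unfolding is_candidate_ds_def A_def by blast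

lemma take_Suc_perm: "k < n \<Longrightarrow> take k \<pi> @ [\<pi> ! k] = take (Suc k) \<pi>"
  using perm_facts(3) by (simp add: take_Suc_conv_app_nth)

lemma reports_nth:
  assumes "k < n" "rl k \<le> j" "j < rl (Suc k)"
  shows "reports C (take (Suc k) \<pi>) ! (j - rl k) = R ! j"
proof -
  have "R ! j = rlog C (take (Suc k) \<pi>) ! j" using assms rlog_take_eq[of "Suc k"] by (metis nth_take)
  then show ?thesis using assms by (simp add: rlog_Suc nth_append)
qed

lemma run_call:
  assumes r: "run (Suc k) k (rl k) G L s" and k: "k < n"
    and u: "mem u = write_block (3 * S + rl k) (reports C (take (Suc k) \<pi>)) ((mem s)(k := \<pi> ! k))"
      "hist u = Some (take (Suc k) \<pi>)" "regs u 11 = Suc k"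
      "\<forall>r\<in>{0, 2, 3, 7, 8, 9, 10, 12, 19}. regs u r = regs s r"
  shows "run (Suc k) (Suc k) (rl k) G L u"
proof -
  let ?ys = "reports C (take (Suc k) \<pi>)"
  have rl: "rl (Suc k) = rl k + length ?ys" "rl (Suc k) \<le> n" using rl_Suc[OF k] rl_le[of "Suc k"] by simp_all
  have mu: "mem u a = mem s a" if "a < 3 * S + rl k \<or> 4 * S \<le> a" "a \<noteq> k" for a
    using that u(1) rl n_S by (auto simp: write_block_def)
  have "heap L rk (nb (rl k)) (nodes (rl k) (Suc k)) s" using r by (simp add: run_def)
  then have h: "heap L rk (nb (rl k)) (nodes (rl k) (Suc k)) u"
  proof (rule heap_frame)
    fix a assume "a \<in> nodes (rl k) (Suc k) \<or> 4 * S \<le> a \<and> a < 5 * S \<or> 6 * S \<le> a \<and> a < 9 * S"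
    then show "mem u a = mem s a" using k n_S by (intro mu) (auto simp: nodes_def)
  qed
  have chain: "mem u (2 * S + j) = mem s (2 * S + j)" if "j < length cs" for j
    using that length_cs n_S k by (intro mu) auto
  have V: "mem u (3 * S + j) = R ! j" if "j < rl (Suc k)" for j
  proof (cases "j < rl k")
    case True
    then have "mem u (3 * S + j) = mem s (3 * S + j)" using k n_S by (intro mu) auto
    then show ?thesis using True r by (simp add: run_def)
  next
    case False
    then show ?thesis using reports_nth[OF k, of j] that u(1) rl(1) by (simp add: write_block_def)
  qed
  have out: "mem u j = \<pi> ! j" if "j < Suc k" for j
  proof (cases "j = k")
    case True
    then show ?thesis using u(1) k n_S by (simp add: write_block_def)
  next
    case False
    then have "mem u j = mem s j" using that k n_S by (intro mu) auto
    then show ?thesis using False that r by (simp add: run_def)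
  qed
  have tg: "mem u (e + 2 * S) = mem s (e + 2 * S)" if "e \<in> nodes (rl k) (Suc k)" for e
    using that k n_S by (intro mu) (auto simp: nodes_def)
  show ?thesis using r u(2,3,4) k h chain V out tg unfolding run_def env_def by simp
qed

text \<open>The letters output so far and the current one were all available before this step, hence
  reported earlier; the log has no repetitions.\<close>

lemma new_reports:
  assumes k: "k < n" and j: "rl k \<le> j" "j < rl (Suc k)"
  shows "R ! j \<notin> set (take (Suc k) \<pi>)"
proof -
  have jn: "j < n" using j rl_le[of "Suc k"] by simp
  have "R ! j \<notin> set (rlog C (take k \<pi>))" using nth_in_rlog_iff[OF jn, of k] j by simp
  moreover have "set (take k \<pi>) \<subseteq> set (rlog C (take k \<pi>))" by (subst rlog_take_set) blast
  ultimately have "R ! j \<notin> set (take k \<pi>)" "R ! j \<noteq> \<pi> ! k" using next_letter(2)[OF k] by (blast, metis)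
  moreover have "set (take (Suc k) \<pi>) = insert (\<pi> ! k) (set (take k \<pi>))" by (simp flip: take_Suc_perm[OF k])
  ultimately show ?thesis by simp
qed

lemma wp_iterate:
  assumes run: "run k k (rl k) G L s" and k: "k < n"
    and Q: "\<And>s' t q L' G'. t + 48 * pot L + 100 * budget k G \<le>
        48 * pot L' + 100 * budget (Suc k) G' + 300 * cost C (take (Suc k) \<pi>) \<Longrightarrow>
      q + 2 * pot L + budget k G \<le> 2 * pot L' + budget (Suc k) G' \<Longrightarrow>
      run (Suc k) (Suc k) (rl (Suc k)) G' L' s' \<Longrightarrow> regs s' 52 = of_bool (Suc k < n) \<Longrightarrow> Q s' t q"
  shows "WP iterate Q s"
proof -
  let ?ys = "reports C (take (Suc k) \<pi>)" and ?P = "if \<pi> ! k \<in> set cs then 0 else pop_cost (\<pi> ! k)"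
  have pops: "sum pop_cost (set (take (Suc k) \<pi>) - set cs) = sum pop_cost (set (take k \<pi>) - set cs) + ?P"
  proof -
    have "set (take (Suc k) \<pi>) - set cs = (if \<pi> ! k \<in> set cs then set (take k \<pi>) - set cs else insert (\<pi> ! k) (set (take k \<pi>) - set cs))"
      by (auto simp flip: take_Suc_perm[OF k])
    then show ?thesis using next_letter(1)[OF k] by simp
  qed
  have nbm: "nb (rl k) \<le> nb (rl (Suc k))" by (rule nb_mono) (simp add: rl_Suc[OF k])
  have sp: "3 * S + rl (Suc k) < 2 ^ w" "3 * S + rl k + length ?ys < 2 ^ w" "Suc k < 2 ^ w" "length ?ys < 2 ^ w"
    using rl_le[of "Suc k"] rl_Suc[OF k] n_S space k by auto
  show ?thesis
    apply (simp add: iterate_def wp_simps)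
    apply (rule wp_select_next[OF run k])
    subgoal premises prems for s1 t1 q1 L1 G1
    proof -
      have s1: "regs s1 11 = k" "regs s1 19 = 1" "regs s1 9 = 3 * S + rl k" "hist s1 = Some (take k \<pi>)" "regs s1 53 = \<pi> ! k"
        using prems(3,4) by (auto simp: run_def env_def)
      let ?s2 = "s1\<lparr>regs := (regs s1)(11 := Suc k, 51 := length ?ys),
          mem := write_block (3 * S + rl k) ?ys ((mem s1)(k := \<pi> ! k)), hist := Some (take (Suc k) \<pi>)\<rparr>"
      have run2: "run (Suc k) (Suc k) (rl k) G1 L1 ?s2" by (rule run_call[OF prems(3) k]) simp_all
      have "WP handle (\<lambda>s3 t3 q3. WP (Bin Less 52 11 0) (\<lambda>s' t q. Q s' (Suc (Suc (Suc (t1 + (t3 + t) + cost C (take (Suc k) \<pi>))))) (q1 + (q3 + q))) s3) ?s2"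
      proof (rule wp_handle[OF run2 _ new_reports[OF k]], goal_cases)
        case (5 s3 t3 q3 L3)
        have s3: "regs s3 11 = Suc k" "regs s3 0 = n" using 5(3) by (auto simp: run_def)
        have "rl (Suc k) - rl k = length ?ys" using rl_Suc[OF k] by simp
        then have "t1 + t3 + cost C (take (Suc k) \<pi>) + 4 + 48 * pot L + 100 * budget k G \<le>
          48 * pot L3 + 100 * budget (Suc k) G1 + 300 * cost C (take (Suc k) \<pi>)"
          using prems(1) 5(1) nbm report_cost[of "Suc k"] unfolding budget_def pops by simp
        moreover have "q1 + q3 + 2 * pot L + budget k G \<le> 2 * pot L3 + budget (Suc k) G1"
          using prems(2) 5(2) nbm unfolding budget_def pops by simp
        moreover have "run (Suc k) (Suc k) (rl (Suc k)) G1 L3 (s3\<lparr>regs := (regs s3)(52 := of_bool (Suc k < n))\<rparr>)"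
          using 5(3) unfolding run_def env_def heap_def node_def by simp
        ultimately show ?case
          using s3 by (simp add: wp_simps split del: split_of_bool) (rule Q[of _ L3 G1]; simp)
      qed (use rl_Suc[OF k] in auto)
      then show ?thesis
        using s1 sp take_Suc_perm[OF k] take_in_A[of "Suc k"]
        by (simp add: wp_simps wp_CallStep[where h = "take k \<pi>"] add_ac)
    qed
    done
qed

lemma wp_main_loop:
  assumes run: "run 0 0 (rl 0) {} L s" 
    and Q: "\<And>s' t q G. t + 48 * pot L + 100 * budget 0 {} + 300 * cost C [] \<le> 2 * n + 5 + 100 * budget n G + 300 * dscost C \<pi> \<Longrightarrow>
      q + 2 * pot L + budget 0 {} \<le> budget n G \<Longrightarrow> G \<subseteq> \<Sigma> - set cs \<Longrightarrow> (\<forall>j<n. mem s' j = \<pi> ! j) \<Longrightarrow> Q s' t q"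
  shows "WP main_loop Q s"
proof -
  have loop: "WP (WhileNZ 52 iterate) W u"
    if u: "run 0 0 (rl 0) {} L u" "regs u 52 = of_bool (0 < n)"
    and W: "\<And>s' t q G. t + 48 * pot L + 100 * budget 0 {} + 300 * cost C [] \<le> 2 * n + 2 + 100 * budget n G + 300 * dscost C \<pi> \<Longrightarrow>
      q + 2 * pot L + budget 0 {} \<le> budget n G \<Longrightarrow> G \<subseteq> \<Sigma> - set cs \<Longrightarrow> (\<forall>j<n. mem s' j = \<pi> ! j) \<Longrightarrow> W s' t q" for W u
  proof (rule wp_WhileNZ[where m = n and I = "\<lambda>v s' t q. \<exists>k L' G. k \<le> n \<and> v = n - k \<and>
      run k k (rl k) G L' s' \<and> regs s' 52 = of_bool (k < n) \<and>
      t + 48 * pot L + 100 * budget 0 {} + 300 * cost C [] \<le> k + 48 * pot L' + 100 * budget k G + 300 * dscost C (take k \<pi>) \<and>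
      q + 2 * pot L + budget 0 {} \<le> 2 * pot L' + budget k G"], goal_cases)
    case 1
    show ?case by (rule exI[of _ 0], rule exI[of _ L], rule exI[of _ "{}"]) (use u in simp)
  next
    case (2 v u t q)
    then obtain k L' G where i: "v = n - k" "run k k (rl k) G L' u" "regs u 52 = of_bool (k < n)"
      "t + 48 * pot L + 100 * budget 0 {} + 300 * cost C [] \<le> k + 48 * pot L' + 100 * budget k G + 300 * dscost C (take k \<pi>)"
      "q + 2 * pot L + budget 0 {} \<le> 2 * pot L' + budget k G" by blast
    have k: "k < n" using i(3) 2(2) by (simp split: if_splits)
    have dc: "dscost C (take (Suc k) \<pi>) = dscost C (take k \<pi>) + cost C (take (Suc k) \<pi>)"
      using dscost_snoc[of C "take k \<pi>" "\<pi> ! k"] take_Suc_perm[OF k] by simp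
    show ?case
    proof (rule wp_iterate[OF i(2) k], goal_cases)
      case (1 s' t' q' L'' G'')
      then show ?case using i(1,4,5) k dc
        by - (rule exI[of _ "n - Suc k"], rule conjI, simp, rule exI[of _ "Suc k"], rule exI[of _ L''], rule exI[of _ G''], simp)
    qed
  next
    case (3 v u t q)
    then obtain k L' G where i: "k \<le> n" "run k k (rl k) G L' u" "regs u 52 = of_bool (k < n)"
      "t + 48 * pot L + 100 * budget 0 {} + 300 * cost C [] \<le> k + 48 * pot L' + 100 * budget k G + 300 * dscost C (take k \<pi>)"
      "q + 2 * pot L + budget 0 {} \<le> 2 * pot L' + budget k G" by blast
    have k: "k = n" using i(1,3) 3(2) by (simp split: if_splits)
    \<comment> \<open>All letters are output, so the heap is empty. Its potential is back at 0:
      every merge has been paid for by a deletion.\<close>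
    have "nodes (rl n) n = {}"
    proof -
      have "lt e \<in> set \<pi>" if "e \<in> nodes (rl n) n" for e
        using node_letter(1)[OF that order_refl] perm_facts(2) by simp
      then show ?thesis using perm_facts(3) by (auto simp: nodes_def)
    qed
    moreover have "heap L' rk (nb (rl n)) (nodes (rl n) n) u" using i(2) k by (simp add: run_def)
    ultimately have "nds L' = {}" by (simp add: heap_def)
    then have "L' c = []" for c by (auto simp: nds_def)
    then have pot: "pot L' = 0" by (simp add: pot_def)
    show ?case
      using i(4,5) pot k perm_facts(3) i(2) by (intro W[of _ G]) (auto simp: run_def)
  qed
  have "run 0 0 (rl 0) {} L (s\<lparr>regs := (regs s)(52 := of_bool (0 < n))\<rparr>)" "regs s 11 = 0" "regs s 0 = n"
    using run by (auto simp: run_def env_def heap_def node_def)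
  then show ?thesis
    apply (simp add: main_loop_def wp_simps split del: split_of_bool)
    apply (rule loop)
      apply simp
     apply simp
    apply (rule Q; simp)
    done
qed

section \<open>Preparing the second run of the data structure\<close>

definition clear_step :: com where
  "clear_step = block [Store 57 12, Bin Add 57 57 19, Bin Less 52 57 58]"

text \<open>The run that computed the bottlenecks has exhausted the data structure, so
  \<open>init\<close> is called again. Its reports are handled like those of a step.\<close>

definition setup_run :: com where
  "setup_run = block [
     Move 7 3,
     Bin Add 9 3 2,
     Move 57 10,
     Bin Add 58 9 10,
     Bin Less 52 57 58,
     WhileNZ 52 clear_step,
     Const 11 0,
     CallInit 9 51,
     handle]"

text \<open>Memory starts with arbitrary words, so the heads of the lists and the minima must be set
  to null: three blocks at five units of time per cell.\<close>

lemma wp_clear: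
  assumes s: "regs s 57 = 6 * S" "regs s 58 = 9 * S" "regs s 12 = 0" "regs s 19 = 1" "regs s 52 = 1"
    and Q: "\<And>s' t. t \<le> 15 * S + 1 \<Longrightarrow> frame {52, 57} {6 * S..<9 * S} s s' \<Longrightarrow>
      (\<forall>a. 6 * S \<le> a \<and> a < 9 * S \<longrightarrow> mem s' a = 0) \<Longrightarrow> Q s' t 0"
  shows "WP (WhileNZ 52 clear_step) Q s"
proof (rule wp_WhileNZ[where m = "3 * S" and I = "\<lambda>m s' t q. q = 0 \<and> (\<exists>j\<le>3 * S. m = 3 * S - j \<and> t = 5 * j \<and>
    regs s' 57 = 6 * S + j \<and> regs s' 52 = of_bool (j < 3 * S) \<and> frame {52, 57} {6 * S..<9 * S} s s' \<and>
    (\<forall>a. 6 * S \<le> a \<and> a < 6 * S + j \<longrightarrow> mem s' a = 0))"], goal_cases)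
  case 1
  then show ?case using s S_pos by (auto intro!: exI[of _ 0] frame_refl)
next
  case (2 m u t q)
  then obtain j where j: "m = 3 * S - j" "t = 5 * j" "regs u 57 = 6 * S + j" "frame {52, 57} {6 * S..<9 * S} s u"
    "\<forall>a. 6 * S \<le> a \<and> a < 6 * S + j \<longrightarrow> mem u a = 0" "j < 3 * S" "q = 0" by auto
  have u: "regs u 58 = 9 * S" "regs u 12 = 0" "regs u 19 = 1" using j(4) s by (auto simp: frame_def)
  have sp: "Suc (6 * S + j) < 2 ^ w" using j(6) space by simp
  let ?u = "u\<lparr>mem := (mem u)(6 * S + j := 0), regs := (regs u)(57 := Suc (6 * S + j), 52 := of_bool (Suc (6 * S + j) < 9 * S))\<rparr>"
  have fr: "frame {52, 57} {6 * S..<9 * S} s ?u" using j(4,6) by (auto simp: frame_def)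
  have z: "\<forall>a. 6 * S \<le> a \<and> a < 6 * S + Suc j \<longrightarrow> mem ?u a = 0" using j(5) by (auto simp: less_Suc_eq)
  show ?case
    using u j(1-3,6,7) sp fr z by (simp add: clear_step_def wp_simps split del: split_of_bool)
next
  case (3 m u t q)
  then obtain j where j: "t = 5 * j" "j = 3 * S" "frame {52, 57} {6 * S..<9 * S} s u"
    "\<forall>a. 6 * S \<le> a \<and> a < 6 * S + j \<longrightarrow> mem u a = 0" "q = 0" by auto
  have "\<forall>a. 6 * S \<le> a \<and> a < 9 * S \<longrightarrow> mem u a = 0" using j(2,4) by simp
  moreover have "1 + t \<le> 15 * S + 1" using j by simp
  ultimately show ?case using Q[OF _ j(3)] j(5) by blast
qed

lemma heap_empty:
  assumes "\<And>a. 6 * S \<le> a \<Longrightarrow> a < 9 * S \<Longrightarrow> mem s a = 0"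
  shows "heap (\<lambda>_. []) r 0 {} s"
proof -
  have "lists ((mem s)(0 := 0)) (mem s) (\<lambda>_. [])" using assms by (auto simp: lists_def cells_def)
  moreover have "aged (\<lambda>_. []) (\<lambda>_. 0) r" by (simp add: aged_def)
  moreover have "\<forall>j<S. ismin key (mem s (8 * S + j)) (below (\<lambda>_. []) j)"
    using assms by (simp add: ismin_def below_def)
  ultimately show ?thesis by (auto simp: heap_def nds_def)
qed

lemma wp_setup_run:
  assumes env: "env s" and s: "regs s 0 = n" "regs s 8 = 2 * S + length cs"
    and chain: "\<And>j. j < length cs \<Longrightarrow> mem s (2 * S + j) = cs ! j"
    and Q: "\<And>s' t q L. t \<le> 48 * pot L + 100 * budget 0 {} + 300 * cost C [] + 20 * S \<Longrightarrow> q \<le> 2 * pot L + budget 0 {} \<Longrightarrow>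
      run 0 0 (rl 0) {} L s' \<Longrightarrow> Q s' t q"
  shows "WP setup_run Q s"
proof -
  have e: "regs s 19 = 1" "regs s 2 = S" "regs s 3 = 2 * S" "regs s 10 = 6 * S" "regs s 12 = 0" using env by (auto simp: env_def)
  let ?ys = "reports C []"
  have rl0: "rl 0 = length ?ys" by simp
  have sp: "3 * S + length ?ys < 2 ^ w" "length ?ys < 2 ^ w" using rl_le[of 0] n_S space by auto
  have pot0: "pot (\<lambda>_. []) = 0" by (simp add: pot_def)
  have nb0: "nb 0 = 0" by (simp add: nb_def)
  show ?thesis
    using e space S_pos
    apply (simp add: setup_run_def wp_simps)
    apply (rule wp_clear)
         apply (simp_all (no_asm_simp))[5]
    subgoal premises prems for s1 t1
    proof -
      have r1: "regs s1 9 = 3 * S" and r: "\<forall>r\<in>{0, 2, 3, 8, 10, 12, 19}. regs s1 r = regs s r" and r7: "regs s1 7 = 2 * S"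
        using prems(9) e by (auto simp: frame_def)
      have lo: "mem s1 a = mem s a" if "a < 6 * S" for a using prems(9) that by (auto simp: frame_def)
      let ?s2 = "s1\<lparr>regs := (regs s1)(11 := 0, 51 := length ?ys), mem := write_block (3 * S) ?ys (mem s1), hist := Some []\<rparr>"
      have h: "heap (\<lambda>_. []) rk 0 {} ?s2"
        by (rule heap_empty) (use prems(10) rl_le[of 0] n_S in \<open>auto simp: write_block_def\<close>)
      have "nodes 0 0 = {}" by (auto simp: nodes_def)
      moreover have "mem ?s2 (2 * S + j) = cs ! j" if "j < length cs" for j
        using that chain[OF that] lo[of "2 * S + j"] length_cs n_S by (simp add: write_block_def)
      moreover have "mem ?s2 (3 * S + j) = R ! j" if "j < rl 0" for j
      proof -
        have "R ! j = rlog C (take 0 \<pi>) ! j" using that rlog_take_eq[of 0] by (metis nth_take)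
        then show ?thesis using that by (simp add: write_block_def)
      qed
      ultimately have run: "run 0 0 0 {} (\<lambda>_. []) ?s2"
        using h r r1 r7 s e nb0 unfolding run_def env_def by (simp add: cc_def)
      have "WP handle (\<lambda>s' t q. Q s' (Suc (Suc (Suc (Suc (Suc (Suc (Suc (t1 + (t + cost C []))))))))) q) ?s2"
      proof (rule wp_handle[OF run], goal_cases)
        case (4 s' t q L)
        have "t + 8 + t1 + cost C [] \<le> 48 * pot L + 100 * budget 0 {} + 300 * cost C [] + 20 * S"
          using 4(1) prems(8) report_cost[of 0] S_pos nb0 pot0 by (simp add: budget_def)
        moreover have "q \<le> 2 * pot L + budget 0 {}" using 4(2) nb0 pot0 by (simp add: budget_def)
        ultimately show ?case using 4(3) by (intro Q[of _ L]) auto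
      qed simp_all
      then show ?thesis
        using r1 sp by (simp add: wp_simps wp_CallInit add_ac)
    qed
    done
qed

end

section \<open>Computing the bottlenecks\<close>

locale layering = ram w A C \<pi>
  for w :: nat and A :: "nat list set" and C :: "nat candidate_ds" and \<pi> :: "nat list" +
  fixes S :: nat and \<Sigma> :: "nat set" and p :: "nat \<Rightarrow> nat set \<Rightarrow> bool"
  assumes space: "10 * S < 2 ^ w" and S_def: "S = card \<Sigma> + 2"
    and fin: "finite \<Sigma>" and mps: "mps \<Sigma> p" and A_def: "A = mps_language \<Sigma> p" and ds: "is_candidate_ds \<Sigma> p C"
    and perm: "\<pi> \<in> antimatroid_perms \<Sigma> (mps_language \<Sigma> p)"
begin

definition core :: "state \<Rightarrow> bool" where
  "core s \<longleftrightarrow> regs s 0 = card \<Sigma> \<and> regs s 19 = 1 \<and> regs s 2 = S \<and> regs s 3 = 2 * S \<and> regs s 10 = 6 * S \<and> regs s 12 = 0"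

text \<open>Steps are made in the order of the reports, so the history is a prefix of its own log.
  The log itself is the queue, with registers 4 and 5 pointing to its first unprocessed letter and
  to its end.\<close>

definition queue :: "nat list \<Rightarrow> state \<Rightarrow> bool" where
  "queue \<beta> s \<longleftrightarrow> core s \<and> \<beta> \<in> A \<and> \<beta> = take (length \<beta>) (rlog C \<beta>) \<and> hist s = Some \<beta> \<and>
     regs s 4 = S + length \<beta> \<and> regs s 5 = S + length (rlog C \<beta>) \<and>
     (\<forall>j<length (rlog C \<beta>). mem s (S + j) = rlog C \<beta> ! j)"

definition layer_step :: com where
  "layer_step = block [
     Load 23 4,
     CallStep 23 5 20,
     Bin Add 5 5 20,
     Bin Add 4 4 19,
     Bin Less 24 4 6]"

text \<open>The letters waiting when a layer begins are exactly those available then, and by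
  monotonicity they remain available while the layer is worked off. A bottleneck is recognised by
  the length of the waiting part, without any comparison.\<close>

definition layer :: com where
  "layer = block [
     Move 6 5,
     Bin Sub 22 5 4,
     Bin Equal 22 22 19,
     IfNZ 22 (block [Load 23 4, Store 8 23, Bin Add 8 8 19]) Skip,
     Bin Less 24 4 6,
     WhileNZ 24 layer_step,
     Bin Less 21 4 5]"

definition layers :: com where
  "layers = block [
     Const 19 1,
     Const 12 0,
     Bin Add 2 0 19,
     Bin Add 2 2 19,
     Bin Add 3 2 2,
     Bin Add 10 3 3,
     Bin Add 10 10 3,
     Move 4 2,
     Move 5 2,
     Move 8 3,
     CallInit 5 20,
     Bin Add 5 5 20,
     Bin Less 21 4 5,
     WhileNZ 21 layer]"

lemma n_S: "card \<Sigma> + 2 \<le> S"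
  by (simp add: S_def)

lemma rlog_facts:
  assumes "\<beta> \<in> A"
  shows "distinct (rlog C \<beta>)" "set (rlog C \<beta>) = set \<beta> \<union> {y \<in> \<Sigma> - set \<beta>. p y (set \<beta>)}"
    "length (rlog C \<beta>) \<le> card \<Sigma>" "set \<beta> \<subseteq> \<Sigma>" "distinct \<beta>"
proof -
  show 1: "distinct (rlog C \<beta>)" "set (rlog C \<beta>) = set \<beta> \<union> {y \<in> \<Sigma> - set \<beta>. p y (set \<beta>)}"
    using rlog_props[OF mps ds] assms A_def by blast+
  show 2: "set \<beta> \<subseteq> \<Sigma>" "distinct \<beta>" using mps_languageD[of \<beta> \<Sigma> p] assms A_def by simp_all
  have "set (rlog C \<beta>) \<subseteq> \<Sigma>" using 1(2) 2(1) by auto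
  then show "length (rlog C \<beta>) \<le> card \<Sigma>"
    using card_mono[OF fin] distinct_card[OF 1(1)] by metis
qed

lemma take_nth_notin: "distinct xs \<Longrightarrow> k < length xs \<Longrightarrow> xs ! k \<notin> set (take k xs)"
  by (simp add: in_set_take_iff_idx idx_nth)

lemma wp_layer_step:
  assumes q: "queue \<beta> s" and e: "regs s 6 = S + e" "length \<beta> < e" "e \<le> length (rlog C \<beta>)"
    and Q: "\<And>s' t \<beta>'. \<beta>' = \<beta> @ [rlog C \<beta> ! length \<beta>] \<Longrightarrow> t \<le> 6 + cost C \<beta>' \<Longrightarrow> 1 \<le> cost C \<beta>' \<Longrightarrow> queue \<beta>' s' \<Longrightarrow>
      regs s' 6 = S + e \<Longrightarrow> regs s' 8 = regs s 8 \<Longrightarrow> (\<forall>a. 2 * S \<le> a \<and> a < 3 * S \<longrightarrow> mem s' a = mem s a) \<Longrightarrow>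
      regs s' 24 = of_bool (length \<beta>' < e) \<Longrightarrow> Q s' t 0"
  shows "WP layer_step Q s"
proof -
  let ?k = "length \<beta>" let ?R = "rlog C \<beta>" let ?x = "?R ! ?k" let ?b = "\<beta> @ [?x]"
  have \<beta>: "\<beta> \<in> A" "\<beta> = take ?k ?R" using q by (auto simp: queue_def)
  note rf = rlog_facts[OF \<beta>(1)]
  have k: "?k < length ?R" using e by simp
  have x: "?x \<in> set ?R" "?x \<notin> set \<beta>" using k take_nth_notin[OF rf(1) k] \<beta>(2) by (auto simp: in_set_conv_nth)
  then have bA: "?b \<in> A" using \<beta>(1) rf(2) by (simp add: A_def snoc_in_mps_language_iff)
  have len: "length (rlog C ?b) = length ?R + length (reports C ?b)" by (simp add: rlog_snoc)
  have lenn: "length (rlog C ?b) \<le> card \<Sigma>" by (rule rlog_facts(3)[OF bA])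
  have sp: "S + length ?R + length (reports C ?b) < 2 ^ w" "Suc (S + ?k) < 2 ^ w" "length (reports C ?b) < 2 ^ w"
    using lenn len space S_def k by auto
  have s: "regs s 4 = S + ?k" "regs s 5 = S + length ?R" "hist s = Some \<beta>" "mem s (S + ?k) = ?x" "regs s 19 = 1" "core s"
    and mem: "\<forall>j<length ?R. mem s (S + j) = ?R ! j"
    using q k by (auto simp: queue_def core_def)
  have cost: "1 \<le> cost C ?b" using ds bA unfolding is_candidate_ds_def A_def by (metis le_add1 le_trans)
  let ?u = "s\<lparr>mem := write_block (S + length ?R) (reports C ?b) (mem s), hist := Some ?b,
      regs := (regs s)(23 := ?x, 20 := length (reports C ?b), 5 := S + length ?R + length (reports C ?b), 4 := Suc (S + ?k),
        24 := of_bool (Suc ?k < e))\<rparr>"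
  have "take (length ?b) (rlog C ?b) = ?b"
    using \<beta>(2) k by (simp add: rlog_snoc take_Suc_conv_app_nth)
  moreover have "mem ?u (S + j) = rlog C ?b ! j" if "j < length (rlog C ?b)" for j
    using that mem by (auto simp: rlog_snoc nth_append write_block_def)
  ultimately have qu: "queue ?b ?u"
    using s bA len unfolding queue_def core_def by simp
  have ch: "\<forall>a. 2 * S \<le> a \<and> a < 3 * S \<longrightarrow> mem ?u a = mem s a"
    using lenn len S_def by (auto simp: write_block_def)
  have "Q ?u (Suc (Suc (Suc (Suc (Suc (cost C ?b)))))) 0"
    by (rule Q[OF refl _ cost qu _ _ ch]) (use e in simp_all)
  then show ?thesis
    using s(1-5) sp e(1) bA
    by (simp add: layer_step_def wp_simps wp_CallStep[where h = \<beta>] add_ac fun_upd_twist split del: split_of_bool)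
qed

definition chain :: "nat list \<Rightarrow> state \<Rightarrow> bool" where
  "chain cs s \<longleftrightarrow> regs s 8 = 2 * S + length cs \<and> (\<forall>j<length cs. mem s (2 * S + j) = cs ! j)"

lemma wp_layer:
  assumes q: "queue \<alpha> s" and lay: "layered \<Sigma> p \<alpha> cs D" and ch: "chain cs s" and len: "length \<alpha> < length (rlog C \<alpha>)"
    and Q: "\<And>s' t \<beta> cs' D'. t + 30 * dscost C \<alpha> \<le> 30 * dscost C \<beta> \<Longrightarrow> queue \<beta> s' \<Longrightarrow> layered \<Sigma> p \<beta> cs' D' \<Longrightarrow>
      chain cs' s' \<Longrightarrow> length \<alpha> < length \<beta> \<Longrightarrow> regs s' 21 = of_bool (length \<beta> < length (rlog C \<beta>)) \<Longrightarrow> Q s' t 0"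
  shows "WP layer Q s"
proof -
  let ?R = "rlog C \<alpha>"
  define ys where "ys = drop (length \<alpha>) ?R"
  have \<alpha>: "\<alpha> \<in> A" "\<alpha> = take (length \<alpha>) ?R" using q by (auto simp: queue_def)
  note rf = rlog_facts[OF \<alpha>(1)]
  have R: "?R = \<alpha> @ ys" using \<alpha>(2) unfolding ys_def by (metis append_take_drop_id)
  have ys: "ys \<noteq> []" "length ys = length ?R - length \<alpha>" using len by (auto simp: ys_def)
  have d: "distinct (\<alpha> @ ys)" using rf(1) R by simp
  have "set ys = set ?R - set \<alpha>" using d R by auto
  then have av: "set ys = {y \<in> \<Sigma> - set \<alpha>. p y (set \<alpha>)}" using rf(2) by auto
  let ?cs = "if length ys = 1 then cs @ ys else cs"
  have lay': "layered \<Sigma> p ?R ?cs (insert (hd ys) D)" using layered_step[OF lay d ys(1) av] R by simp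
  have hd: "?R ! length \<alpha> = hd ys" using R ys(1) by (simp add: nth_append hd_conv_nth)
  have csl: "length cs \<le> length \<alpha>"
  proof -
    have "set cs \<subseteq> set \<alpha>" "distinct cs" using lay by (auto simp: layered_def bottlenecks_def)
    then show ?thesis using rf(5) by (metis card_mono distinct_card finite_set)
  qed
  have s: "regs s 4 = S + length \<alpha>" "regs s 5 = S + length ?R" "regs s 8 = 2 * S + length cs" "regs s 19 = 1"
    "mem s (S + length \<alpha>) = hd ys"
    using q ch len hd by (auto simp: queue_def chain_def core_def)
  have sp: "S + length ?R < 2 ^ w" "Suc (2 * S + length cs) < 2 ^ w" using rf(3) csl len space S_def by auto
  have steps: "WP (WhileNZ 24 layer_step) W u"
    if u: "queue \<alpha> u" "regs u 6 = S + length ?R" "chain ?cs u" "regs u 24 = 1"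
      and W: "\<And>s' t. t + 30 * dscost C \<alpha> + 20 \<le> 30 * dscost C ?R \<Longrightarrow> queue ?R s' \<Longrightarrow> chain ?cs s' \<Longrightarrow> W s' t 0" for W u
  \<comment> \<open>Each step costs at least one unit of \<open>dscost\<close> and a layer has at
    least one step, so raising the factor from 8 to 30 pays for the constant overhead of a
    layer.\<close>
  proof (rule wp_WhileNZ[where m = "length ys" and I = "\<lambda>m s' t q. q = 0 \<and> (\<exists>\<beta>. length \<alpha> \<le> length \<beta> \<and> length \<beta> \<le> length ?R \<and>
      \<beta> = take (length \<beta>) ?R \<and> m = length ?R - length \<beta> \<and> queue \<beta> s' \<and> chain ?cs s' \<and> regs s' 6 = S + length ?R \<and>
      regs s' 24 = of_bool (length \<beta> < length ?R) \<and> t + 8 * dscost C \<alpha> \<le> 8 * dscost C \<beta> \<and>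
      length \<beta> + dscost C \<alpha> \<le> length \<alpha> + dscost C \<beta>)"], goal_cases)
    case 1
    show ?case by (rule conjI, simp, rule exI[of _ \<alpha>]) (use u ys len \<alpha> in simp)
  next
    case (2 m v t q)
    then obtain \<beta> where b: "length \<alpha> \<le> length \<beta>" "\<beta> = take (length \<beta>) ?R" "m = length ?R - length \<beta>" "queue \<beta> v" "chain ?cs v"
      "regs v 6 = S + length ?R" "length \<beta> < length ?R" "t + 8 * dscost C \<alpha> \<le> 8 * dscost C \<beta>"
      "length \<beta> + dscost C \<alpha> \<le> length \<alpha> + dscost C \<beta>" "q = 0" by (auto split: if_splits)
    obtain zs where zs: "rlog C \<beta> = ?R @ zs"
    proof -
      have "take (length \<alpha>) \<beta> = \<alpha>" using b(1,2) \<alpha>(2) by (metis min.absorb1 take_take)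
      then show ?thesis using rlog_take[of C \<beta> "length \<alpha>"] that by auto
    qed
    have x: "rlog C \<beta> ! length \<beta> = ?R ! length \<beta>" using zs b(7) by (simp add: nth_append)
    have "length ?R \<le> length (rlog C \<beta>)" using zs by simp
    then show ?case
    proof (rule wp_layer_step[OF b(4,6,7)], goal_cases)
      case (1 s' t' \<beta>')
      have bt: "\<beta>' = take (Suc (length \<beta>)) ?R"
        unfolding 1(1) x using b(7) by (subst b(2)) (simp add: take_Suc_conv_app_nth)
      have l: "length \<beta>' = Suc (length \<beta>)" using 1(1) by simp
      have "dscost C \<beta>' = dscost C \<beta> + cost C \<beta>'" using 1(1) by (simp add: dscost_snoc)
      moreover have "chain ?cs s'"
      proof -
        have "length ?cs \<le> Suc (length \<alpha>)" using csl by simp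
        then have "length ?cs < S" using len rf(3) S_def by simp
        then show ?thesis using 1(6,7) b(5) unfolding chain_def by simp
      qed
      ultimately show ?case using 1 b bt l
        by - (rule exI[of _ "length ?R - Suc (length \<beta>)"], rule conjI, simp, rule conjI, simp, rule exI[of _ \<beta>'], simp)
    qed
  next
    case (3 m v t q)
    then obtain \<beta> where b: "length \<beta> \<le> length ?R" "\<beta> = take (length \<beta>) ?R" "queue \<beta> v" "chain ?cs v"
      "\<not> length \<beta> < length ?R" "t + 8 * dscost C \<alpha> \<le> 8 * dscost C \<beta>"
      "length \<beta> + dscost C \<alpha> \<le> length \<alpha> + dscost C \<beta>" "q = 0" by (auto split: if_splits)
    have "\<beta> = ?R" using b(1,2,5) by (metis le_antisym not_less take_all_iff)
    then show ?case using b W[of "1 + t" v] len by simp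
  qed
  have queue_cong: "queue \<alpha> u" if "\<forall>j<length ?R. mem u (S + j) = mem s (S + j)" "hist u = hist s"
      "\<forall>r\<in>{0, 2, 3, 4, 5, 10, 12, 19}. regs u r = regs s r" for u
    using q that by (simp add: queue_def core_def)
  have fin: "Q s' t 0" if "t + 30 * dscost C \<alpha> \<le> 30 * dscost C ?R" "queue ?R s'" "chain ?cs s'"
      "regs s' 21 = of_bool (length ?R < length (rlog C ?R))" for s' t
    by (rule Q[OF that(1,2) lay' that(3)]) (use len that(4) in simp_all)
  have last: "Q (v\<lparr>regs := (regs v)(21 := of_bool (regs v 4 < regs v 5))\<rparr>) t 0"
    if "t + 30 * dscost C \<alpha> \<le> 30 * dscost C ?R" "queue ?R v" "chain ?cs v" for t v
  proof -
    have r: "regs v 4 = S + length ?R" "regs v 5 = S + length (rlog C ?R)" using that(2) by (auto simp: queue_def)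
    have "queue ?R (v\<lparr>regs := (regs v)(21 := of_bool (length ?R < length (rlog C ?R)))\<rparr>)"
      using that(2) unfolding queue_def core_def by simp
    then show ?thesis using that r by (intro fin) (simp_all add: chain_def)
  qed
  show ?thesis
  proof (cases "length ys = 1")
    case True
    then have "S + length ?R - (S + length \<alpha>) = 1" using ys by simp
    moreover have y: "ys = [hd ys]" using True ys(1) by (cases ys) auto
    moreover have ch1: "chain ?cs u"
      if u: "mem u = (mem s)(2 * S + length cs := hd ys)" "regs u 8 = Suc (2 * S + length cs)" for u
    proof -
      have "mem u (2 * S + j) = (cs @ [hd ys]) ! j" if "j < Suc (length cs)" for j
        using that ch u(1) by (cases "j = length cs") (auto simp: chain_def nth_append)
      then have "chain (cs @ [hd ys]) u" using u(2) by (simp add: chain_def)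
      then show ?thesis using True y by simp
    qed
    ultimately show ?thesis
      using s sp len True csl rf(3) n_S
      apply (simp add: layer_def wp_simps)
      apply (rule steps)
          apply (rule queue_cong; simp)
         apply simp
        apply (rule ch1; simp)
       apply simp
      apply (rule last; simp)
      done
  next
    case False
    then have "S + length ?R - (S + length \<alpha>) \<noteq> 1" using ys by simp
    then show ?thesis
      using s sp len False
      apply (simp add: layer_def wp_simps)
      apply (rule steps)
          apply (rule queue_cong; simp)
         apply simp
        apply (use ch in \<open>simp add: chain_def; fail\<close>)
       apply simp
      apply (rule last; simp)
      done
  qed
qed

text \<open>If letters were left over, \<open>\<pi>\<close> would contain one that is available at
  \<open>set \<beta>\<close>, and it would still be in the queue.\<close>

lemma exhausted_queue_perm:
  assumes \<beta>: "\<beta> \<in> A" and len: "\<not> length \<beta> < length (rlog C \<beta>)" and t: "\<beta> = take (length \<beta>) (rlog C \<beta>)"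
  shows "\<beta> \<in> antimatroid_perms \<Sigma> (mps_language \<Sigma> p)"
proof -
  note rf = rlog_facts[OF \<beta>]
  have "rlog C \<beta> = \<beta>" using len t by simp
  then have none: "{y \<in> \<Sigma> - set \<beta>. p y (set \<beta>)} = {}" using rf(2) by auto
  note pf = antimatroid_permsD[OF perm]
  have "set \<beta> = \<Sigma>"
  proof (rule ccontr)
    assume "set \<beta> \<noteq> \<Sigma>"
    then have "\<not> set \<pi> \<subseteq> set \<beta>" using pf(2) rf(4) by blast
    then show False using ex_available_in_word[OF mps pf(3) rf(4)] pf(2) none by blast
  qed
  then show ?thesis using \<beta> rf(5) by (simp add: antimatroid_perms_def permutations_of_set_def A_def)
qed

text \<open>The history \<open>\<sigma>\<close> of this run may differ from \<open>\<pi>\<close>; it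
  is some element of \<open>P(A)\<close>, which is all that the estimate of the number of
  non-bottlenecks requires. No comparison is spent.\<close>

lemma wp_layers:
  assumes s: "regs s 0 = card \<Sigma>"
    and Q: "\<And>s' t \<sigma> cs D. t \<le> 31 * dscost C \<sigma> + 14 \<Longrightarrow> core s' \<Longrightarrow> \<sigma> \<in> antimatroid_perms \<Sigma> (mps_language \<Sigma> p) \<Longrightarrow>
      layered \<Sigma> p \<sigma> cs D \<Longrightarrow> chain cs s' \<Longrightarrow> Q s' t 0"
  shows "WP layers Q s"
proof -
  have A0: "[] \<in> A" by (simp add: A_def Nil_in_mps_language)
  have len: "length (reports C []) \<le> card \<Sigma>" using rlog_facts(3)[OF A0] by simp
  have w: "0 < w" using space S_def by (cases w) auto
  have sp: "card \<Sigma> + 1 < 2 ^ w" "Suc (Suc (card \<Sigma>)) < 2 ^ w" "S + length (reports C []) < 2 ^ w"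
    "length (reports C []) < 2 ^ w" "6 * S < 2 ^ w" "4 * S < 2 ^ w" "2 * S < 2 ^ w" "S < 2 ^ w" "Suc (Suc (card \<Sigma>)) = S" "2 \<le> S"
    using space S_def len by auto
  have loop: "WP (WhileNZ 21 layer) W u"
    if u: "queue [] u" "chain [] u" "regs u 21 = of_bool (0 < length (rlog C []))"
      and W: "\<And>s' t \<sigma> cs D. t + 30 * cost C [] \<le> 31 * dscost C \<sigma> + 1 \<Longrightarrow> core s' \<Longrightarrow> \<sigma> \<in> antimatroid_perms \<Sigma> (mps_language \<Sigma> p) \<Longrightarrow>
        layered \<Sigma> p \<sigma> cs D \<Longrightarrow> chain cs s' \<Longrightarrow> W s' t 0" for W u
  proof (rule wp_WhileNZ[where m = "card \<Sigma>" and I = "\<lambda>m s' t q. q = 0 \<and> (\<exists>\<beta> cs D. m = card \<Sigma> - length \<beta> \<and>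
      queue \<beta> s' \<and> layered \<Sigma> p \<beta> cs D \<and> chain cs s' \<and> regs s' 21 = of_bool (length \<beta> < length (rlog C \<beta>)) \<and>
      t + 30 * cost C [] \<le> 30 * dscost C \<beta> + length \<beta>)"], goal_cases)
    case 1
    show ?case by (rule conjI, simp, rule exI[of _ "[]"], rule exI[of _ "[]"], rule exI[of _ "{}"]) (use u layered_Nil in simp)
  next
    case (2 m v t q)
    then obtain \<beta> cs D where b: "m = card \<Sigma> - length \<beta>" "queue \<beta> v" "layered \<Sigma> p \<beta> cs D" "chain cs v"
      "length \<beta> < length (rlog C \<beta>)" "t + 30 * cost C [] \<le> 30 * dscost C \<beta> + length \<beta>" "q = 0" by (auto split: if_splits)
    have "length (rlog C \<beta>) \<le> card \<Sigma>" using rlog_facts(3) b(2) by (simp add: queue_def)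
    then have lb: "length \<beta> < card \<Sigma>" using b(5) by simp
    show ?case
    proof (rule wp_layer[OF b(2,3,4,5)], goal_cases)
      case (1 s' t' \<beta>' cs' D')
      then show ?case using b lb
        by - (rule exI[of _ "card \<Sigma> - length \<beta>'"], rule conjI, simp, rule conjI, simp, rule exI[of _ \<beta>'], rule exI[of _ cs'], rule exI[of _ D'], simp)
    qed
  next
    case (3 m v t q)
    then obtain \<beta> cs D where b: "queue \<beta> v" "layered \<Sigma> p \<beta> cs D" "chain cs v"
      "\<not> length \<beta> < length (rlog C \<beta>)" "t + 30 * cost C [] \<le> 30 * dscost C \<beta> + length \<beta>" "q = 0" by (auto split: if_splits)
    have bA: "\<beta> \<in> A" "\<beta> = take (length \<beta>) (rlog C \<beta>)" "core v" using b(1) by (auto simp: queue_def)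
    have "length \<beta> < dscost C \<beta>" using rlog_props[OF mps ds] bA(1) A_def by fastforce
    then show ?case using W[of "1 + t" \<beta> v cs D] b bA exhausted_queue_perm[OF bA(1) b(4) bA(2)] by simp
  qed
  show ?thesis
    using s sp w
    apply (simp add: layers_def wp_simps wp_CallInit split del: split_of_bool)
    apply (rule loop)
       apply (simp add: queue_def core_def write_block_def A0)
      apply (simp add: chain_def)
     apply (simp split del: split_of_bool)
    apply (rule Q; simp)
    done
qed

end

section \<open>Bounding the costs\<close>

context sorting
begin

lemma avl_facts:
  assumes "b \<in> \<Sigma>"
  shows "avl b \<le> idx \<pi> b" "p b (set (take (avl b) \<pi>))" "j < avl b \<Longrightarrow> \<not> p b (set (take j \<pi>))"
proof -
  have "p b (set (take (idx \<pi> b) \<pi>))" using antimatroid_permsD(4)[OF perm] assms by simp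
  then show "avl b \<le> idx \<pi> b" "p b (set (take (avl b) \<pi>))" unfolding avl_def by (rule Least_le, rule LeastI)
  show "j < avl b \<Longrightarrow> \<not> p b (set (take j \<pi>))" unfolding avl_def by (rule not_less_Least)
qed

lemma rl_mono: "i \<le> j \<Longrightarrow> rl i \<le> rl j"
  using rlog_take[of C "take j \<pi>" i] by (auto simp: min_def)

lemma nb_le_card: "nb m \<le> card (\<Sigma> - set cs)"
proof -
  have "nb m = card (set (filter (\<lambda>y. y \<notin> set cs) (take m R)))"
    unfolding nb_def using R_facts(1) by (intro distinct_card[symmetric] distinct_filter distinct_take)
  also have "\<dots> \<le> card (\<Sigma> - set cs)"
    using fin R_facts(2) by (intro card_mono) (auto dest: in_set_takeD)
  finally show ?thesis .
qed

abbreviation "P \<equiv> card (antimatroid_perms \<Sigma> (mps_language \<Sigma> p))"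

text \<open>The summand 1 covers \<open>x = 0\<close>, where \<open>floor_log\<close> has the value
  0.\<close>

lemma floor_log_power_le: "2 ^ floor_log x \<le> x + 1"
  using floor_log_exp2_le[of x] by (cases "x = 0") auto

lemma two_power_sum: "finite B \<Longrightarrow> (2::nat) ^ sum f B = (\<Prod>b\<in>B. 2 ^ f b)"
  by (simp add: power_sum)

text \<open>The key interval of \<open>b\<close> runs from the insertions before its own to those
  made before its output. A letter output before \<open>b\<close> becomes available is chosen while
  \<open>b\<close> is still unreported, so its upper key is at most the lower key of
  \<open>b\<close>; this is the condition for moving all letters independently.\<close>

lemma sum_insb: "2 ^ (\<Sum>b\<in>\<Sigma> - set cs. floor_log (insb b)) \<le> 4 ^ card (\<Sigma> - set cs) * P"
proof -
  have "(2::nat) ^ (\<Sum>b\<in>\<Sigma> - set cs. floor_log (insb b)) \<le> (\<Prod>b\<in>\<Sigma> - set cs. nb (rl (idx \<pi> b)) - nb (idx R b) + 1)"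
    using fin floor_log_power_le by (auto simp: two_power_sum insb_def intro!: prod_mono)
  also have "\<dots> \<le> 4 ^ card (\<Sigma> - set cs) * P"
  proof (rule prod_key_intervals_le_card_perms[OF fin mps perm])
    show "nb (rl (idx \<pi> x)) \<le> nb (rl (idx \<pi> y))" if "idx \<pi> x < idx \<pi> y" for x y
      using that by (intro nb_mono rl_mono) simp
    fix b assume b: "b \<in> \<Sigma> - set cs"
    then have b\<Sigma>: "b \<in> \<Sigma>" by simp
    note av = avl_facts[OF b\<Sigma>]
    have bR: "b \<in> set R" using b\<Sigma> R_facts by simp
    have jn: "idx R b < n" using idx_less_length[OF bR] R_facts by simp
    have in_iff: "b \<in> set (rlog C (take k \<pi>)) \<longleftrightarrow> idx R b < rl k" for k
      using nth_in_rlog_iff[OF jn, of k] nth_idx[OF bR] by simp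
    have nt: "b \<notin> set (take k \<pi>)" if "k \<le> idx \<pi> b" for k
      using that in_set_take_iff_idx[OF perm_facts(1), of b k] by simp
    show "\<exists>j\<le>idx \<pi> b. p b (set (take j \<pi>)) \<and> (\<forall>y\<in>set (take j \<pi>). nb (rl (idx \<pi> y)) \<le> nb (idx R b))"
    proof (intro exI[of _ "avl b"] conjI ballI av(1,2) nb_mono)
      fix y assume "y \<in> set (take (avl b) \<pi>)"
      then have y: "idx \<pi> y < avl b" using in_set_take_iff_idx[OF perm_facts(1)] by blast
      then have "b \<notin> set (take (idx \<pi> y) \<pi>)" using nt av(1) by simp
      then have "b \<notin> set (rlog C (take (idx \<pi> y) \<pi>))" using av(3)[OF y] by (subst rlog_take_set) simp
      then show "rl (idx \<pi> y) \<le> idx R b" using in_iff by simp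
    qed
    have "p b (set (take (idx \<pi> b) \<pi>))" using antimatroid_permsD(4)[OF perm] b\<Sigma> by simp
    then have "b \<in> set (rlog C (take (idx \<pi> b) \<pi>))" using nt b\<Sigma> by (subst rlog_take_set) simp
    then have "idx R b < rl (idx \<pi> b)" using in_iff by simp
    then show "nb (idx R b) \<le> nb (rl (idx \<pi> b)) \<and> nb (rl (idx \<pi> b)) \<le> card (\<Sigma> - set cs)"
      by (intro conjI nb_mono nb_le_card) simp
  qed simp
  finally show ?thesis .
qed

text \<open>Here the bottlenecks serve as the letters held in place and each other letter ranges
  over the places since it became available, so the product bound holds without a loss
  factor.\<close>

lemma sum_dst: "2 ^ (\<Sum>b\<in>\<Sigma> - set cs. floor_log (dst b + 1)) \<le> P"
proof -
  have le: "2 ^ floor_log (dst b + 1) \<le> dst b + 1" for b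
    using floor_log_exp2_le[of "dst b + 1"] by simp
  have "(2::nat) ^ (\<Sum>b\<in>\<Sigma> - set cs. floor_log (dst b + 1)) \<le> (\<Prod>b\<in>\<Sigma> - set cs. dst b + 1)"
    using fin le by (auto simp: two_power_sum intro!: prod_mono)
  also have "\<dots> \<le> P"
    unfolding dst_def cc_def
    by (rule prod_moves_le_card_perms[OF fin mps perm cs_facts(2)]) (simp add: avl_facts)
  finally show ?thesis .
qed

lemma P_pos: "0 < P"
  using perm finite_antimatroid_perms[OF fin] by (auto simp: card_gt_0_iff)

lemma power2_le_imp_le_log: "2 ^ a \<le> b \<Longrightarrow> real a \<le> log 2 (real b)"
proof -
  assume "2 ^ a \<le> b"
  then have "(2::real) ^ a \<le> real b" by (metis of_nat_le_iff of_nat_numeral of_nat_power)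
  moreover have "0 < (2::real) ^ a" by simp
  ultimately have "0 < real b" by linarith
  then show ?thesis using \<open>2 ^ a \<le> real b\<close> by (subst le_log_iff) (simp_all add: powr_realpow)
qed

text \<open>Per non-bottleneck the constants are 2 for insertion, 6 for deletion and 1 for the
  search, which gives \<open>9 * ?m + 4 * ?I + 2 * ?D\<close>. With \<open>?m \<le> 2 * ?L\<close>,
  \<open>?I \<le> 5 * ?L\<close> and \<open>?D \<le> ?L\<close> this is 18 + 20 + 2 = 40 times
  \<open>?L\<close>.\<close>

lemma budget_le:
  assumes m: "2 ^ card (\<Sigma> - set cs) \<le> P\<^sup>2" and G: "G \<subseteq> \<Sigma> - set cs"
  shows "real (budget n G) \<le> 40 * log 2 P"
proof -
  let ?m = "card (\<Sigma> - set cs)" and ?L = "log 2 (real P)"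
  let ?I = "\<Sum>b\<in>\<Sigma> - set cs. floor_log (insb b)" and ?D = "\<Sum>b\<in>\<Sigma> - set cs. floor_log (dst b + 1)"
  have "real ?m \<le> log 2 (real (P\<^sup>2))" by (rule power2_le_imp_le_log[OF m])
  also have "\<dots> = 2 * ?L" using P_pos by (simp add: log_nat_power)
  finally have 1: "real ?m \<le> 2 * ?L" .
  have "real ?I \<le> log 2 (real (4 ^ ?m * P))" by (rule power2_le_imp_le_log[OF sum_insb])
  also have "\<dots> = log 2 (4 ^ ?m) + ?L" using P_pos by (simp add: log_mult)
  also have "log 2 (4 ^ ?m) = 2 * real ?m"
    using log_nat_power[of 4 2 ?m] log_nat_power[of 2 2 2] by simp
  finally have 2: "real ?I \<le> 2 * real ?m + ?L" .
  have 3: "real ?D \<le> ?L" by (rule power2_le_imp_le_log[OF sum_dst])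
  have "set (take n \<pi>) - set cs = \<Sigma> - set cs" using perm_facts by simp
  then have "budget n G \<le> 2 * ?m + sum pop_cost (\<Sigma> - set cs) + sum search_cost (\<Sigma> - set cs)"
    unfolding budget_def using nb_le_card[of "rl n"] sum_mono2[OF _ G, of search_cost] fin by simp
  also have "\<dots> = 2 * ?m + (4 * ?I + 6 * ?m) + (2 * ?D + ?m)"
    unfolding pop_cost_def search_cost_def by (simp only: sum.distrib sum_distrib_left[symmetric] sum_constant) simp
  finally have "budget n G \<le> 9 * ?m + 4 * ?I + 2 * ?D" by simp
  then have "real (budget n G) \<le> real (9 * ?m + 4 * ?I + 2 * ?D)" by (simp only: of_nat_le_iff)
  also have "\<dots> = 9 * real ?m + 4 * real ?I + 2 * real ?D" by simp
  finally show ?thesis using 1 2 3 by linarith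
qed

end

section \<open>The complete program\<close>

definition sort_program :: com where
  "sort_program = block [layering.layers, sorting.setup_run, sorting.main_loop]"

lemma wp_sort_program:
  assumes fin: "finite \<Sigma>" and space: "32 * (card \<Sigma> + 1) \<le> 2 ^ w" and s: "regs s 0 = card \<Sigma>"
    and mps: "mps \<Sigma> p" and A: "A = mps_language \<Sigma> p" and ds: "is_candidate_ds \<Sigma> p C"
    and perm: "\<pi> \<in> antimatroid_perms \<Sigma> A"
  shows "wp w A C \<pi> sort_program (\<lambda>s' t q. output_word (card \<Sigma>) s' = \<pi> \<and>
    real t \<le> 5000 * (real (total_time A C) + log 2 (real (card (antimatroid_perms \<Sigma> A)))) \<and>
    real q \<le> 40 * log 2 (real (card (antimatroid_perms \<Sigma> A)))) s"
proof -
  let ?S = "card \<Sigma> + 2"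
  define lt where "lt = (\<lambda>e. rlog C \<pi> ! (e - 3 * ?S))"
  let ?T = "total_time A C" and ?L = "log 2 (real (card (antimatroid_perms \<Sigma> A)))"
  have perm': "\<pi> \<in> antimatroid_perms \<Sigma> (mps_language \<Sigma> p)" using perm A by simp
  \<comment> \<open>The word size is needed for \<open>10 * (n + 2)\<close> addresses;
    \<open>32 * (n + 1)\<close> exceeds this for every \<open>n\<close>.\<close>
  have sp: "10 * ?S < 2 ^ w" using space by simp
  interpret lay: layering w A C \<pi> ?S \<Sigma> p
    by unfold_locales (use sp fin mps A ds perm' in auto)
  have finA: "finite A" using finite_mps_language[OF fin] A by simp
  have T: "dscost C \<alpha> \<le> ?T" if "\<alpha> \<in> A" for \<alpha> by (rule dscost_le_total_time[OF finA that])
  show ?thesis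
    unfolding sort_program_def
    apply (simp only: lay.wp_Cons)
    apply (rule lay.wp_layers[OF s])
    subgoal premises prems for s1 t1 \<sigma> cs D
    proof -
      note pf = antimatroid_permsD[OF perm'] and sf = antimatroid_permsD[OF prems(3)]
      interpret sorting w A C \<pi> ?S lt \<Sigma> p cs
      proof unfold_locales
        show "bottlenecks \<Sigma> p \<Sigma> cs" using prems(4) sf(2) by (simp add: layered_def)
      qed (use sp pf fin mps A ds perm' lt_def in auto)
      have env: "env s1" using prems(2) unfolding env_def lay.core_def by simp
      have m: "2 ^ card (\<Sigma> - set cs) \<le> P\<^sup>2" by (rule layered_card[OF fin mps prems(3,4)])
      have r: "regs s1 0 = n" "regs s1 8 = 2 * ?S + length cs" using prems(2,5) unfolding lay.core_def lay.chain_def by simp_all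
      have ch: "mem s1 (2 * ?S + j) = cs ! j" if "j < length cs" for j using prems(5) that unfolding lay.chain_def by simp
      show ?thesis
      proof (rule wp_setup_run[OF env r ch], goal_cases)
        case (2 s2 t2 q2 L)
        show ?case
        proof (rule wp_main_loop[OF 2(3)], goal_cases)
          case (1 s3 t3 q3 G)
          have b: "real (budget n G) \<le> 40 * ?L" using budget_le[OF m 1(3)] A by simp
          have "output_word n s3 = \<pi>"
            unfolding output_word_def using 1(4) perm_facts(3) by (intro nth_equalityI) auto
          moreover have q: "q2 + q3 \<le> budget n G" using 1(2) 2(2) by simp
          moreover have "real (t1 + (t2 + (t3 + 1))) \<le> 5000 * (real ?T + ?L)"
          proof -
            have "\<sigma> \<in> A" "\<pi> \<in> A" using sf(3) pf(3) A by auto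
            then have "dscost C \<sigma> \<le> ?T" "dscost C \<pi> \<le> ?T" using T by auto
            moreover have "n < dscost C \<pi>" using rlog_props[OF mps ds pf(3)] perm_facts(3) by simp
            \<comment> \<open>Constants and terms linear in \<open>n\<close> are absorbed through
              \<open>n < dscost C \<pi>\<close>. The factor 5000 is generous; the budget itself
              contributes 100 * 40 times the logarithm.\<close>
            ultimately have "t1 + (t2 + (t3 + 1)) \<le> 5000 * ?T + 100 * budget n G"
              using 1(1) 2(1) prems(1) by simp
            then have "real (t1 + (t2 + (t3 + 1))) \<le> real (5000 * ?T + 100 * budget n G)" by (simp only: of_nat_le_iff)
            also have "\<dots> = 5000 * real ?T + 100 * real (budget n G)" by simp
            finally show ?thesis using b by (simp add: algebra_simps)
          qed
          ultimately show ?case using b by (simp add: lay.wp_Nil)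
        qed
      qed simp
    qed
    done
qed

theorem theorem9:
  shows "\<exists>(prog :: com) (K :: nat) (ct :: real) (cq :: real).
    \<forall>(w :: nat) (\<Sigma> :: nat set) (xs :: nat list) (A :: nat list set)
      (p :: nat \<Rightarrow> nat set \<Rightarrow> bool) (C :: nat candidate_ds) (\<pi> :: nat list) (s :: state).
      finite \<Sigma> \<longrightarrow> \<Sigma> \<subseteq> {..<2 ^ w} \<longrightarrow> K * (card \<Sigma> + 1) \<le> 2 ^ w \<longrightarrow>
      set xs = \<Sigma> \<longrightarrow> distinct xs \<longrightarrow> input_state w xs s \<longrightarrow>
      antimatroid \<Sigma> A \<longrightarrow> mps \<Sigma> p \<longrightarrow> A = mps_language \<Sigma> p \<longrightarrow>
      is_candidate_ds \<Sigma> p C \<longrightarrow> \<pi> \<in> antimatroid_perms \<Sigma> A \<longrightarrow>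
      (\<exists>s' t q. exec w A C \<pi> prog s s' t q \<and>
         output_word (card \<Sigma>) s' = \<pi> \<and>
         real t \<le> ct * (real (total_time A C) + log 2 (real (card (antimatroid_perms \<Sigma> A)))) \<and>
         real q \<le> cq * log 2 (real (card (antimatroid_perms \<Sigma> A))))"
proof (rule exI[of _ sort_program], rule exI[of _ 32], rule exI[of _ 5000], rule exI[of _ 40], intro allI impI)
  fix w \<Sigma> xs A p C \<pi> s
  assume "finite \<Sigma>" "32 * (card \<Sigma> + 1) \<le> (2::nat) ^ w" "set xs = \<Sigma>" "distinct xs" "input_state w xs s"
    "mps \<Sigma> p" "A = mps_language \<Sigma> p" "is_candidate_ds \<Sigma> p C" "\<pi> \<in> antimatroid_perms \<Sigma> A"
  moreover from this have "regs s 0 = card \<Sigma>" by (auto simp: input_state_def distinct_card)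
  ultimately show "\<exists>s' t q. exec w A C \<pi> sort_program s s' t q \<and>
         output_word (card \<Sigma>) s' = \<pi> \<and>
         real t \<le> 5000 * (real (total_time A C) + log 2 (real (card (antimatroid_perms \<Sigma> A)))) \<and>
         real q \<le> 40 * log 2 (real (card (antimatroid_perms \<Sigma> A)))"
    using wp_sort_program unfolding wp_def by blast
qed

end
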